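(* Consider the sequence of passive random intersection graphs $G_1^*(n,m,P)$, $n=1,2,\dots$, with $m=m_n$, $P=P_n$, and put $\beta_n=m/n$. Let $m,n\to\infty$. Assume that $\beta_n\to\beta\in(0,+\infty)$, that $X_1$ converges in distribution to a random variable $Z$, that $\mathbf{P}(Z\ge 2)>0$, $\mathbf{E}Z^4<\infty$ and $\lim_{m\to\infty}\mathbf{E}X_1^4=\mathbf{E}Z^4$. Then $$b=1+\beta_n^{-1}y_2+y_2^{-1}y_3+O(n^{-1})=\delta_{*2}\delta_{*1}^{-1}+o(1),$$ $$h=y_2^{-1}y_3+O(n^{-1})=\delta_{*2}\delta_{*1}^{-1}-1-\delta_{*1}+o(1).$$ Assuming, in addition, that $\mathbf{P}(d_{**}=k)>0$, where $k>0$ is an integer, we have $$h_k=k^{-1}\mathbf{E}(d_{2*}\mid d_{**}=k)+o(1),$$ $$b_k=1+\beta^{-1}y_2+h_k+o(1)=1+\delta_{*1}+h_k+o(1).$$ Here $d_{2*}=\sum_{1\le i\le\Lambda}(\tilde Z_i)_2$.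
   Context: Passive random intersection graph $G_1^*(n,m,P)$: let $W=\{w_1,\dots,w_m\}$ and let $P$ be a probability distribution on $\{0,1,\dots,m\}$. Let $D_1,\dots,D_n$ be independent identically distributed random subsets of $W$ with $\mathbf{P}(D_i=A)=\binom{m}{|A|}^{-1}P(|A|)$ for each $A\subset W$. Put $X_i=|D_i|$ (i.i.d. with distribution $P$). The vertex set is $W$, and distinct $w_i,w_j$ are adjacent, $w_i\sim w_j$, iff $w_i,w_j\in D_k$ for some $1\le k\le n$. Both $m=m_n$ and $P=P_n$ depend on $n$. Let $d(w)$ denote the degree of $w$ and $d(w,w')$ the number of common neighbours of $w$ and $w'$. Let $(v_1^*,v_2^* )$ be an ordered pair of distinct vertices (elements of $W$) drawn uniformly at random, independently of the random graph. Let $\mathbf{E}^*$ denote conditional expectation given $v_1^*\sim v_2^*$, and $\mathbf{E}^{*k}$ conditional expectation given $v_1^*\sim v_2^*$ and $d(v_2^* )=k$ (with respect to both the random graph and the random pair). Then $$b=\mathbf{E}^*d(v_1^* ),\quad h=\mathbf{E}^*d(v_1^*,v_2^* ),\quad b_k=\mathbf{E}^{*k}d(v_1^* ),\quad h_k=\mathbf{E}^{*k}d(v_1^*,v_2^* ).$$ Notation: $(x)_i=x(x-1)\cdots(x-i+1)$; $y_i=\mathbf{E}(X_1)_i$ (depends on $n$). Let $d_{**}=\sum_{j=1}^{\Lambda}\tilde Z_j$, where $\tilde Z_1,\tilde Z_2,\dots$ are i.i.d. with $\mathbf{P}(\tilde Z_1=j)=(j+1)\mathbf{P}(Z=j+1)/\mathbf{E}Z$,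 $j=0,1,\dots$, and $\Lambda$ is independent of the sequence $\tilde Z_1,\tilde Z_2,\dots$ and has the Poisson distribution with mean $\beta^{-1}\mathbf{E}Z$. Then $\delta_{*i}=\mathbf{E}d_{**}^i$. The variables $d_{2*}$ and $d_{**}$ are built from the same $\Lambda$ and $\tilde Z_i$. Asymptotic symbols refer to $n\to\infty$ with $k$ fixed. *)

theory Defs
  imports "HOL-Probability.Probability" "HOL-Library.Landau_Symbols"
begin

definition falling_factorial :: "real \<Rightarrow> nat \<Rightarrow> real" where
  "falling_factorial x i = (\<Prod>j<i. x - real j)"

definition factorial_moment :: "nat pmf \<Rightarrow> nat \<Rightarrow> real" where
  "factorial_moment p i = measure_pmf.expectation p (\<lambda>x. falling_factorial (real x) i)"


subsection \<open>The passive random intersection graph\<close>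

text \<open>The attribute set \<open>W\<close> is \<open>{..<m}\<close>. A random subset is drawn by first drawing its size
  from \<open>P\<close>; lemma \<open>pmf_random_subset\<close> gives the resulting point probabilities.\<close>

definition random_subset :: "nat \<Rightarrow> nat pmf \<Rightarrow> nat set pmf" where
  "random_subset m P = bind_pmf P (\<lambda>s. pmf_of_set {A. A \<subseteq> {..<m} \<and> card A = s})"

lemma pmf_random_subset:
  assumes supp: "set_pmf P \<subseteq> {..m}" and A: "A \<subseteq> {..<m}"
  shows "pmf (random_subset m P) A = pmf P (card A) / real (m choose card A)"
proof -
  have fin: "finite {B. B \<subseteq> {..<m} \<and> card B = s}" for s
    by (rule finite_subset[of _ "Pow {..<m}"]) auto
  have card: "card {B. B \<subseteq> {..<m} \<and> card B = s} = m choose s" for s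
    using n_subsets[of "{..<m}" s] by simp
  have ne: "{B. B \<subseteq> {..<m} \<and> card B = s} \<noteq> {}" if "s \<le> m" for s
    using card[of s] that by (metis card.empty zero_less_binomial less_irrefl)
  have "pmf (random_subset m P) A =
      measure_pmf.expectation P (\<lambda>s. pmf (pmf_of_set {B. B \<subseteq> {..<m} \<and> card B = s}) A)"
    by (simp add: random_subset_def pmf_bind)
  also have "\<dots> = measure_pmf.expectation P
      (\<lambda>s. indicator {card A} s * (1 / real (m choose card A)))"
  proof (rule integral_cong_AE)
    show "AE s in measure_pmf P. pmf (pmf_of_set {B. B \<subseteq> {..<m} \<and> card B = s}) A =
        indicator {card A} s * (1 / real (m choose card A))"
      using supp A by (auto simp: AE_measure_pmf_iff pmf_of_set[OF ne fin] card indicator_def)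
  qed simp_all
  also have "\<dots> = pmf P (card A) / real (m choose card A)"
    by (simp add: measure_pmf_single)
  finally show ?thesis .
qed

definition ordered_pairs :: "nat \<Rightarrow> (nat \<times> nat) set" where
  "ordered_pairs m = {(v, w). v < m \<and> w < m \<and> v \<noteq> w}"

text \<open>A sample point \<open>(D, v\<^sub>1, v\<^sub>2)\<close> consists of the independent random sets
  \<open>D 0, \<dots>, D (n - 1)\<close> and an independent uniformly random ordered pair of distinct vertices.\<close>

definition passive_model :: "nat \<Rightarrow> nat \<Rightarrow> nat pmf \<Rightarrow> ((nat \<Rightarrow> nat set) \<times> nat \<times> nat) pmf" where
  "passive_model n m P =
     pair_pmf (Pi_pmf {..<n} {} (\<lambda>_. random_subset m P)) (pmf_of_set (ordered_pairs m))"

definition adjacent :: "nat \<Rightarrow> (nat \<Rightarrow> nat set) \<Rightarrow> nat \<Rightarrow> nat \<Rightarrow> bool" where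
  "adjacent n D v w \<longleftrightarrow> v \<noteq> w \<and> (\<exists>k<n. v \<in> D k \<and> w \<in> D k)"

definition deg :: "nat \<Rightarrow> nat \<Rightarrow> (nat \<Rightarrow> nat set) \<Rightarrow> nat \<Rightarrow> nat" where
  "deg n m D v = card {u \<in> {..<m}. adjacent n D v u}"

definition common_deg :: "nat \<Rightarrow> nat \<Rightarrow> (nat \<Rightarrow> nat set) \<Rightarrow> nat \<Rightarrow> nat \<Rightarrow> nat" where
  "common_deg n m D v w = card {u \<in> {..<m}. adjacent n D v u \<and> adjacent n D w u}"

text \<open>Conditional expectation given an event; meaningful only if the event has positive
  probability.\<close>

definition expectation_given :: "'a pmf \<Rightarrow> 'a set \<Rightarrow> ('a \<Rightarrow> real) \<Rightarrow> real" where
  "expectation_given p A f = measure_pmf.expectation (cond_pmf p A) f"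

definition b_mean :: "nat \<Rightarrow> nat \<Rightarrow> nat pmf \<Rightarrow> real" where
  "b_mean n m P = expectation_given (passive_model n m P)
     {(D, v1, v2). adjacent n D v1 v2} (\<lambda>(D, v1, v2). real (deg n m D v1))"

definition h_mean :: "nat \<Rightarrow> nat \<Rightarrow> nat pmf \<Rightarrow> real" where
  "h_mean n m P = expectation_given (passive_model n m P)
     {(D, v1, v2). adjacent n D v1 v2} (\<lambda>(D, v1, v2). real (common_deg n m D v1 v2))"

definition b_mean_deg :: "nat \<Rightarrow> nat \<Rightarrow> nat \<Rightarrow> nat pmf \<Rightarrow> real" where
  "b_mean_deg k n m P = expectation_given (passive_model n m P)
     {(D, v1, v2). adjacent n D v1 v2 \<and> deg n m D v2 = k}
     (\<lambda>(D, v1, v2). real (deg n m D v1))"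

definition h_mean_deg :: "nat \<Rightarrow> nat \<Rightarrow> nat \<Rightarrow> nat pmf \<Rightarrow> real" where
  "h_mean_deg k n m P = expectation_given (passive_model n m P)
     {(D, v1, v2). adjacent n D v1 v2 \<and> deg n m D v2 = k}
     (\<lambda>(D, v1, v2). real (common_deg n m D v1 v2))"


subsection \<open>The limiting compound Poisson variables\<close>

text \<open>The law of \<open>Z\<close> is a \<open>nat pmf\<close>. The variables \<open>Z~\<^sub>j\<close> have its size-biased
  law shifted by one; the mean of \<open>Z\<close> has to be finite and positive.\<close>

definition size_biased :: "nat pmf \<Rightarrow> nat pmf" where
  "size_biased Z =
     embed_pmf (\<lambda>j. (real j + 1) * pmf Z (j + 1) / measure_pmf.expectation Z real)"

lemma pmf_size_biased:
  assumes int: "integrable (measure_pmf Z) real"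
    and pos: "measure_pmf.expectation Z real > 0"
  shows "pmf (size_biased Z) j = (real j + 1) * pmf Z (j + 1) / measure_pmf.expectation Z real"
  unfolding size_biased_def
proof (rule pmf_embed_pmf)
  let ?E = "measure_pmf.expectation Z real"
  show "0 \<le> (real j + 1) * pmf Z (j + 1) / ?E" for j
    using pos by simp
  define g where "g = (\<lambda>i. ennreal (pmf Z i) * ennreal (real i))"
  have "(\<integral>\<^sup>+ j. ennreal ((real j + 1) * pmf Z (j + 1) / ?E) \<partial>count_space UNIV)
      = (\<integral>\<^sup>+ j. g (Suc j) * ennreal (1 / ?E) \<partial>count_space UNIV)"
  proof (intro nn_integral_cong)
    fix j :: nat
    have mult3: "ennreal (a * b * c) = ennreal a * ennreal b * ennreal c"
      if "0 \<le> a" "0 \<le> b" "0 \<le> c" for a b c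
      using that by (simp add: ennreal_mult)
    have "g (Suc j) * ennreal (1 / ?E) = ennreal (pmf Z (Suc j) * real (Suc j) * (1 / ?E))"
      using pos mult3[of "pmf Z (Suc j)" "real (Suc j)" "1 / ?E"] by (simp add: g_def)
    also have "pmf Z (Suc j) * real (Suc j) * (1 / ?E) = (real j + 1) * pmf Z (j + 1) / ?E"
      by (simp add: algebra_simps add_divide_distrib)
    finally show "ennreal ((real j + 1) * pmf Z (j + 1) / ?E) = g (Suc j) * ennreal (1 / ?E)" ..
  qed
  also have "\<dots> = (\<integral>\<^sup>+ j. g (Suc j) \<partial>count_space UNIV) * ennreal (1 / ?E)"
    by (simp add: nn_integral_multc)
  also have "(\<integral>\<^sup>+ j. g (Suc j) \<partial>count_space UNIV) = (\<integral>\<^sup>+ i. g i \<partial>count_space UNIV)"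
  proof -
    have "(\<integral>\<^sup>+ i. g i \<partial>count_space UNIV) = (\<Sum>i. g i)"
      by (simp add: nn_integral_count_space_nat)
    also have "\<dots> = (\<Sum>i. g (i + 1)) + (\<Sum>i<1. g i)"
      by (rule suminf_offset) simp
    also have "\<dots> = (\<integral>\<^sup>+ j. g (Suc j) \<partial>count_space UNIV)"
      by (simp add: nn_integral_count_space_nat g_def)
    finally show ?thesis by simp
  qed
  also have "(\<integral>\<^sup>+ i. g i \<partial>count_space UNIV) = (\<integral>\<^sup>+ i. ennreal (real i) \<partial>measure_pmf Z)"
    by (simp add: g_def nn_integral_measure_pmf)
  also have "\<dots> = ennreal ?E"
    using int by (intro nn_integral_eq_integral) auto
  also have "ennreal ?E * ennreal (1 / ?E) = 1"
    using pos by (simp flip: ennreal_mult' ennreal_mult'')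
  finally show "(\<integral>\<^sup>+ j. ennreal ((real j + 1) * pmf Z (j + 1) / ?E) \<partial>count_space UNIV) = 1" .
qed

text \<open>Joint law of \<open>\<Lambda>\<close> and of the first \<open>\<Lambda>\<close> members of the i.i.d. sequence; the
  later members do not enter \<open>d_ss\<close> and \<open>d_2s\<close>, and are replaced by 0.\<close>

definition limit_model :: "real \<Rightarrow> nat pmf \<Rightarrow> (nat \<times> (nat \<Rightarrow> nat)) pmf" where
  "limit_model \<beta> Z =
     bind_pmf (poisson_pmf (measure_pmf.expectation Z real / \<beta>)) (\<lambda>L.
       map_pmf (\<lambda>z. (L, z)) (Pi_pmf {..<L} 0 (\<lambda>_. size_biased Z)))"

definition d_ss :: "nat \<times> (nat \<Rightarrow> nat) \<Rightarrow> nat" where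
  "d_ss = (\<lambda>(L, z). \<Sum>j<L. z j)"

definition d_2s :: "nat \<times> (nat \<Rightarrow> nat) \<Rightarrow> real" where
  "d_2s = (\<lambda>(L, z). \<Sum>j<L. falling_factorial (real (z j)) 2)"

definition delta_s :: "real \<Rightarrow> nat pmf \<Rightarrow> nat \<Rightarrow> real" where
  "delta_s \<beta> Z i = measure_pmf.expectation (limit_model \<beta> Z) (\<lambda>\<omega>. real (d_ss \<omega>) ^ i)"

end

theory Submission
  imports Defs
begin

text \<open>Why the theorem holds. Write \<open>q\<close> and \<open>r\<close> for the probabilities that one random set contains two, respectively
three, prescribed vertices; they have orders \<open>n\<^sup>-\<^sup>2\<close> and \<open>n\<^sup>-\<^sup>3\<close>. The \<open>n\<close> sets are independent, so
inclusion-exclusion over the missing edges gives the exact probabilities of an edge, of a path with two edges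
and of a triangle as combinations of the three powers \<open>(1 - q)^n\<close>, \<open>(1 - 2q + r)^n\<close>, \<open>(1 - 3q + 2r)^n\<close>.
Both unconditional means are exact quotients, \<open>b = 1 + (m - 2) path / edge\<close> and
\<open>h = (m - 2) triangle / edge\<close> (\<open>b_mean_eq\<close>, \<open>h_mean_eq\<close>). Expanding the powers to second order with an
error of third order leaves \<open>edge = n q\<close>, \<open>path = n r + (n q)\<^sup>2\<close> and \<open>triangle = n r\<close> up to one factor \<open>1/n\<close>,
and \<open>(m - 2) r / q = y\<^sub>3 / y\<^sub>2\<close> holds exactly. The limits follow, because pointwise convergence of the
laws together with convergence of fourth moments yields convergence of the lower factorial moments.

For the means given \<open>d(v\<^sub>2) = k\<close>, sum first over \<open>v\<^sub>1\<close>. The conditioning event then has weight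
\<open>k \<cdot> P(d(v) = k)\<close>; the common neighbours become the ordered pairs of neighbours of \<open>v\<close> that are
adjacent, and \<open>d(v\<^sub>1)\<close> splits into \<open>1\<close> for \<open>v\<close> itself, the common neighbours, and the remaining
neighbours of \<open>v\<^sub>1\<close>, which are not adjacent to \<open>v\<close> (\<open>h_mean_deg_eq\<close>, \<open>b_mean_deg_eq\<close>). Three comparisons handle the pieces.

\<^item> Up to events of probability \<open>O(1/n)\<close>, the degree of \<open>v\<close> is the sum over the sets \<open>D\<close> containing \<open>v\<close> of
  \<open>|D| - 1\<close>, and the number of adjacent ordered pairs is the sum of \<open>(|D| - 1)\<^sub>2\<close>. The errors come from nonnegative
  overcounts, so it is enough to compare expectations, and these are known exactly. On the event that the degree is \<open>k\<close> both counts
  are at most \<open>k\<^sup>2\<close>, which takes the place of uniform integrability (\<open>triangles_close\<close>).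

\<^item> The sums over sets are sums of \<open>n\<close> independent terms, and they converge to the compound Poisson model. Both models
  satisfy the same identity: weighting a configuration by \<open>\<Sum> f(x\<^sub>i)\<close> amounts to inserting one extra term
  \<open>y\<close> with weight \<open>f(y)\<close> (\<open>nn_integral_iid_sum_palm\<close>, \<open>nn_integral_palm\<close>). With \<open>f = id\<close> the identity is a recursion
  in \<open>k\<close> for the point masses, which carries convergence from \<open>0\<close> to all \<open>k\<close>; with
  \<open>f(y) = (y)\<^sub>2\<close> it expresses the numerator of \<open>h\<^sub>k\<close> by the same point masses; and in the limit model
  it also yields the moments \<open>\<delta>\<^sub>*\<^sub>1\<close> and \<open>\<delta>\<^sub>*\<^sub>2\<close>.

\<^item> An edge from \<open>v\<^sub>1\<close> to a vertex \<open>u\<close> that is not a neighbour of \<open>v\<close> comes from a set that avoids \<open>v\<close>. Such a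
  set is independent of everything that determines the neighbourhood of \<open>v\<close>, so these edges contribute the
  factor \<open>n (m - 2) (q - r)\<close>, whose limit is \<open>\<delta>\<^sub>*\<^sub>1\<close>, times the probability of the conditioning event (\<open>open_paths_close\<close>).\<close>

section \<open>Falling factorials and powers\<close>

lemma falling_factorial_2: "falling_factorial (real z) 2 = real z * real (z - 1)"
  by (cases z) (auto simp: falling_factorial_def numeral_2_eq_2)

lemma falling_factorial_3: "falling_factorial (real z) 3 = real z * real (z - 1) * real (z - 2)"
proof (cases "z \<ge> 2")
  case False
  then have "z = 0 \<or> z = 1" by auto
  then show ?thesis by (auto simp: falling_factorial_def numeral_3_eq_3)
qed (auto simp: falling_factorial_def numeral_3_eq_3)

lemma falling_factorial_eq_choose: "falling_factorial (real z) i = fact i * real (z choose i)"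
  by (simp add: falling_factorial_def binomial_gbinomial gbinomial_prod_rev atLeast0LessThan)

lemma falling_factorial_nonneg: "0 \<le> falling_factorial (real z) i"
  by (simp add: falling_factorial_eq_choose)

text \<open>The reason why fourth moments dominate everything below: all factorial moments of order at most four converge with them.\<close>

lemma falling_factorial_le_power4:
  assumes "1 \<le> i" "i \<le> 4"
  shows "\<bar>falling_factorial (real z) i\<bar> \<le> real z ^ 4"
proof (cases "z = 0")
  case True
  then show ?thesis using assms falling_factorial_eq_choose[of 0 i] by (simp add: binomial_eq_0)
next
  case False
  have "falling_factorial (real z) i \<le> real z ^ i"
  proof (cases "i \<le> z")
    case True
    then show ?thesis
      unfolding falling_factorial_def using prod_mono[of "{..<i}" "\<lambda>j. real z - real j" "\<lambda>_. real z"]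
      by auto
  qed (simp add: falling_factorial_eq_choose binomial_eq_0)
  also have "\<dots> \<le> real z ^ 4"
    using False assms by (intro power_increasing) auto
  finally show ?thesis using falling_factorial_nonneg[of z i] by simp
qed

lemma falling_factorial_real:
  "falling_factorial x (Suc 0) = x" "falling_factorial x 2 = x * (x - 1)"
  "falling_factorial x 3 = x * (x - 1) * (x - 2)"
  by (simp_all add: falling_factorial_def numeral_2_eq_2 numeral_3_eq_3)

text \<open>The next two lemmas are the Bonferroni inequalities of orders two and three for \<open>n\<close> independent events of probability \<open>x\<close>.\<close>

lemma one_minus_power_le:
  fixes x :: real
  assumes "0 \<le> x" "x \<le> 1"
  shows "(1 - x) ^ n \<le> 1 - n * x + n * (real n - 1) / 2 * x\<^sup>2"
proof (induction n)
  case (Suc n)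
  have "(1 - x) ^ Suc n \<le> (1 - x) * (1 - n * x + n * (real n - 1) / 2 * x\<^sup>2)"
    using mult_left_mono[OF Suc, of "1 - x"] assms by simp
  also have "\<dots> = 1 - Suc n * x + Suc n * (real (Suc n) - 1) / 2 * x\<^sup>2
      - (n * (real n - 1) / 2) * x ^ 3"
    by (simp add: field_simps power2_eq_square power3_eq_cube)
  also have "\<dots> \<le> 1 - Suc n * x + Suc n * (real (Suc n) - 1) / 2 * x\<^sup>2"
    using assms by (cases n) auto
  finally show ?case .
qed simp

lemma one_minus_power_ge:
  fixes x :: real
  assumes "0 \<le> x" "x \<le> 1"
  shows "1 - n * x + n * (real n - 1) / 2 * x\<^sup>2 - n * (real n - 1) * (real n - 2) / 6 * x ^ 3
    \<le> (1 - x) ^ n"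
proof (induction n)
  case (Suc n)
  have nn: "0 \<le> real n * (real n - 1) * (real n - 2)"
    by (cases "n \<le> 2") (auto simp: le_Suc_eq numeral_2_eq_2)
  have "1 - Suc n * x + Suc n * (real (Suc n) - 1) / 2 * x\<^sup>2
      - Suc n * (real (Suc n) - 1) * (real (Suc n) - 2) / 6 * x ^ 3
    \<le> 1 - Suc n * x + Suc n * (real (Suc n) - 1) / 2 * x\<^sup>2
      - Suc n * (real (Suc n) - 1) * (real (Suc n) - 2) / 6 * x ^ 3
      + n * (real n - 1) * (real n - 2) / 6 * x ^ 4"
    using assms nn by simp
  also have "\<dots> = (1 - x) * (1 - n * x + n * (real n - 1) / 2 * x\<^sup>2
      - n * (real n - 1) * (real n - 2) / 6 * x ^ 3)"
    by (simp add: field_simps power2_eq_square power3_eq_cube power4_eq_xxxx)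
  also have "\<dots> \<le> (1 - x) ^ Suc n"
    using mult_left_mono[OF Suc, of "1 - x"] assms by simp
  finally show ?case .
qed simp

text \<open>An error of third order is what the triangle probability needs, since its terms of first and second order in \<open>q\<close> cancel.\<close>

lemma one_minus_power_approx:
  fixes x :: real
  assumes "0 \<le> x" "x \<le> 1"
  shows "\<bar>(1 - x) ^ n - (1 - n * x + n * (real n - 1) / 2 * x\<^sup>2)\<bar> \<le> (n * x) ^ 3"
proof -
  have "real n * (real n - 1) * (real n - 2) \<le> real n * real n * real n"
  proof (cases "n \<ge> 2")
    case True then show ?thesis by (intro mult_mono) auto
  next
    case False
    then have "n = 0 \<or> n = 1" by auto
    then show ?thesis by auto
  qed
  then have "real n * (real n - 1) * (real n - 2) \<le> real n * real n * real n * 6"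
    by (rule order_trans) simp
  then have "real n * (real n - 1) * (real n - 2) / 6 * x ^ 3 \<le> (real n) ^ 3 * x ^ 3"
    using assms by (intro mult_right_mono) (auto simp: power3_eq_cube)
  moreover have "0 \<le> (n * x) ^ 3" using assms by simp
  ultimately show ?thesis
    using one_minus_power_le[OF assms, of n] one_minus_power_ge[OF assms, of n]
    unfolding power_mult_distrib by linarith
qed

lemma one_minus_power_first_order:
  fixes x :: real
  assumes "0 \<le> x" "x \<le> 1"
  shows "1 - (1 - x) ^ n \<le> n * x" "n * x - (n * x)\<^sup>2 \<le> 1 - (1 - x) ^ n"
proof -
  show "1 - (1 - x) ^ n \<le> n * x"
    using Bernoulli_inequality[of "-x" n] assms by simp
  have "real n * (real n - 1) / 2 \<le> real n * real n" by (simp add: field_simps)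
  then have "real n * (real n - 1) / 2 * x\<^sup>2 \<le> real n * real n * x\<^sup>2"
    by (intro mult_right_mono) auto
  then show "n * x - (n * x)\<^sup>2 \<le> 1 - (1 - x) ^ n"
    using one_minus_power_le[OF assms, of n] unfolding power_mult_distrib by (simp add: power2_eq_square)
qed

section \<open>Conditional expectations and convergence of moments\<close>

text \<open>Evaluating the nonnegative integral is enough; integrability comes with it. Sums, exchange of
integrals and weighted insertions can therefore be carried out without side conditions.\<close>

lemma expectation_eq_of_nn_integral:
  assumes "\<And>x. 0 \<le> f x" "0 \<le> r" "(\<integral>\<^sup>+ x. ennreal (f x) \<partial>measure_pmf p) = ennreal r"
  shows "measure_pmf.expectation p f = r"
  using assms by (subst integral_eq_nn_integral) auto

lemma nn_integral_pmf_swap: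
  "(\<integral>\<^sup>+ a. \<integral>\<^sup>+ b. f a b \<partial>measure_pmf B \<partial>measure_pmf A)
    = (\<integral>\<^sup>+ b. \<integral>\<^sup>+ a. f a b \<partial>measure_pmf A \<partial>measure_pmf B)"
proof -
  have "(\<integral>\<^sup>+ a. \<integral>\<^sup>+ b. f a b \<partial>B \<partial>A) = (\<integral>\<^sup>+ x. (case x of (a, b) \<Rightarrow> f a b) \<partial>pair_pmf A B)"
    by (simp add: nn_integral_pair_pmf')
  also have "\<dots> = (\<integral>\<^sup>+ x. (case x of (b, a) \<Rightarrow> f a b) \<partial>pair_pmf B A)"
    by (subst pair_commute_pmf) (simp add: case_prod_unfold)
  finally show ?thesis by (simp add: nn_integral_pair_pmf')
qed

lemma expectation_of_bool:
  "measure_pmf.expectation p (\<lambda>x. of_bool (R x) :: real) = measure_pmf.prob p {x. R x}"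
proof -
  have "measure_pmf.expectation p (\<lambda>x. of_bool (R x) :: real) = measure_pmf.expectation p (indicator {x. R x})"
    by (intro Bochner_Integration.integral_cong) (auto simp: indicator_def)
  then show ?thesis by simp
qed

lemma expectation_given_eq:
  assumes "measure_pmf.prob p A > 0"
  shows "expectation_given p A f
    = measure_pmf.expectation p (\<lambda>x. indicator A x * f x) / measure_pmf.prob p A"
proof -
  have ne: "set_pmf p \<inter> A \<noteq> {}"
    using assms by (metis less_irrefl measure_pmf_zero_iff)
  have "measure_pmf (cond_pmf p A) = density (measure_pmf p) (\<lambda>x. ennreal (indicator A x / measure_pmf.prob p A))"
    unfolding cond_pmf.rep_eq[OF ne] uniform_measure_def
    using assms by (intro density_cong) (auto simp: measure_pmf.emeasure_eq_measure divide_ennreal indicator_def simp flip: ennreal_1)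
  then have "expectation_given p A f
      = measure_pmf.expectation p (\<lambda>x. (indicator A x / measure_pmf.prob p A) *\<^sub>R f x)"
    unfolding expectation_given_def by (simp add: integral_density)
  also have "\<dots> = measure_pmf.expectation p (\<lambda>x. (indicator A x * f x) / measure_pmf.prob p A)"
    by (intro Bochner_Integration.integral_cong) auto
  finally show ?thesis by simp
qed

text \<open>The limiting distribution function is continuous off the integers, so it may be evaluated at the half-integers
on both sides of \<open>j\<close>.\<close>

lemma pmf_tendsto_of_weak_conv:
  fixes P :: "nat \<Rightarrow> nat pmf" and Z :: "nat pmf"
  assumes "weak_conv_m (\<lambda>n. distr (measure_pmf (P n)) borel real) (distr (measure_pmf Z) borel real)"
  shows "(\<lambda>n. pmf (P n) j) \<longlonglongrightarrow> pmf Z j"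
proof -
  have cdf: "cdf (distr (measure_pmf p) borel real) x = measure_pmf.prob p {i. real i \<le> x}"
    for p :: "nat pmf" and x
    by (simp add: cdf_def measure_distr vimage_def)
  interpret Z: real_distribution "distr (measure_pmf Z) borel real"
    by (rule prob_space.real_distribution_distr[OF measure_pmf.prob_space_axioms]) simp
  have lim: "(\<lambda>n. measure_pmf.prob (P n) {i. real i \<le> x}) \<longlonglongrightarrow> measure_pmf.prob Z {i. real i \<le> x}"
    if "\<And>i::nat. x \<noteq> real i" for x
  proof -
    have e: "real -` {x} = {}" using that by auto
    have "isCont (cdf (distr (measure_pmf Z) borel real)) x"
      by (simp add: Z.isCont_cdf measure_distr e)
    then show ?thesis
      using assms unfolding weak_conv_m_def weak_conv_def cdf by blast
  qed
  have pm: "pmf p j = measure_pmf.prob p {i. real i \<le> real j + 1/2}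
      - measure_pmf.prob p {i. real i \<le> real j - 1/2}" for p :: "nat pmf"
  proof -
    have "{i::nat. real i \<le> real j + 1/2} = {j} \<union> {i. real i \<le> real j - 1/2}"
    proof (intro set_eqI, simp, intro iffI)
      fix x :: nat assume "real x \<le> real j + 1/2"
      then have "x \<le> j" by linarith
      then show "x = j \<or> real x \<le> real j - 1/2" by (cases "x = j") auto
    qed auto
    then have "measure_pmf.prob p {i::nat. real i \<le> real j + 1/2}
        = measure_pmf.prob p {j} + measure_pmf.prob p {i. real i \<le> real j - 1/2}"
      by (simp only:, subst measure_pmf.finite_measure_Union) auto
    then show ?thesis by (simp add: measure_pmf_single)
  qed
  have ne: "real j + 1/2 \<noteq> real i" "real j - 1/2 \<noteq> real i" for i :: nat
  proof -
    have "2 * j + 1 \<noteq> 2 * i" "2 * j \<noteq> 2 * i + 1" by presburger+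
    then have "real (2 * j + 1) \<noteq> real (2 * i)" "real (2 * j) \<noteq> real (2 * i + 1)"
      by (simp_all only: of_nat_eq_iff not_False_eq_True)
    then show "real j + 1/2 \<noteq> real i" "real j - 1/2 \<noteq> real i" by auto
  qed
  show ?thesis
    unfolding pm by (intro tendsto_diff lim ne)
qed

text \<open>A law on the naturals loses no mass of \<open>g\<close> at infinity if the expectations of \<open>g\<close> converge: sums over initial
segments converge, hence so do the tails of \<open>g\<close>, and those bound the tails of \<open>f\<close>.\<close>

lemma expectation_tendsto_of_dominating:
  fixes P :: "nat \<Rightarrow> nat pmf" and Z :: "nat pmf" and f g :: "nat \<Rightarrow> real"
  assumes pw: "\<And>j. (\<lambda>n. pmf (P n) j) \<longlonglongrightarrow> pmf Z j"
    and intP: "\<forall>\<^sub>F n in sequentially. integrable (measure_pmf (P n)) g"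
    and intZ: "integrable (measure_pmf Z) g"
    and conv: "(\<lambda>n. measure_pmf.expectation (P n) g) \<longlonglongrightarrow> measure_pmf.expectation Z g"
    and le: "\<And>j. \<bar>f j\<bar> \<le> g j"
  shows "(\<lambda>n. measure_pmf.expectation (P n) f) \<longlonglongrightarrow> measure_pmf.expectation Z f"
proof -
  define hd where "hd p h K = (\<Sum>j\<le>K. h j * pmf p j)" for p :: "nat pmf" and h :: "nat \<Rightarrow> real" and K
  define tl where "tl p K = measure_pmf.expectation p g - hd p g K" for p K
  have hd_eq: "hd p h K = measure_pmf.expectation p (\<lambda>j. h j * indicator {..K} j)" for p h K
  proof -
    have "measure_pmf.expectation p (\<lambda>j. h j * indicator {..K} j)
        = (\<Sum>j\<le>K. (h j * indicator {..K} j) * pmf p j)"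
      by (intro integral_measure_pmf_real) (auto simp: indicator_def split: if_splits)
    then show ?thesis by (simp add: hd_def)
  qed
  have err: "\<bar>measure_pmf.expectation p f - hd p f K\<bar> \<le> tl p K"
    if i: "integrable (measure_pmf p) g" for p K
  proof -
    have fi: "integrable (measure_pmf p) f"
      using i by (rule Bochner_Integration.integrable_bound) (auto intro!: AE_pmfI order_trans[OF le])
    have ind: "integrable (measure_pmf p) (\<lambda>j. h j * indicator {..K} j)"
      if "integrable (measure_pmf p) h" for h :: "nat \<Rightarrow> real"
      using that by (rule Bochner_Integration.integrable_bound) (auto intro!: AE_pmfI simp: indicator_def)
    have "\<bar>measure_pmf.expectation p f - hd p f K\<bar>
        = \<bar>measure_pmf.expectation p (\<lambda>j. f j - f j * indicator {..K} j)\<bar>"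
      unfolding hd_eq using fi ind[OF fi] by simp
    also have "\<dots> \<le> measure_pmf.expectation p (\<lambda>j. \<bar>f j - f j * indicator {..K} j\<bar>)"
      by (rule integral_abs_bound)
    also have "\<dots> \<le> measure_pmf.expectation p (\<lambda>j. g j - g j * indicator {..K} j)"
      using fi i ind[OF fi] ind[OF i] le
      by (intro integral_mono) (auto simp: indicator_def)
    also have "\<dots> = tl p K"
      unfolding tl_def hd_eq using i ind[OF i] by simp
    finally show ?thesis .
  qed
  have tlZ: "(\<lambda>K. tl Z K) \<longlonglongrightarrow> 0"
  proof -
    have "(\<lambda>K. measure_pmf.expectation Z (\<lambda>j. g j * indicator {..K} j)) \<longlonglongrightarrow> measure_pmf.expectation Z g"
    proof (rule integral_dominated_convergence[where w = g])
      have "\<forall>\<^sub>F K in sequentially. g j * indicator {..K} j = g j" for j :: nat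
        using eventually_ge_at_top[of j] by eventually_elim (simp add: indicator_def)
      then show "AE x in measure_pmf Z. (\<lambda>i. g x * indicator {..i} x) \<longlonglongrightarrow> g x"
        by (intro AE_I2 tendsto_eventually) blast
      show "AE x in measure_pmf Z. norm (g x * indicator {..i} x) \<le> g x" for i
        using le by (intro AE_I2) (auto simp: indicator_def intro: order_trans[OF abs_ge_zero])
    qed (use intZ in auto)
    then have "(\<lambda>K. measure_pmf.expectation Z g - hd Z g K) \<longlonglongrightarrow> measure_pmf.expectation Z g - measure_pmf.expectation Z g"
      unfolding hd_eq by (intro tendsto_intros)
    then show ?thesis by (simp add: tl_def)
  qed
  have hdlim: "(\<lambda>n. hd (P n) h K) \<longlonglongrightarrow> hd Z h K" for h K
    unfolding hd_def by (intro tendsto_intros pw)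
  show ?thesis
  proof (rule LIMSEQ_I)
    fix e :: real assume "e > 0"
    then have "\<forall>\<^sub>F K in sequentially. tl Z K < e / 4"
      using order_tendstoD(2)[OF tlZ, of "e/4"] by simp
    then obtain K where K: "tl Z K < e / 4" by (meson eventually_happens sequentially_bot)
    have "(\<lambda>n. tl (P n) K) \<longlonglongrightarrow> tl Z K"
      unfolding tl_def by (intro tendsto_intros conv hdlim)
    then have "\<forall>\<^sub>F n in sequentially. tl (P n) K < e / 4"
      using K by (rule order_tendstoD)
    moreover have "\<forall>\<^sub>F n in sequentially. dist (hd (P n) f K) (hd Z f K) < e / 4"
      using hdlim[of f K] \<open>e > 0\<close> by (intro tendstoD) auto
    ultimately have "\<forall>\<^sub>F n in sequentially.
        norm (measure_pmf.expectation (P n) f - measure_pmf.expectation Z f) < e"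
      using intP
    proof eventually_elim
      case (elim n)
      show ?case
        using err[OF elim(3), of K] err[OF intZ, of K] elim(1,2) K \<open>e > 0\<close>
        unfolding dist_real_def real_norm_def by linarith
    qed
    then show "\<exists>no. \<forall>n\<ge>no. norm (measure_pmf.expectation (P n) f - measure_pmf.expectation Z f) < e"
      by (simp add: eventually_sequentially)
  qed
qed

section \<open>Sums of independent copies\<close>

definition iid_sum :: "nat pmf \<Rightarrow> nat \<Rightarrow> nat pmf" where
  "iid_sum p n = map_pmf (\<lambda>x. \<Sum>i<n. x i) (Pi_pmf {..<n} 0 (\<lambda>_. p))"

lemma sum_Pi_pmf_insert:
  assumes "finite A" "a \<notin> A"
  shows "map_pmf (\<lambda>x. \<Sum>i\<in>insert a A. x i) (Pi_pmf (insert a A) 0 (\<lambda>_. p))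
    = map_pmf (\<lambda>(y, s). y + s)
        (pair_pmf p (map_pmf (\<lambda>x. \<Sum>i\<in>A. x i :: nat) (Pi_pmf A 0 (\<lambda>_. p))))"
proof -
  have "(\<Sum>i\<in>A. (f(a := y)) i) = (\<Sum>i\<in>A. f i)" for f :: "'a \<Rightarrow> nat" and y
    using assms by (intro sum.cong) auto
  then show ?thesis
    using assms
    by (simp add: Pi_pmf_insert pair_map_pmf2 pmf.map_comp o_def case_prod_unfold apsnd_def)
qed

lemma iid_sum_0 [simp]: "iid_sum p 0 = return_pmf 0"
  by (simp add: iid_sum_def)

lemma iid_sum_Suc: "iid_sum p (Suc n) = map_pmf (\<lambda>(y, s). y + s) (pair_pmf p (iid_sum p n))"
  using sum_Pi_pmf_insert[of "{..<n}" n p] by (simp add: iid_sum_def lessThan_Suc)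

text \<open>Only the number of summands matters. This is the form in which exchangeability enters: removing any one of
the \<open>n\<close> terms leaves the law of a sum of \<open>n - 1\<close> terms.\<close>

lemma sum_Pi_pmf_eq_iid_sum:
  assumes "finite A"
  shows "map_pmf (\<lambda>x. \<Sum>i\<in>A. x i) (Pi_pmf A 0 (\<lambda>_. p)) = iid_sum p (card A)"
  using assms
proof (induction rule: finite_induct)
  case (insert a A)
  show ?case
    by (subst sum_Pi_pmf_insert) (use insert in \<open>auto simp: iid_sum_Suc\<close>)
qed simp

text \<open>Each summand \<open>f(x\<^sub>i)\<close> singles out one term, which is then independent of the remaining \<open>n - 1\<close> terms. The
compound Poisson counterpart is \<open>nn_integral_palm\<close> below, where the number of remaining terms has the same law as the
total number.\<close>

lemma nn_integral_iid_sum_palm: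
  fixes f g :: "nat \<Rightarrow> ennreal"
  shows "(\<integral>\<^sup>+ x. (\<Sum>i<n. f (x i)) * g (\<Sum>i<n. x i) \<partial>Pi_pmf {..<n} 0 (\<lambda>_. p))
    = of_nat n * (\<integral>\<^sup>+ y. f y * (\<integral>\<^sup>+ s. g (y + s) \<partial>iid_sum p (n - 1)) \<partial>p)"
proof -
  let ?A = "{..<n}"
  have one: "(\<integral>\<^sup>+ x. f (x i) * g (\<Sum>i<n. x i) \<partial>Pi_pmf {..<n} 0 (\<lambda>_. p))
      = (\<integral>\<^sup>+ y. f y * (\<integral>\<^sup>+ s. g (y + s) \<partial>iid_sum p (n - 1)) \<partial>p)" if i: "i < n" for i
  proof -
    have A: "{..<n} = insert i ({..<n} - {i})" using i by auto
    have upd: "(\<Sum>j<n. (h(i := y)) j) = y + (\<Sum>j\<in>{..<n} - {i}. h j)" for h :: "nat \<Rightarrow> nat" and y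
      by (subst A, subst sum.insert) (auto intro!: sum.cong)
    have "(\<integral>\<^sup>+ x. f (x i) * g (\<Sum>i<n. x i) \<partial>Pi_pmf {..<n} 0 (\<lambda>_. p))
       = (\<integral>\<^sup>+ x. f (x i) * g (\<Sum>i<n. x i) \<partial>Pi_pmf (insert i ({..<n} - {i})) 0 (\<lambda>_. p))"
      using A by simp
    also have "\<dots> = (\<integral>\<^sup>+ y. \<integral>\<^sup>+ h. f y * g (y + (\<Sum>j\<in>{..<n} - {i}. h j))
        \<partial>Pi_pmf ({..<n} - {i}) 0 (\<lambda>_. p) \<partial>p)"
      by (subst Pi_pmf_insert) (simp_all add: case_prod_unfold nn_integral_pair_pmf' upd del: fun_upd_apply, simp)
    also have "\<dots> = (\<integral>\<^sup>+ y. f y * (\<integral>\<^sup>+ h. g (y + (\<Sum>j\<in>{..<n} - {i}. h j))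
        \<partial>Pi_pmf ({..<n} - {i}) 0 (\<lambda>_. p)) \<partial>p)"
      by (simp add: nn_integral_cmult)
    also have "\<dots> = (\<integral>\<^sup>+ y. f y * (\<integral>\<^sup>+ s. g (y + s) \<partial>iid_sum p (n - 1)) \<partial>p)"
    proof -
      have "iid_sum p (n - 1)
          = map_pmf (\<lambda>x. \<Sum>j\<in>{..<n} - {i}. x j) (Pi_pmf ({..<n} - {i}) 0 (\<lambda>_. p))"
        using sum_Pi_pmf_eq_iid_sum[of "{..<n} - {i}" p] i by simp
      then show ?thesis by simp
    qed
    finally show ?thesis .
  qed
  have "(\<integral>\<^sup>+ x. (\<Sum>i<n. f (x i)) * g (\<Sum>i<n. x i) \<partial>Pi_pmf {..<n} 0 (\<lambda>_. p))
     = (\<Sum>i<n. \<integral>\<^sup>+ x. f (x i) * g (\<Sum>i<n. x i) \<partial>Pi_pmf {..<n} 0 (\<lambda>_. p))"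
    by (simp add: sum_distrib_right nn_integral_sum)
  also have "\<dots> = of_nat n * (\<integral>\<^sup>+ y. f y * (\<integral>\<^sup>+ s. g (y + s) \<partial>iid_sum p (n - 1)) \<partial>p)"
    by (simp add: one)
  finally show ?thesis .
qed

lemma nn_integral_indicator_shift:
  fixes y :: nat
  shows "(\<integral>\<^sup>+ s. indicator {k} (y + s) \<partial>measure_pmf q) = ennreal (if y \<le> k then pmf q (k - y) else 0)"
proof (cases "y \<le> k")
  case True
  then have "indicator {k} (y + s) = (indicator {k - y} s :: ennreal)" for s
    by (auto simp: indicator_def)
  then show ?thesis using True by (simp add: emeasure_pmf_single)
next
  case False
  then have "indicator {k} (y + s) = (0 :: ennreal)" for s
    by (auto simp: indicator_def)
  then show ?thesis using False by simp
qed

lemma nn_integral_convolution: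
  fixes f :: "nat \<Rightarrow> real"
  assumes "\<And>j. 0 \<le> f j"
  shows "(\<integral>\<^sup>+ y. ennreal (f y) * ennreal (if y \<le> k then pmf q (k - y) else 0) \<partial>measure_pmf p)
    = ennreal (\<Sum>j\<le>k. pmf p j * f j * pmf q (k - j))"
proof -
  have "(\<integral>\<^sup>+ y. ennreal (f y) * ennreal (if y \<le> k then pmf q (k - y) else 0) \<partial>measure_pmf p)
     = (\<Sum>j\<le>k. ennreal (f j) * ennreal (if j \<le> k then pmf q (k - j) else 0) * ennreal (pmf p j))"
    by (intro nn_integral_measure_pmf_support) auto
  also have "\<dots> = (\<Sum>j\<le>k. ennreal (pmf p j * f j * pmf q (k - j)))"
    using assms by (intro sum.cong) (auto simp: ennreal_mult mult_ac)
  also have "\<dots> = ennreal (\<Sum>j\<le>k. pmf p j * f j * pmf q (k - j))"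
    using assms by (intro sum_ennreal) auto
  finally show ?thesis .
qed

lemma expectation_iid_sum_palm:
  fixes f :: "nat \<Rightarrow> real"
  assumes f: "\<And>j. 0 \<le> f j"
  shows "measure_pmf.expectation (Pi_pmf {..<n} 0 (\<lambda>_. p))
      (\<lambda>x. of_bool ((\<Sum>i<n. x i) = k) * (\<Sum>i<n. f (x i)))
    = real n * (\<Sum>j\<le>k. pmf p j * f j * pmf (iid_sum p (n - 1)) (k - j))"
proof (rule expectation_eq_of_nn_integral)
  have "(\<integral>\<^sup>+ x. ennreal (of_bool ((\<Sum>i<n. x i) = k) * (\<Sum>i<n. f (x i))) \<partial>Pi_pmf {..<n} 0 (\<lambda>_. p))
    = (\<integral>\<^sup>+ x. (\<Sum>i<n. ennreal (f (x i))) * indicator {k} (\<Sum>i<n. x i) \<partial>Pi_pmf {..<n} 0 (\<lambda>_. p))"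
    using f by (intro nn_integral_cong) (auto simp: sum_ennreal)
  also have "\<dots> = of_nat n * ennreal (\<Sum>j\<le>k. pmf p j * f j * pmf (iid_sum p (n - 1)) (k - j))"
    unfolding nn_integral_iid_sum_palm[where f = "\<lambda>j. ennreal (f j)"] nn_integral_indicator_shift
    by (simp add: nn_integral_convolution[of f, OF f])
  also have "\<dots> = ennreal (real n * (\<Sum>j\<le>k. pmf p j * f j * pmf (iid_sum p (n - 1)) (k - j)))"
    using f by (simp add: ennreal_mult sum_nonneg flip: ennreal_of_nat_eq_real_of_nat)
  finally show "(\<integral>\<^sup>+ x. ennreal (of_bool ((\<Sum>i<n. x i) = k) * (\<Sum>i<n. f (x i))) \<partial>Pi_pmf {..<n} 0 (\<lambda>_. p))
    = ennreal (real n * (\<Sum>j\<le>k. pmf p j * f j * pmf (iid_sum p (n - 1)) (k - j)))" .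
qed (use f in \<open>auto intro!: sum_nonneg mult_nonneg_nonneg\<close>)

text \<open>The case \<open>f = id\<close>, in which \<open>\<Sum> f(x\<^sub>i)\<close> is the constant \<open>k\<close> on the event considered.\<close>

lemma pmf_iid_sum_recursion:
  "real k * pmf (iid_sum p n) k = real n * (\<Sum>j\<le>k. pmf p j * j * pmf (iid_sum p (n - 1)) (k - j))"
proof -
  let ?M = "Pi_pmf {..<n} 0 (\<lambda>_. p)"
  have "real n * (\<Sum>j\<le>k. pmf p j * j * pmf (iid_sum p (n - 1)) (k - j))
     = measure_pmf.expectation ?M (\<lambda>x. of_bool ((\<Sum>i<n. x i) = k) * (\<Sum>i<n. real (x i)))"
    using expectation_iid_sum_palm[of real n p k] by simp
  also have "\<dots> = measure_pmf.expectation ?M (\<lambda>x. real k * indicator {x. (\<Sum>i<n. x i) = k} x)"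
    by (intro Bochner_Integration.integral_cong) (auto simp flip: of_nat_sum)
  also have "\<dots> = real k * pmf (iid_sum p n) k"
    by (simp add: iid_sum_def pmf_map vimage_def)
  finally show ?thesis by simp
qed

lemma pmf_iid_sum_Suc: "pmf (iid_sum p (Suc n)) k = (\<Sum>j\<le>k. pmf p j * pmf (iid_sum p n) (k - j))"
proof -
  have "ennreal (pmf (iid_sum p (Suc n)) k)
      = (\<integral>\<^sup>+ y. ennreal 1 * (\<integral>\<^sup>+ s. indicator {k} (y + s) \<partial>iid_sum p n) \<partial>p)"
  proof -
    have "ennreal (pmf (iid_sum p (Suc n)) k) = (\<integral>\<^sup>+ x. indicator {k} x \<partial>iid_sum p (Suc n))"
      by (simp add: emeasure_pmf_single)
    then show ?thesis
      unfolding iid_sum_Suc nn_integral_map_pmf nn_integral_pair_pmf' by simp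
  qed
  also have "\<dots> = ennreal (\<Sum>j\<le>k. pmf p j * pmf (iid_sum p n) (k - j))"
    unfolding nn_integral_indicator_shift using nn_integral_convolution[of "\<lambda>_. 1"] by simp
  finally show ?thesis by (simp add: sum_nonneg)
qed

text \<open>One more summand changes the sum only if it is nonzero. In the application this has probability \<open>O(1/n)\<close>, so
\<open>n - 1\<close> and \<open>n\<close> summands have the same limit.\<close>

lemma pmf_iid_sum_diff_le:
  "\<bar>pmf (iid_sum p n) k - pmf (iid_sum p (n - 1)) k\<bar> \<le> 1 - pmf p 0"
proof (cases n)
  case (Suc l)
  let ?c = "pmf (iid_sum p l)"
  have "pmf (iid_sum p (Suc l)) k = pmf p 0 * ?c k + (\<Sum>j\<in>{..k} - {0}. pmf p j * ?c (k - j))"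
    unfolding pmf_iid_sum_Suc by (subst sum.remove[of _ 0]) auto
  moreover have "0 \<le> (\<Sum>j\<in>{..k} - {0}. pmf p j * ?c (k - j))"
    by (auto intro!: sum_nonneg)
  moreover have "(\<Sum>j\<in>{..k} - {0}. pmf p j * ?c (k - j)) \<le> 1 - pmf p 0"
  proof -
    have "(\<Sum>j\<in>{..k} - {0}. pmf p j * ?c (k - j)) \<le> (\<Sum>j\<in>{..k} - {0}. pmf p j)"
      by (intro sum_mono mult_left_le pmf_le_1) auto
    also have "\<dots> = (\<Sum>j\<le>k. pmf p j) - pmf p 0"
      by (subst sum_diff) auto
    also have "\<dots> \<le> 1 - pmf p 0"
      by (simp add: measure_measure_pmf_finite[symmetric])
    finally show ?thesis .
  qed
  moreover have "pmf p 0 * ?c k \<le> ?c k" "?c k - pmf p 0 * ?c k \<le> 1 - pmf p 0"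
    using mult_right_mono[of "pmf p 0" 1 "?c k"] mult_left_mono[of "?c k" 1 "1 - pmf p 0"]
    by (auto simp: pmf_le_1 algebra_simps)
  ultimately show ?thesis using Suc by simp
qed (simp add: pmf_le_1)

lemma pmf_iid_sum_at_0: "pmf (iid_sum p n) 0 = pmf p 0 ^ n"
  by (induction n) (simp_all add: pmf_iid_sum_Suc)

section \<open>The compound Poisson limit\<close>

text \<open>The Poisson weights satisfy \<open>L p\<^sub>L = r p\<^sub>L\<^sub>-\<^sub>1\<close>: size-biasing a Poisson variable adds one.\<close>

lemma nn_integral_poisson_shift:
  fixes r :: real and \<phi> :: "nat \<Rightarrow> ennreal"
  assumes r: "r > 0"
  shows "(\<integral>\<^sup>+ L. of_nat L * \<phi> (L - 1) \<partial>poisson_pmf r) = ennreal r * (\<integral>\<^sup>+ L. \<phi> L \<partial>poisson_pmf r)"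
proof -
  define q where "q L = ennreal (pmf (poisson_pmf r) L)" for L
  have step: "q (Suc L) * of_nat (Suc L) = ennreal r * q L" for L
  proof -
    have "pmf (poisson_pmf r) (Suc L) * real (Suc L) = r * pmf (poisson_pmf r) L"
      using r by (simp add: fact_Suc divide_simps del: of_nat_Suc)
    then have "ennreal (pmf (poisson_pmf r) (Suc L) * real (Suc L)) = ennreal (r * pmf (poisson_pmf r) L)"
      by simp
    then show ?thesis
      using r unfolding q_def
      by (simp add: ennreal_mult ennreal_of_nat_eq_real_of_nat del: of_nat_Suc pmf_poisson)
  qed
  have "(\<integral>\<^sup>+ L. of_nat L * \<phi> (L - 1) \<partial>poisson_pmf r) = (\<Sum>L. q L * (of_nat L * \<phi> (L - 1)))"
    by (simp add: nn_integral_measure_pmf nn_integral_count_space_nat q_def)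
  also have "\<dots> = (\<Sum>L. q (L + 1) * (of_nat (L + 1) * \<phi> (L + 1 - 1)))
      + (\<Sum>L<1. q L * (of_nat L * \<phi> (L - 1)))"
    by (rule suminf_offset) simp
  also have "\<dots> = (\<Sum>L. ennreal r * (q L * \<phi> L))"
    using step by (simp flip: mult.assoc)
  also have "\<dots> = ennreal r * (\<integral>\<^sup>+ L. \<phi> L \<partial>poisson_pmf r)"
    by (simp add: nn_integral_measure_pmf nn_integral_count_space_nat q_def)
  finally show ?thesis .
qed

locale compound_poisson_limit =
  fixes \<beta> :: real and Z :: "nat pmf"
  assumes beta_pos: "\<beta> > 0"
    and Z_int: "integrable (measure_pmf Z) real"
    and Z_mean: "measure_pmf.expectation Z real > 0"
begin

definition rate :: real where "rate = measure_pmf.expectation Z real / \<beta>"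

text \<open>The expected number of terms of \<open>d\<^sub>*\<^sub>*\<close> equal to \<open>j\<close>; see \<open>rate_size_biased\<close>. Unlike the law of the terms it involves
no normalisation by the mean of \<open>Z\<close>, and for \<open>j \<ge> 1\<close> it is the limit of \<open>n\<close> times the point masses in the finite model.\<close>

definition intensity :: "nat \<Rightarrow> real" where
  "intensity j = (real j + 1) * pmf Z (j + 1) / \<beta>"

definition d_law :: "nat pmf" where "d_law = map_pmf d_ss (limit_model \<beta> Z)"

lemma rate_pos: "rate > 0"
  using beta_pos Z_mean by (simp add: rate_def)

lemma rate_size_biased: "rate * pmf (size_biased Z) j = intensity j"
  using Z_mean beta_pos by (simp add: rate_def intensity_def pmf_size_biased[OF Z_int Z_mean])

lemma nn_integral_limit_model:
  "(\<integral>\<^sup>+ \<omega>. F \<omega> \<partial>limit_model \<beta> Z)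
    = (\<integral>\<^sup>+ L. \<integral>\<^sup>+ z. F (L, z) \<partial>Pi_pmf {..<L} 0 (\<lambda>_. size_biased Z) \<partial>poisson_pmf rate)"
  by (simp add: limit_model_def rate_def)

lemma d_law_eq: "d_law = bind_pmf (poisson_pmf rate) (iid_sum (size_biased Z))"
  by (simp add: d_law_def limit_model_def rate_def map_bind_pmf pmf.map_comp o_def d_ss_def
      iid_sum_def[abs_def])

text \<open>Conditionally on \<open>\<Lambda> = L\<close> the identity for \<open>L\<close> independent terms applies; the resulting weight \<open>L\<close> and the
number \<open>L - 1\<close> of remaining terms turn into the factor \<open>rate\<close> and an unbiased Poisson number.\<close>

lemma nn_integral_palm:
  fixes f g :: "nat \<Rightarrow> ennreal"
  shows "(\<integral>\<^sup>+ \<omega>. (\<Sum>j<fst \<omega>. f (snd \<omega> j)) * g (d_ss \<omega>) \<partial>limit_model \<beta> Z)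
    = ennreal rate * (\<integral>\<^sup>+ y. f y * (\<integral>\<^sup>+ s. g (y + s) \<partial>d_law) \<partial>size_biased Z)"
proof -
  let ?p = "size_biased Z"
  have "(\<integral>\<^sup>+ \<omega>. (\<Sum>j<fst \<omega>. f (snd \<omega> j)) * g (d_ss \<omega>) \<partial>limit_model \<beta> Z)
     = (\<integral>\<^sup>+ L. of_nat L * (\<integral>\<^sup>+ y. f y * (\<integral>\<^sup>+ s. g (y + s) \<partial>iid_sum ?p (L - 1)) \<partial>?p) \<partial>poisson_pmf rate)"
    by (simp add: nn_integral_limit_model d_ss_def nn_integral_iid_sum_palm)
  also have "\<dots> = ennreal rate *
      (\<integral>\<^sup>+ L. (\<integral>\<^sup>+ y. f y * (\<integral>\<^sup>+ s. g (y + s) \<partial>iid_sum ?p L) \<partial>?p) \<partial>poisson_pmf rate)"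
    by (rule nn_integral_poisson_shift[OF rate_pos])
  also have "\<dots> = ennreal rate * (\<integral>\<^sup>+ y. f y * (\<integral>\<^sup>+ s. g (y + s) \<partial>d_law) \<partial>?p)"
    by (subst nn_integral_pmf_swap) (simp add: d_law_eq nn_integral_cmult)
  finally show ?thesis .
qed

lemma expectation_palm:
  fixes f :: "nat \<Rightarrow> real"
  assumes f: "\<And>j. 0 \<le> f j"
  shows "measure_pmf.expectation (limit_model \<beta> Z)
      (\<lambda>\<omega>. of_bool (d_ss \<omega> = k) * (\<Sum>j<fst \<omega>. f (snd \<omega> j)))
    = (\<Sum>j\<le>k. intensity j * f j * pmf d_law (k - j))"
proof (rule expectation_eq_of_nn_integral)
  have "(\<integral>\<^sup>+ \<omega>. ennreal (of_bool (d_ss \<omega> = k) * (\<Sum>j<fst \<omega>. f (snd \<omega> j))) \<partial>limit_model \<beta> Z)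
    = (\<integral>\<^sup>+ \<omega>. (\<Sum>j<fst \<omega>. ennreal (f (snd \<omega> j))) * indicator {k} (d_ss \<omega>) \<partial>limit_model \<beta> Z)"
    using f by (intro nn_integral_cong) (auto simp: sum_ennreal)
  also have "\<dots> = ennreal rate * ennreal (\<Sum>j\<le>k. pmf (size_biased Z) j * f j * pmf d_law (k - j))"
    unfolding nn_integral_palm[where f = "\<lambda>j. ennreal (f j)"] nn_integral_indicator_shift
    by (simp add: nn_integral_convolution[of f, OF f])
  also have "\<dots> = ennreal (\<Sum>j\<le>k. rate * (pmf (size_biased Z) j * f j * pmf d_law (k - j)))"
    using f rate_pos by (simp add: ennreal_mult sum_nonneg flip: sum_distrib_left)
  also have "(\<Sum>j\<le>k. rate * (pmf (size_biased Z) j * f j * pmf d_law (k - j)))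
      = (\<Sum>j\<le>k. intensity j * f j * pmf d_law (k - j))"
    by (simp add: mult.assoc flip: rate_size_biased)
  finally show "(\<integral>\<^sup>+ \<omega>. ennreal (of_bool (d_ss \<omega> = k) * (\<Sum>j<fst \<omega>. f (snd \<omega> j))) \<partial>limit_model \<beta> Z)
    = ennreal (\<Sum>j\<le>k. intensity j * f j * pmf d_law (k - j))" .
qed (use f beta_pos in \<open>auto simp: intensity_def intro!: sum_nonneg mult_nonneg_nonneg divide_nonneg_pos\<close>)

lemma pmf_d_law: "pmf d_law k = measure_pmf.prob (limit_model \<beta> Z) {\<omega>. d_ss \<omega> = k}"
  by (simp add: d_law_def pmf_map vimage_def)

lemma pmf_d_law_recursion: "real k * pmf d_law k = (\<Sum>j\<le>k. intensity j * j * pmf d_law (k - j))"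
proof -
  have "(\<Sum>j\<le>k. intensity j * j * pmf d_law (k - j))
     = measure_pmf.expectation (limit_model \<beta> Z)
        (\<lambda>\<omega>. of_bool (d_ss \<omega> = k) * (\<Sum>j<fst \<omega>. real (snd \<omega> j)))"
    using expectation_palm[of real k] by simp
  also have "\<dots> = measure_pmf.expectation (limit_model \<beta> Z) (\<lambda>\<omega>. real k * indicator {\<omega>. d_ss \<omega> = k} \<omega>)"
    by (intro Bochner_Integration.integral_cong) (auto simp: d_ss_def case_prod_unfold simp flip: of_nat_sum)
  also have "\<dots> = real k * pmf d_law k"
    by (simp add: pmf_d_law)
  finally show ?thesis by simp
qed

lemma pmf_d_law_0: "pmf d_law 0 = exp (- (rate - intensity 0))"
proof -
  let ?p0 = "pmf (size_biased Z) 0"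
  have sums: "(\<lambda>L. (rate * ?p0) ^ L / fact L * exp (- rate)) sums (exp (rate * ?p0) * exp (- rate))"
    using exp_converges[of "rate * ?p0"] by (intro sums_mult2) (simp add: divide_inverse mult.commute)
  have "ennreal (pmf d_law 0) = (\<integral>\<^sup>+ L. ennreal (?p0 ^ L) \<partial>poisson_pmf rate)"
    by (simp add: d_law_eq ennreal_pmf_bind pmf_iid_sum_at_0)
  also have "\<dots> = (\<Sum>L. ennreal ((rate * ?p0) ^ L / fact L * exp (- rate)))"
    using rate_pos
    by (simp add: nn_integral_measure_pmf nn_integral_count_space_nat power_mult_distrib mult_ac
        flip: ennreal_mult)
  also have "\<dots> = ennreal (exp (rate * ?p0) * exp (- rate))"
    using rate_pos by (intro suminf_ennreal_eq sums) auto
  finally have "pmf d_law 0 = exp (rate * ?p0) * exp (- rate)"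
    by (simp add: )
  then show ?thesis
    unfolding rate_size_biased by (simp add: exp_diff exp_minus divide_inverse)
qed

text \<open>Undoes the size-biasing, so that moments of the limit model become moments of \<open>Z\<close>.\<close>

lemma rate_nn_integral_size_biased:
  "ennreal rate * (\<integral>\<^sup>+ y. h y \<partial>size_biased Z) = ennreal (1 / \<beta>) * (\<integral>\<^sup>+ z. of_nat z * h (z - 1) \<partial>Z)"
proof -
  have step: "ennreal rate * ennreal (pmf (size_biased Z) j)
      = ennreal (1 / \<beta>) * (ennreal (pmf Z (j + 1)) * of_nat (j + 1))" for j
  proof -
    have "ennreal rate * ennreal (pmf (size_biased Z) j) = ennreal (1 / \<beta> * (pmf Z (j + 1) * real (j + 1)))"
      using rate_pos rate_size_biased[of j]
      by (simp add: intensity_def field_simps flip: ennreal_mult)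
    then show ?thesis
      using beta_pos unfolding ennreal_of_nat_eq_real_of_nat
      by (subst (asm) ennreal_mult, simp, simp, subst (asm) ennreal_mult) auto
  qed
  have "ennreal rate * (\<integral>\<^sup>+ y. h y \<partial>size_biased Z)
      = (\<Sum>j. ennreal rate * ennreal (pmf (size_biased Z) j) * h j)"
    by (simp add: nn_integral_measure_pmf nn_integral_count_space_nat mult.assoc)
  also have "\<dots> = ennreal (1 / \<beta>) * (\<Sum>j. ennreal (pmf Z (j + 1)) * (of_nat (j + 1) * h (j + 1 - 1)))"
    unfolding step by (simp add: mult.assoc)
  also have "(\<Sum>j. ennreal (pmf Z (j + 1)) * (of_nat (j + 1) * h (j + 1 - 1)))
      = (\<Sum>j. ennreal (pmf Z j) * (of_nat j * h (j - 1)))"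
    using suminf_offset[of "\<lambda>j. ennreal (pmf Z j) * (of_nat j * h (j - 1))" 1] by simp
  also have "\<dots> = (\<integral>\<^sup>+ z. of_nat z * h (z - 1) \<partial>Z)"
    by (simp add: nn_integral_measure_pmf nn_integral_count_space_nat)
  finally show ?thesis .
qed

lemma nn_integral_d_law_first:
  "(\<integral>\<^sup>+ \<omega>. of_nat (d_ss \<omega>) \<partial>limit_model \<beta> Z) = ennreal (1 / \<beta>) * (\<integral>\<^sup>+ z. of_nat z * of_nat (z - 1) \<partial>Z)"
proof -
  have "(\<integral>\<^sup>+ \<omega>. of_nat (d_ss \<omega>) \<partial>limit_model \<beta> Z) = ennreal rate * (\<integral>\<^sup>+ y. of_nat y \<partial>size_biased Z)"
    using nn_integral_palm[of of_nat "\<lambda>_. 1"]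
    by (simp add: d_ss_def case_prod_unfold)
  then show ?thesis
    unfolding rate_nn_integral_size_biased .
qed

text \<open>Since \<open>d\<^sub>*\<^sub>*\<^sup>2 = d\<^sub>*\<^sub>* \<cdot> (\<Sum> z\<^sub>j)\<close>, the inserted term \<open>y\<close> contributes \<open>y (y + d\<^sub>*\<^sub>*)\<close>.\<close>

lemma nn_integral_d_law_second:
  "(\<integral>\<^sup>+ \<omega>. of_nat (d_ss \<omega>) * of_nat (d_ss \<omega>) \<partial>limit_model \<beta> Z)
    = ennreal (1 / \<beta>) * (\<integral>\<^sup>+ z. of_nat z * (of_nat (z - 1) * of_nat (z - 1)) \<partial>Z)
      + (\<integral>\<^sup>+ \<omega>. of_nat (d_ss \<omega>) \<partial>limit_model \<beta> Z) * (\<integral>\<^sup>+ \<omega>. of_nat (d_ss \<omega>) \<partial>limit_model \<beta> Z)"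
proof -
  let ?m = "\<integral>\<^sup>+ \<omega>. of_nat (d_ss \<omega>) \<partial>limit_model \<beta> Z"
  have "(\<integral>\<^sup>+ \<omega>. of_nat (d_ss \<omega>) * of_nat (d_ss \<omega>) \<partial>limit_model \<beta> Z)
      = ennreal rate * (\<integral>\<^sup>+ y. of_nat y * (\<integral>\<^sup>+ s. of_nat (y + s) \<partial>d_law) \<partial>size_biased Z)"
    unfolding nn_integral_palm[of of_nat of_nat, symmetric] by (simp add: d_ss_def case_prod_unfold)
  also have "\<dots> = ennreal rate * (\<integral>\<^sup>+ y. of_nat y * of_nat y + ?m * of_nat y \<partial>size_biased Z)"
    by (simp add: d_law_def nn_integral_add distrib_left mult.commute)
  also have "\<dots> = ennreal rate * (\<integral>\<^sup>+ y. of_nat y * of_nat y \<partial>size_biased Z)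
      + ?m * (ennreal rate * (\<integral>\<^sup>+ y. of_nat y \<partial>size_biased Z))"
    by (subst nn_integral_add) (simp_all add: nn_integral_cmult distrib_left mult.left_commute)
  finally show ?thesis
    unfolding rate_nn_integral_size_biased nn_integral_d_law_first[symmetric] .
qed

lemma integrable_le_power4:
  assumes "integrable (measure_pmf Z) (\<lambda>z. real z ^ 4)" "\<And>z. \<bar>f z\<bar> \<le> real z ^ 4"
  shows "integrable (measure_pmf Z) f"
  using assms(1) by (rule Bochner_Integration.integrable_bound) (use assms(2) in auto)

lemma nn_integral_falling_2:
  assumes "integrable (measure_pmf Z) (\<lambda>z. real z ^ 4)"
  shows "(\<integral>\<^sup>+ z. of_nat z * of_nat (z - 1) \<partial>Z) = ennreal (factorial_moment Z 2)"
proof -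
  have "(\<integral>\<^sup>+ z. of_nat z * of_nat (z - 1) \<partial>Z) = (\<integral>\<^sup>+ z. ennreal (falling_factorial (real z) 2) \<partial>Z)"
    by (intro nn_integral_cong) (simp add: falling_factorial_2 ennreal_of_nat_eq_real_of_nat flip: ennreal_mult)
  also have "\<dots> = ennreal (factorial_moment Z 2)"
    unfolding factorial_moment_def
    by (intro nn_integral_eq_integral integrable_le_power4[OF assms] falling_factorial_le_power4)
       (auto simp: falling_factorial_2)
  finally show ?thesis .
qed

lemma delta_s_1:
  assumes "integrable (measure_pmf Z) (\<lambda>z. real z ^ 4)"
  shows "delta_s \<beta> Z 1 = factorial_moment Z 2 / \<beta>"
  unfolding delta_s_def
proof (rule expectation_eq_of_nn_integral)
  show "0 \<le> factorial_moment Z 2 / \<beta>"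
    using beta_pos by (simp add: factorial_moment_def falling_factorial_2)
  show "(\<integral>\<^sup>+ \<omega>. ennreal (real (d_ss \<omega>) ^ 1) \<partial>limit_model \<beta> Z) = ennreal (factorial_moment Z 2 / \<beta>)"
    using nn_integral_d_law_first nn_integral_falling_2[OF assms] beta_pos
    by (simp add: ennreal_of_nat_eq_real_of_nat flip: ennreal_mult')
qed simp

text \<open>The second moment of the size-biased term is that of \<open>Z (Z - 1)\<^sup>2 = (Z)\<^sub>3 + (Z)\<^sub>2\<close>, up to the factor removed by
\<open>rate_nn_integral_size_biased\<close>.\<close>

lemma delta_s_2:
  assumes "integrable (measure_pmf Z) (\<lambda>z. real z ^ 4)"
  shows "delta_s \<beta> Z 2 = (factorial_moment Z 3 + factorial_moment Z 2) / \<beta> + (delta_s \<beta> Z 1)\<^sup>2"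
  unfolding delta_s_def[of \<beta> Z 2]
proof (rule expectation_eq_of_nn_integral)
  have int: "integrable (measure_pmf Z) (\<lambda>z. falling_factorial (real z) i)" if "i \<in> {2, 3}" for i
    using that by (intro integrable_le_power4[OF assms] falling_factorial_le_power4) auto
  have nn: "0 \<le> factorial_moment Z 3 + factorial_moment Z 2" "0 \<le> delta_s \<beta> Z 1"
    by (auto simp: factorial_moment_def falling_factorial_nonneg delta_s_def)
  show nn': "0 \<le> (factorial_moment Z 3 + factorial_moment Z 2) / \<beta> + (delta_s \<beta> Z 1)\<^sup>2"
    using beta_pos nn by simp
  have "(\<integral>\<^sup>+ z. of_nat z * (of_nat (z - 1) * of_nat (z - 1)) \<partial>Z)
      = (\<integral>\<^sup>+ z. ennreal (falling_factorial (real z) 3 + falling_factorial (real z) 2) \<partial>Z)"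
  proof (intro nn_integral_cong)
    fix z :: nat
    have "real z * (real (z - 1) * real (z - 1)) = falling_factorial (real z) 3 + falling_factorial (real z) 2"
      unfolding falling_factorial_2 falling_factorial_3
      by (cases z rule: nat.exhaust[case_names 0 Suc], simp, rename_tac y, case_tac y)
        (simp_all add: algebra_simps)
    then show "of_nat z * (of_nat (z - 1) * of_nat (z - 1))
        = ennreal (falling_factorial (real z) 3 + falling_factorial (real z) 2)"
      by (simp add: ennreal_of_nat_eq_real_of_nat flip: ennreal_mult)
  qed
  also have "\<dots> = ennreal (factorial_moment Z 3 + factorial_moment Z 2)"
    using int by (subst nn_integral_eq_integral) (auto simp: factorial_moment_def falling_factorial_nonneg)
  finally have 2: "(\<integral>\<^sup>+ z. of_nat z * (of_nat (z - 1) * of_nat (z - 1)) \<partial>Z)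
      = ennreal (factorial_moment Z 3 + factorial_moment Z 2)" .
  have 1: "(\<integral>\<^sup>+ \<omega>. of_nat (d_ss \<omega>) \<partial>limit_model \<beta> Z) = ennreal (delta_s \<beta> Z 1)"
    unfolding nn_integral_d_law_first delta_s_1[OF assms] nn_integral_falling_2[OF assms]
    using beta_pos by (simp flip: ennreal_mult')
  have "(\<integral>\<^sup>+ \<omega>. ennreal (real (d_ss \<omega>) ^ 2) \<partial>limit_model \<beta> Z)
     = (\<integral>\<^sup>+ \<omega>. of_nat (d_ss \<omega>) * of_nat (d_ss \<omega>) \<partial>limit_model \<beta> Z)"
    by (simp add: ennreal_of_nat_eq_real_of_nat power2_eq_square ennreal_mult)
  also have "\<dots> = ennreal (1 / \<beta>) * ennreal (factorial_moment Z 3 + factorial_moment Z 2)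
      + ennreal (delta_s \<beta> Z 1) * ennreal (delta_s \<beta> Z 1)"
    unfolding nn_integral_d_law_second 1 2 ..
  also have "\<dots> = ennreal (1 / \<beta> * (factorial_moment Z 3 + factorial_moment Z 2)
      + delta_s \<beta> Z 1 * delta_s \<beta> Z 1)"
    using nn beta_pos by (subst ennreal_plus) (auto simp: ennreal_mult' simp del: times_divide_eq_left)
  also have "1 / \<beta> * (factorial_moment Z 3 + factorial_moment Z 2) + delta_s \<beta> Z 1 * delta_s \<beta> Z 1
      = (factorial_moment Z 3 + factorial_moment Z 2) / \<beta> + (delta_s \<beta> Z 1)\<^sup>2"
    by (simp add: power2_eq_square)
  finally show "(\<integral>\<^sup>+ \<omega>. ennreal (real (d_ss \<omega>) ^ 2) \<partial>limit_model \<beta> Z)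
      = ennreal ((factorial_moment Z 3 + factorial_moment Z 2) / \<beta> + (delta_s \<beta> Z 1)\<^sup>2)" .
qed simp

text \<open>Poisson limit theorem for sums with integer terms that are mostly zero. The point mass at \<open>0\<close> is a power
converging to an exponential; the recursions of both models, which have the same shape, extend the convergence to all \<open>k\<close>.\<close>

lemma iid_sum_tendsto_d_law:
  assumes lim: "\<And>j. j \<ge> 1 \<Longrightarrow> (\<lambda>n. real n * pmf (p n) j) \<longlonglongrightarrow> intensity j"
    and lim0: "(\<lambda>n. real n * (1 - pmf (p n) 0)) \<longlonglongrightarrow> rate - intensity 0"
  shows "(\<lambda>n. pmf (iid_sum (p n) n) k) \<longlonglongrightarrow> pmf d_law k"
    and "(\<lambda>n. pmf (iid_sum (p n) (n - 1)) k) \<longlonglongrightarrow> pmf d_law k"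
proof -
  define u where "u n = 1 - pmf (p n) 0" for n
  have u0: "0 \<le> u n" for n by (simp add: u_def pmf_le_1)
  have ulim: "u \<longlonglongrightarrow> 0"
  proof -
    have "(\<lambda>n. real n * u n * (1 / real n)) \<longlonglongrightarrow> (rate - intensity 0) * 0"
      using lim0 unfolding u_def by (intro tendsto_mult lim_1_over_n)
    moreover have "\<forall>\<^sub>F n in sequentially. real n * u n * (1 / real n) = u n"
      using eventually_gt_at_top[of 0] by eventually_elim simp
    ultimately show ?thesis by (simp add: tendsto_cong)
  qed
  have prev: "(\<lambda>n. pmf (iid_sum (p n) (n - 1)) k) \<longlonglongrightarrow> pmf d_law k"
    if "(\<lambda>n. pmf (iid_sum (p n) n) k) \<longlonglongrightarrow> pmf d_law k" for k
  proof -
    have "(\<lambda>n. pmf (iid_sum (p n) n) k - pmf (iid_sum (p n) (n - 1)) k) \<longlonglongrightarrow> 0"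
      by (rule Lim_null_comparison[OF _ ulim]) (use pmf_iid_sum_diff_le in \<open>simp add: u_def\<close>)
    from tendsto_diff[OF that this] show ?thesis by simp
  qed
  have main: "(\<lambda>n. pmf (iid_sum (p n) n) k) \<longlonglongrightarrow> pmf d_law k" for k
  proof (induction k rule: less_induct)
    case (less k)
    show ?case
    proof (cases "k = 0")
      case True
      \<comment> \<open>The point mass is \<open>(1 - u\<^sub>n)^n\<close>; its logarithm is squeezed between \<open>- u - 2 u\<^sup>2\<close> and \<open>- u\<close>,
        which is valid for \<open>u \<le> 1/2\<close>.\<close>
      have ev: "\<forall>\<^sub>F n in sequentially. u n < 1/2"
        using ulim by (rule order_tendstoD) simp
      have l2: "(\<lambda>n. real n * (- u n - 2 * (u n)\<^sup>2)) \<longlonglongrightarrow> - (rate - intensity 0)"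
      proof -
        have "(\<lambda>n. - (real n * u n) - 2 * (real n * u n) * u n) \<longlonglongrightarrow>
            - (rate - intensity 0) - 2 * (rate - intensity 0) * 0"
          using lim0 unfolding u_def[symmetric] by (intro tendsto_intros ulim)
        then show ?thesis by (simp add: algebra_simps power2_eq_square)
      qed
      have l1: "(\<lambda>n. real n * (- u n)) \<longlonglongrightarrow> - (rate - intensity 0)"
        using tendsto_minus[OF lim0] by (simp add: u_def algebra_simps)
      have "(\<lambda>n. real n * ln (1 - u n)) \<longlonglongrightarrow> - (rate - intensity 0)"
      proof (rule tendsto_sandwich[OF _ _ l2 l1])
        show "\<forall>\<^sub>F n in sequentially. real n * (- u n - 2 * (u n)\<^sup>2) \<le> real n * ln (1 - u n)"
          using ev
        proof eventually_elim
          case (elim n)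
          then show ?case using u0[of n] by (intro mult_left_mono ln_one_minus_pos_lower_bound) auto
        qed
        show "\<forall>\<^sub>F n in sequentially. real n * ln (1 - u n) \<le> real n * (- u n)"
          using ev
        proof eventually_elim
          case (elim n)
          then show ?case using u0[of n] by (intro mult_left_mono ln_one_minus_pos_upper_bound) auto
        qed
      qed
      then have "(\<lambda>n. exp (real n * ln (1 - u n))) \<longlonglongrightarrow> exp (- (rate - intensity 0))"
        by (intro tendsto_intros)
      moreover have "\<forall>\<^sub>F n in sequentially. exp (real n * ln (1 - u n)) = pmf (iid_sum (p n) n) k"
        using ev
      proof eventually_elim
        case (elim n)
        then show ?case
          using True by (simp add: pmf_iid_sum_at_0 exp_of_nat_mult u_def)
      qed
      ultimately show ?thesis
        unfolding True pmf_d_law_0 by (rule Lim_transform_eventually)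
    next
      case False
      have IH: "(\<lambda>n. pmf (iid_sum (p n) (n - 1)) (k - j)) \<longlonglongrightarrow> pmf d_law (k - j)" if "j \<ge> 1" for j
        using that False by (intro prev less) auto
      have "(\<lambda>n. (\<Sum>j\<le>k. real n * pmf (p n) j * j * pmf (iid_sum (p n) (n - 1)) (k - j)))
          \<longlonglongrightarrow> (\<Sum>j\<le>k. intensity j * j * pmf d_law (k - j))"
      proof (intro tendsto_sum)
        fix j show "(\<lambda>n. real n * pmf (p n) j * j * pmf (iid_sum (p n) (n - 1)) (k - j))
            \<longlonglongrightarrow> intensity j * j * pmf d_law (k - j)"
          by (cases "j = 0") (use IH in \<open>auto intro!: tendsto_intros lim\<close>)
      qed
      moreover have "(\<Sum>j\<le>k. real n * pmf (p n) j * j * pmf (iid_sum (p n) (n - 1)) (k - j))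
          = real k * pmf (iid_sum (p n) n) k" for n
        unfolding pmf_iid_sum_recursion by (simp add: sum_distrib_left mult.assoc)
      ultimately have "(\<lambda>n. real k * pmf (iid_sum (p n) n) k / real k) \<longlonglongrightarrow> real k * pmf d_law k / real k"
        unfolding pmf_d_law_recursion by (intro tendsto_divide) (use False in auto)
      then show ?thesis using False by simp
    qed
  qed
  show "(\<lambda>n. pmf (iid_sum (p n) n) k) \<longlonglongrightarrow> pmf d_law k"
    and "(\<lambda>n. pmf (iid_sum (p n) (n - 1)) k) \<longlonglongrightarrow> pmf d_law k"
    using main prev by blast+
qed

lemma expectation_iid_sum_tendsto:
  fixes f :: "nat \<Rightarrow> real"
  assumes lim: "\<And>j. j \<ge> 1 \<Longrightarrow> (\<lambda>n. real n * pmf (p n) j) \<longlonglongrightarrow> intensity j"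
    and lim0: "(\<lambda>n. real n * (1 - pmf (p n) 0)) \<longlonglongrightarrow> rate - intensity 0"
    and f: "\<And>j. 0 \<le> f j" "f 0 = 0"
  shows "(\<lambda>n. measure_pmf.expectation (Pi_pmf {..<n} 0 (\<lambda>_. p n))
        (\<lambda>x. of_bool ((\<Sum>i<n. x i) = k) * (\<Sum>i<n. f (x i))))
    \<longlonglongrightarrow> measure_pmf.expectation (limit_model \<beta> Z)
      (\<lambda>\<omega>. of_bool (d_ss \<omega> = k) * (\<Sum>j<fst \<omega>. f (snd \<omega> j)))"
proof -
  have "(\<lambda>n. (\<Sum>j\<le>k. real n * pmf (p n) j * f j * pmf (iid_sum (p n) (n - 1)) (k - j)))
      \<longlonglongrightarrow> (\<Sum>j\<le>k. intensity j * f j * pmf d_law (k - j))"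
  proof (intro tendsto_sum)
    fix j show "(\<lambda>n. real n * pmf (p n) j * f j * pmf (iid_sum (p n) (n - 1)) (k - j))
        \<longlonglongrightarrow> intensity j * f j * pmf d_law (k - j)"
      by (cases "j = 0") (use iid_sum_tendsto_d_law(2)[OF lim lim0] in \<open>auto simp: f intro!: tendsto_intros lim\<close>)
  qed
  then show ?thesis
    unfolding expectation_iid_sum_palm[of f, OF f(1)] expectation_palm[of f, OF f(1)]
    by (simp add: sum_distrib_left mult.assoc)
qed

end

section \<open>Edges, paths and triangles\<close>

text \<open>Removing \<open>A\<close> is a bijection onto the subsets of the complement.\<close>

lemma card_supersets:
  assumes "A \<subseteq> {..<m}" "card A \<le> s"
  shows "card {B. B \<subseteq> {..<m} \<and> card B = s \<and> A \<subseteq> B} = (m - card A) choose (s - card A)"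
proof -
  have fA: "finite A" using assms finite_subset by blast
  have "bij_betw (\<lambda>C. C \<union> A) {C. C \<subseteq> {..<m} - A \<and> card C = s - card A}
      {B. B \<subseteq> {..<m} \<and> card B = s \<and> A \<subseteq> B}"
  proof (rule bij_betw_byWitness[where f' = "\<lambda>B. B - A"])
    show "(\<lambda>C. C \<union> A) ` {C. C \<subseteq> {..<m} - A \<and> card C = s - card A}
        \<subseteq> {B. B \<subseteq> {..<m} \<and> card B = s \<and> A \<subseteq> B}"
    proof safe
      fix C assume C: "C \<subseteq> {..<m} - A" "card C = s - card A"
      then have "finite C" by (meson finite_Diff finite_lessThan finite_subset)
      then show "card (C \<union> A) = s" using C assms fA by (subst card_Un_disjoint) auto
    qed (use assms in auto)
    show "(\<lambda>B. B - A) ` {B. B \<subseteq> {..<m} \<and> card B = s \<and> A \<subseteq> B}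
        \<subseteq> {C. C \<subseteq> {..<m} - A \<and> card C = s - card A}"
      using fA by (auto simp: card_Diff_subset)
  qed auto
  then have "card {B. B \<subseteq> {..<m} \<and> card B = s \<and> A \<subseteq> B}
      = card {C. C \<subseteq> {..<m} - A \<and> card C = s - card A}"
    by (simp add: bij_betw_same_card)
  also have "\<dots> = (card ({..<m} - A)) choose (s - card A)"
    by (rule n_subsets) simp
  also have "card ({..<m} - A) = m - card A"
    using assms fA by (simp add: card_Diff_subset)
  finally show ?thesis .
qed

text \<open>One random intersection graph. At least three vertices are assumed so that paths and triangles exist and the
denominators below are positive.\<close>

locale passive_graph =
  fixes n m :: nat and P :: "nat pmf"
  assumes supp: "set_pmf P \<subseteq> {..m}" and m_ge: "m \<ge> 3"
begin

abbreviation W :: "nat set" where "W \<equiv> {..<m}"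
abbreviation Q :: "nat set pmf" where "Q \<equiv> random_subset m P"
abbreviation G :: "(nat \<Rightarrow> nat set) pmf" where "G \<equiv> Pi_pmf {..<n} {} (\<lambda>_. Q)"
abbreviation EQ :: "(nat set \<Rightarrow> real) \<Rightarrow> real" where "EQ \<equiv> measure_pmf.expectation Q"
abbreviation EG :: "((nat \<Rightarrow> nat set) \<Rightarrow> real) \<Rightarrow> real" where "EG \<equiv> measure_pmf.expectation G"
abbreviation adj :: "(nat \<Rightarrow> nat set) \<Rightarrow> nat \<Rightarrow> nat \<Rightarrow> bool" where "adj \<equiv> adjacent n"

text \<open>The probability that the random set contains \<open>a\<close> prescribed vertices, see \<open>EQ_hit\<close>.\<close>

definition hit :: "nat \<Rightarrow> real" where
  "hit a = factorial_moment P a / falling_factorial (real m) a"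

lemma subsets_of_size:
  "finite {B. B \<subseteq> W \<and> card B = s}" "card {B. B \<subseteq> W \<and> card B = s} = m choose s"
  "s \<le> m \<Longrightarrow> {B. B \<subseteq> W \<and> card B = s} \<noteq> {}"
proof -
  show "finite {B. B \<subseteq> W \<and> card B = s}" by (rule finite_subset[of _ "Pow W"]) auto
  show c: "card {B. B \<subseteq> W \<and> card B = s} = m choose s" using n_subsets[of W s] by simp
  show "{B. B \<subseteq> W \<and> card B = s} \<noteq> {}" if "s \<le> m"
    using c that by (metis card.empty zero_less_binomial less_irrefl)
qed

lemma EQ_eq:
  "EQ h = (\<Sum>s\<le>m. pmf P s * ((\<Sum>B | B \<subseteq> W \<and> card B = s. h B) / real (m choose s)))"
  unfolding random_subset_def
proof (subst pmf_expectation_bind[of "{..m}"])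
  show "finite (set_pmf (pmf_of_set {A. A \<subseteq> W \<and> card A = x}))" if "x \<in> {..m}" for x
    using subsets_of_size[of x] that by simp
qed (use supp subsets_of_size in \<open>auto intro!: sum.cong simp: integral_pmf_of_set\<close>)

lemma set_Q: "D \<in> set_pmf Q \<Longrightarrow> D \<subseteq> W"
  using supp subsets_of_size(1,3) by (fastforce simp: random_subset_def set_pmf_of_set)

lemma finite_set_Q: "finite (set_pmf Q)"
  by (rule finite_subset[of _ "Pow W"]) (use set_Q in auto)

lemma integrable_Q [simp]: "integrable (measure_pmf Q) (f :: _ \<Rightarrow> real)"
  by (rule integrable_measure_pmf_finite[OF finite_set_Q])

lemma set_G: "D \<in> set_pmf G \<Longrightarrow> D i \<subseteq> W"
  using set_Q by (cases "i < n") (auto simp: set_Pi_pmf PiE_dflt_def)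

lemma finite_set_G: "finite (set_pmf G)"
  by (simp add: set_Pi_pmf finite_PiE_dflt finite_set_Q)

lemma integrable_G [simp]: "integrable (measure_pmf G) (f :: _ \<Rightarrow> real)"
  by (rule integrable_measure_pmf_finite[OF finite_set_G])

lemma EG_sum: "EG (\<lambda>D. \<Sum>u\<in>A. F u D) = (\<Sum>u\<in>A. EG (F u))"
  by (rule Bochner_Integration.integral_sum) simp

lemma EG_mono:
  assumes "\<And>D. (\<And>i. D i \<subseteq> W) \<Longrightarrow> f D \<le> g D"
  shows "EG f \<le> EG g"
  by (intro integral_mono_AE AE_pmfI) (use assms set_G in auto)

lemma EG_cong:
  assumes "\<And>D. (\<And>i. D i \<subseteq> W) \<Longrightarrow> f D = g D"
  shows "EG f = EG g"
  by (intro antisym EG_mono) (use assms in auto)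

text \<open>Given its size \<open>s\<close>, the random set contains the \<open>a\<close> points of \<open>A\<close> with probability
\<open>(s)\<^sub>a / (m)\<^sub>a\<close>. The weight \<open>h\<close> of the size also gives the joint law of the size and of containing a point.\<close>

lemma EQ_superset:
  assumes A: "A \<subseteq> W"
  shows "EQ (\<lambda>D. of_bool (A \<subseteq> D) * h (card D))
    = measure_pmf.expectation P (\<lambda>s. h s * falling_factorial (real s) (card A))
      / falling_factorial (real m) (card A)"
proof -
  let ?a = "card A"
  have a: "?a \<le> m" using A card_mono[of W A] by simp
  have "(\<Sum>B | B \<subseteq> W \<and> card B = s. of_bool (A \<subseteq> B) * h (card B)) / real (m choose s)
      = h s * falling_factorial (real s) ?a / falling_factorial (real m) ?a" if s: "s \<le> m" for s
  proof -
    have "(\<Sum>B | B \<subseteq> W \<and> card B = s. of_bool (A \<subseteq> B) * h (card B))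
        = (\<Sum>B | B \<subseteq> W \<and> card B = s. of_bool (A \<subseteq> B) * h s)"
      by (intro sum.cong) auto
    also have "\<dots> = (\<Sum>B | B \<subseteq> W \<and> card B = s \<and> A \<subseteq> B. h s)"
      by (intro sum.mono_neutral_cong_right) (use subsets_of_size in auto)
    finally have sum: "(\<Sum>B | B \<subseteq> W \<and> card B = s. of_bool (A \<subseteq> B) * h (card B))
        = real (card {B. B \<subseteq> W \<and> card B = s \<and> A \<subseteq> B}) * h s"
      by simp
    show ?thesis
    proof (cases "?a \<le> s")
      case True
      have "real (m choose s) * real (s choose ?a) = real (m choose ?a) * real ((m - ?a) choose (s - ?a))"
        using choose_mult[OF True s] by (simp flip: of_nat_mult)
      moreover have "real (m choose s) > 0" "real (m choose ?a) > 0"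
        using s a by simp_all
      ultimately have "real ((m - ?a) choose (s - ?a)) / real (m choose s)
          = real (s choose ?a) / real (m choose ?a)"
        by (simp add: divide_simps mult_ac)
      moreover have "x * h s / c = h s * (fact ?a * y) / (fact ?a * d)" if "x / c = y / d" for x y c d :: real
      proof -
        have "x * h s / c = x / c * h s" by simp
        then show ?thesis unfolding that by simp
      qed
      ultimately show ?thesis
        unfolding sum card_supersets[OF A True] falling_factorial_eq_choose by blast
    next
      case False
      have "?a \<le> card B" if "B \<subseteq> W" "A \<subseteq> B" for B
        using that by (meson card_mono finite_lessThan finite_subset)
      with False have "{B. B \<subseteq> W \<and> card B = s \<and> A \<subseteq> B} = {}" by blast
      then show ?thesis
        unfolding sum falling_factorial_eq_choose using False by (simp add: binomial_eq_0)
    qed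
  qed
  then have "EQ (\<lambda>D. of_bool (A \<subseteq> D) * h (card D))
      = (\<Sum>s\<le>m. pmf P s * (h s * falling_factorial (real s) ?a / falling_factorial (real m) ?a))"
    unfolding EQ_eq by (intro sum.cong) auto
  also have "\<dots> = measure_pmf.expectation P (\<lambda>s. h s * falling_factorial (real s) ?a)
      / falling_factorial (real m) ?a"
    by (subst integral_measure_pmf_real[of "{..m}"]) (use supp in \<open>auto simp: sum_divide_distrib mult_ac\<close>)
  finally show ?thesis .
qed

lemma EQ_hit: "A \<subseteq> W \<Longrightarrow> EQ (\<lambda>D. of_bool (A \<subseteq> D)) = hit (card A)"
  using EQ_superset[of A "\<lambda>_. 1"] by (simp add: hit_def factorial_moment_def)

lemma EQ_hit1: "v < m \<Longrightarrow> EQ (\<lambda>D. of_bool (v \<in> D)) = hit 1"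
  using EQ_hit[of "{v}"] by simp

lemma EQ_hit2: "v < m \<Longrightarrow> w < m \<Longrightarrow> v \<noteq> w \<Longrightarrow> EQ (\<lambda>D. of_bool (v \<in> D \<and> w \<in> D)) = hit 2"
  using EQ_hit[of "{v, w}"] by (simp add: numeral_2_eq_2)

lemma EQ_hit3: "v < m \<Longrightarrow> w < m \<Longrightarrow> u < m \<Longrightarrow> v \<noteq> w \<Longrightarrow> v \<noteq> u \<Longrightarrow> w \<noteq> u
    \<Longrightarrow> EQ (\<lambda>D. of_bool (v \<in> D \<and> w \<in> D \<and> u \<in> D)) = hit 3"
  using EQ_hit[of "{v, w, u}"] by (simp add: numeral_3_eq_3)

lemma hit_nonneg: "0 \<le> hit a"
  unfolding hit_def factorial_moment_def
  by (intro divide_nonneg_nonneg falling_factorial_nonneg Bochner_Integration.integral_nonneg)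

lemma hit3_le_hit2: "hit 3 \<le> hit 2"
  unfolding EQ_hit2[of 0 1, symmetric, OF order.strict_trans2[OF _ m_ge] order.strict_trans2[OF _ m_ge], simplified]
    EQ_hit3[of 0 1 2, symmetric, OF order.strict_trans2[OF _ m_ge] order.strict_trans2[OF _ m_ge] order.strict_trans2[OF _ m_ge], simplified]
  by (intro integral_mono) auto

lemma prob_all_sets:
  "EG (\<lambda>D. of_bool (\<forall>i<n. R (D i))) = EQ (\<lambda>D. of_bool (R D)) ^ n"
proof -
  have "{D. \<forall>i<n. R (D i)} = Pi {..<n} (\<lambda>_. {D. R D})" by auto
  then show ?thesis
    unfolding expectation_of_bool by (simp add: measure_Pi_pmf_Pi)
qed

text \<open>The \<open>i\<close>-th set is independent of the others; replacing it by the empty set expresses "the others" without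
changing the index set.\<close>

lemma EG_split:
  assumes i: "i < n"
  shows "EG (\<lambda>D. F (D i) * H (D(i := {}))) = EQ F * EG (\<lambda>D. H (D(i := {})))"
proof -
  let ?R = "Pi_pmf ({..<n} - {i}) {} (\<lambda>_. Q)"
  have fin: "finite (set_pmf ?R)"
    by (simp add: set_Pi_pmf finite_PiE_dflt finite_set_Q)
  have intR: "integrable (measure_pmf ?R) (f :: _ \<Rightarrow> real)" for f
    by (rule integrable_measure_pmf_finite[OF fin])
  have G: "G = bind_pmf Q (\<lambda>x. map_pmf (\<lambda>D. D(i := x)) ?R)"
  proof -
    have A: "insert i ({..<n} - {i}) = {..<n}" using i by auto
    have "Pi_pmf (insert i ({..<n} - {i})) {} (\<lambda>_. Q) = bind_pmf Q (\<lambda>x. map_pmf (\<lambda>D. D(i := x)) ?R)"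
      by (subst Pi_pmf_insert') (auto simp: map_pmf_def)
    then show ?thesis unfolding A .
  qed
  have R: "EG (\<lambda>D. H (D(i := {}))) = measure_pmf.expectation ?R H"
    by (simp add: Pi_pmf_remove)
  have RR: "measure_pmf.expectation ?R (\<lambda>D. H (D(i := {}))) = measure_pmf.expectation ?R H"
    by (simp add: Pi_pmf_remove)
  have EQF: "EQ F = (\<Sum>x\<in>set_pmf Q. pmf Q x * F x)"
    by (subst integral_measure_pmf[OF finite_set_Q]) auto
  have "EG (\<lambda>D. F (D i) * H (D(i := {})))
     = (\<Sum>x\<in>set_pmf Q. pmf Q x * (F x * measure_pmf.expectation ?R (\<lambda>D. H (D(i := {})))))"
    by (subst G, subst pmf_expectation_bind[OF finite_set_Q]) (use fin intR in auto)
  also have "\<dots> = EQ F * EG (\<lambda>D. H (D(i := {})))"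
    unfolding R RR EQF by (simp add: sum_distrib_right mult.assoc)
  finally show ?thesis .
qed

lemma EG_component:
  assumes "i < n"
  shows "EG (\<lambda>D. F (D i)) = EQ F"
  using EG_split[of i F "\<lambda>_. 1"] assms by simp

text \<open>The inclusion-exclusion formulas for the probabilities of an edge, of two edges at a common vertex, of a triangle,
and of three vertices lying in a common set. The powers are the probabilities that no set contains any
of one, two or three given pairs, or, in the last formula, the whole triple.\<close>

definition edge_prob :: real where "edge_prob = 1 - (1 - hit 2) ^ n"
definition path_prob :: real where
  "path_prob = 1 - 2 * (1 - hit 2) ^ n + (1 - (2 * hit 2 - hit 3)) ^ n"
definition triangle_prob :: real where
  "triangle_prob = 1 - 3 * (1 - hit 2) ^ n + 3 * (1 - (2 * hit 2 - hit 3)) ^ n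
     - (1 - (3 * hit 2 - 2 * hit 3)) ^ n"
definition common_set_prob :: real where "common_set_prob = 1 - (1 - hit 3) ^ n"

lemma not_adj_iff: "v \<noteq> w \<Longrightarrow> \<not> adj D v w \<longleftrightarrow> (\<forall>i<n. \<not> (v \<in> D i \<and> w \<in> D i))"
  by (auto simp: adjacent_def)

lemma adj_commute: "adj D v w = adj D w v"
  by (auto simp: adjacent_def)

context
  fixes v w u assumes lt: "v < m" "w < m" "u < m" and distinct: "v \<noteq> w" "v \<noteq> u" "w \<noteq> u"
begin

lemma EQ_no_edge: "EQ (\<lambda>D. of_bool (\<not> (v \<in> D \<and> w \<in> D))) = 1 - hit 2"
proof -
  have "EQ (\<lambda>D. of_bool (\<not> (v \<in> D \<and> w \<in> D))) = EQ (\<lambda>D. 1 - of_bool (v \<in> D \<and> w \<in> D))"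
    by (intro Bochner_Integration.integral_cong) auto
  then show ?thesis using lt distinct by (simp add: EQ_hit2 del: of_bool_conj)
qed

lemma EQ_no_path:
  "EQ (\<lambda>D. of_bool (\<not> (v \<in> D \<and> w \<in> D) \<and> \<not> (v \<in> D \<and> u \<in> D))) = 1 - (2 * hit 2 - hit 3)"
proof -
  have "EQ (\<lambda>D. of_bool (\<not> (v \<in> D \<and> w \<in> D) \<and> \<not> (v \<in> D \<and> u \<in> D)))
     = EQ (\<lambda>D. 1 - of_bool (v \<in> D \<and> w \<in> D) - of_bool (v \<in> D \<and> u \<in> D)
         + of_bool (v \<in> D \<and> w \<in> D \<and> u \<in> D))"
    by (intro Bochner_Integration.integral_cong) auto
  then show ?thesis using lt distinct by (simp add: EQ_hit2 EQ_hit3 del: of_bool_conj)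
qed

lemma EQ_no_triangle:
  "EQ (\<lambda>D. of_bool (\<not> (v \<in> D \<and> w \<in> D) \<and> \<not> (v \<in> D \<and> u \<in> D) \<and> \<not> (w \<in> D \<and> u \<in> D)))
    = 1 - (3 * hit 2 - 2 * hit 3)"
proof -
  have "EQ (\<lambda>D. of_bool (\<not> (v \<in> D \<and> w \<in> D) \<and> \<not> (v \<in> D \<and> u \<in> D) \<and> \<not> (w \<in> D \<and> u \<in> D)))
     = EQ (\<lambda>D. 1 - of_bool (v \<in> D \<and> w \<in> D) - of_bool (v \<in> D \<and> u \<in> D) - of_bool (w \<in> D \<and> u \<in> D)
         + 2 * of_bool (v \<in> D \<and> w \<in> D \<and> u \<in> D))"
    by (intro Bochner_Integration.integral_cong) auto
  then show ?thesis using lt distinct by (simp add: EQ_hit2 EQ_hit3 del: of_bool_conj)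
qed

lemma EG_not_adj: "EG (\<lambda>D. of_bool (\<not> adj D v w)) = (1 - hit 2) ^ n"
  using prob_all_sets[of "\<lambda>X. \<not> (v \<in> X \<and> w \<in> X)"] distinct
  unfolding EQ_no_edge by (simp only: not_adj_iff not_False_eq_True)

lemma EG_not_adj2: "EG (\<lambda>D. of_bool (\<not> adj D v w \<and> \<not> adj D v u)) = (1 - (2 * hit 2 - hit 3)) ^ n"
proof -
  have "(\<not> adj D v w \<and> \<not> adj D v u) = (\<forall>i<n. \<not> (v \<in> D i \<and> w \<in> D i) \<and> \<not> (v \<in> D i \<and> u \<in> D i))" for D
    using distinct by (auto simp: not_adj_iff)
  then show ?thesis
    using prob_all_sets[of "\<lambda>X. \<not> (v \<in> X \<and> w \<in> X) \<and> \<not> (v \<in> X \<and> u \<in> X)"]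
    unfolding EQ_no_path by (simp only:)
qed

lemma EG_not_adj3: "EG (\<lambda>D. of_bool (\<not> adj D v w \<and> \<not> adj D v u \<and> \<not> adj D w u))
    = (1 - (3 * hit 2 - 2 * hit 3)) ^ n"
proof -
  have "(\<not> adj D v w \<and> \<not> adj D v u \<and> \<not> adj D w u)
      = (\<forall>i<n. \<not> (v \<in> D i \<and> w \<in> D i) \<and> \<not> (v \<in> D i \<and> u \<in> D i) \<and> \<not> (w \<in> D i \<and> u \<in> D i))" for D
    using distinct by (auto simp: not_adj_iff)
  then show ?thesis
    using prob_all_sets[of "\<lambda>X. \<not> (v \<in> X \<and> w \<in> X) \<and> \<not> (v \<in> X \<and> u \<in> X) \<and> \<not> (w \<in> X \<and> u \<in> X)"]
    unfolding EQ_no_triangle by (simp only:)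
qed

lemma EG_common_set:
  "EG (\<lambda>D. of_bool (\<exists>i<n. v \<in> D i \<and> w \<in> D i \<and> u \<in> D i)) = common_set_prob"
proof -
  have "EQ (\<lambda>D. of_bool (\<not> (v \<in> D \<and> w \<in> D \<and> u \<in> D))) = EQ (\<lambda>D. 1 - of_bool (v \<in> D \<and> w \<in> D \<and> u \<in> D))"
    by (intro Bochner_Integration.integral_cong) auto
  then have 1: "EQ (\<lambda>D. of_bool (\<not> (v \<in> D \<and> w \<in> D \<and> u \<in> D))) = 1 - hit 3"
    using lt distinct by (simp add: EQ_hit3 del: of_bool_conj)
  have "EG (\<lambda>D. of_bool (\<exists>i<n. v \<in> D i \<and> w \<in> D i \<and> u \<in> D i))
      = EG (\<lambda>D. 1 - of_bool (\<forall>i<n. \<not> (v \<in> D i \<and> w \<in> D i \<and> u \<in> D i)))"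
    by (intro Bochner_Integration.integral_cong) auto
  also have "\<dots> = 1 - EG (\<lambda>D. of_bool (\<forall>i<n. \<not> (v \<in> D i \<and> w \<in> D i \<and> u \<in> D i)))"
    by simp
  finally show ?thesis
    unfolding prob_all_sets[of "\<lambda>X. \<not> (v \<in> X \<and> w \<in> X \<and> u \<in> X)"] 1 common_set_prob_def .
qed

end

lemma EG_edge:
  assumes "v < m" "w < m" "v \<noteq> w"
  shows "EG (\<lambda>D. of_bool (adj D v w)) = edge_prob"
proof -
  \<comment> \<open>A third vertex, since the complementary events are stated for three distinct ones.\<close>
  obtain u where u: "u < m" "v \<noteq> u" "w \<noteq> u"
  proof -
    have "card {v, w} < card W" using m_ge by (simp add: card_insert_if)
    then have "\<not> W \<subseteq> {v, w}" using card_mono[of "{v, w}" W] by auto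
    then show ?thesis using that by auto
  qed
  have "EG (\<lambda>D. of_bool (adj D v w)) = EG (\<lambda>D. 1 - of_bool (\<not> adj D v w))"
    by (intro Bochner_Integration.integral_cong) auto
  also have "\<dots> = 1 - EG (\<lambda>D. of_bool (\<not> adj D v w))"
    by simp
  finally show ?thesis
    unfolding EG_not_adj[OF assms(1,2) u(1) assms(3) u(2,3)] edge_prob_def .
qed

lemma EG_path:
  assumes lt: "v < m" "w < m" "u < m" and distinct: "v \<noteq> w" "v \<noteq> u" "w \<noteq> u"
  shows "EG (\<lambda>D. of_bool (adj D v w \<and> adj D v u)) = path_prob"
proof -
  have "EG (\<lambda>D. of_bool (adj D v w \<and> adj D v u))
     = EG (\<lambda>D. 1 - of_bool (\<not> adj D v w) - of_bool (\<not> adj D v u) + of_bool (\<not> adj D v w \<and> \<not> adj D v u))"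
    by (intro Bochner_Integration.integral_cong) auto
  then show ?thesis
    using assms by (simp add: EG_not_adj[of v w u] EG_not_adj[of v u w] EG_not_adj2 path_prob_def
        del: of_bool_conj of_bool_not_iff)
qed

lemma EG_triangle:
  assumes lt: "v < m" "w < m" "u < m" and distinct: "v \<noteq> w" "v \<noteq> u" "w \<noteq> u"
  shows "EG (\<lambda>D. of_bool (adj D v w \<and> adj D v u \<and> adj D w u)) = triangle_prob"
proof -
  have "EG (\<lambda>D. of_bool (adj D v w \<and> adj D v u \<and> adj D w u))
     = EG (\<lambda>D. 1 - of_bool (\<not> adj D v w) - of_bool (\<not> adj D v u) - of_bool (\<not> adj D w u)
         + of_bool (\<not> adj D v w \<and> \<not> adj D v u) + of_bool (\<not> adj D w v \<and> \<not> adj D w u)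
         + of_bool (\<not> adj D u v \<and> \<not> adj D u w)
         - of_bool (\<not> adj D v w \<and> \<not> adj D v u \<and> \<not> adj D w u))"
    by (intro Bochner_Integration.integral_cong refl)
       (use adj_commute[of _ w v] adj_commute[of _ u v] adj_commute[of _ u w] in auto)
  then show ?thesis
    using assms by (simp add: EG_not_adj[of v w u] EG_not_adj[of v u w] EG_not_adj[of w u v]
        EG_not_adj2[of v w u] EG_not_adj2[of w v u] EG_not_adj2[of u v w] EG_not_adj3 triangle_prob_def
        del: of_bool_conj of_bool_not_iff)
qed

text \<open>The uniform pair may be summed in either order. The conditional quantities need the second order, in which \<open>v\<^sub>2\<close>,
whose degree is prescribed, comes first.\<close>

lemma sum_ordered_pairs:
  fixes F :: "nat \<Rightarrow> nat \<Rightarrow> real"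
  shows "(\<Sum>(v, w)\<in>ordered_pairs m. F v w) = (\<Sum>v<m. \<Sum>w\<in>W - {v}. F v w)"
    and "(\<Sum>(v, w)\<in>ordered_pairs m. F v w) = (\<Sum>w<m. \<Sum>v\<in>W - {w}. F v w)"
proof -
  have 1: "ordered_pairs m = Sigma W (\<lambda>v. W - {v})" by (auto simp: ordered_pairs_def)
  show a: "(\<Sum>(v, w)\<in>ordered_pairs m. F v w) = (\<Sum>v<m. \<Sum>w\<in>W - {v}. F v w)" for F
    unfolding 1 by (simp add: sum.Sigma)
  have "(\<Sum>(v, w)\<in>ordered_pairs m. F v w) = (\<Sum>(v, w)\<in>ordered_pairs m. F w v)"
    by (rule sum.reindex_bij_witness[where i = prod.swap and j = prod.swap])
       (auto simp: ordered_pairs_def)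
  then show "(\<Sum>(v, w)\<in>ordered_pairs m. F v w) = (\<Sum>w<m. \<Sum>v\<in>W - {w}. F v w)"
    unfolding a[of "\<lambda>v w. F w v"] .
qed

lemma expectation_passive_model:
  "measure_pmf.expectation (passive_model n m P) (\<lambda>(D, v, w). f D v w)
    = (\<Sum>(v, w)\<in>ordered_pairs m. EG (\<lambda>D. f D v w)) / card (ordered_pairs m)"
proof -
  have fin: "finite (ordered_pairs m)"
    by (rule finite_subset[of _ "W \<times> W"]) (auto simp: ordered_pairs_def)
  have ne: "ordered_pairs m \<noteq> {}"
  proof -
    have "(0, 1) \<in> ordered_pairs m" using m_ge by (simp add: ordered_pairs_def)
    then show ?thesis by blast
  qed
  have eq: "passive_model n m P = bind_pmf (pmf_of_set (ordered_pairs m)) (\<lambda>y. map_pmf (\<lambda>D. (D, y)) G)"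
    unfolding passive_model_def pair_pmf_def map_pmf_def by (rule bind_commute_pmf)
  show ?thesis
    unfolding eq using finite_set_G
    by (subst pmf_expectation_bind_pmf_of_set[OF ne fin])
       (simp_all add: case_prod_unfold divide_inverse sum_distrib_left mult.commute)
qed

lemma expectation_given_passive_model:
  assumes pos: "(\<Sum>(v, w)\<in>ordered_pairs m. EG (\<lambda>D. of_bool (A D v w))) > 0"
  shows "expectation_given (passive_model n m P) {(D, v, w). A D v w} (\<lambda>(D, v, w). f D v w)
    = (\<Sum>(v, w)\<in>ordered_pairs m. EG (\<lambda>D. of_bool (A D v w) * f D v w))
      / (\<Sum>(v, w)\<in>ordered_pairs m. EG (\<lambda>D. of_bool (A D v w)))"
proof -
  let ?M = "passive_model n m P" and ?c = "real (card (ordered_pairs m))"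
  have c: "?c > 0"
  proof (rule ccontr)
    assume "\<not> ?c > 0"
    then have "infinite (ordered_pairs m) \<or> ordered_pairs m = {}" by (auto simp: card_gt_0_iff)
    then have "(\<Sum>(v, w)\<in>ordered_pairs m. EG (\<lambda>D. of_bool (A D v w))) = 0"
      by (elim disjE) (simp_all only: sum.infinite sum.empty not_False_eq_True)
    with pos show False by linarith
  qed
  have prob: "measure_pmf.prob ?M {(D, v, w). A D v w}
      = (\<Sum>(v, w)\<in>ordered_pairs m. EG (\<lambda>D. of_bool (A D v w))) / ?c"
  proof -
    have "measure_pmf.prob ?M {(D, v, w). A D v w} = measure_pmf.expectation ?M (\<lambda>(D, v, w). of_bool (A D v w))"
      unfolding expectation_of_bool[symmetric] case_prod_unfold by simp
    then show ?thesis unfolding expectation_passive_model .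
  qed
  have "measure_pmf.expectation ?M (\<lambda>x. indicator {(D, v, w). A D v w} x * (case x of (D, v, w) \<Rightarrow> f D v w))
     = measure_pmf.expectation ?M (\<lambda>(D, v, w). of_bool (A D v w) * f D v w)"
    by (intro Bochner_Integration.integral_cong) (auto simp: indicator_def)
  also have "\<dots> = (\<Sum>(v, w)\<in>ordered_pairs m. EG (\<lambda>D. of_bool (A D v w) * f D v w)) / ?c"
    by (rule expectation_passive_model)
  finally show ?thesis
    using pos c by (subst expectation_given_eq) (simp_all add: prob)
qed

lemma real_deg: "real (deg n m D v) = (\<Sum>u\<in>W - {v}. of_bool (adj D v u))"
proof -
  have "{u \<in> W. adj D v u} = {u \<in> W - {v}. adj D v u}" by (auto simp: adjacent_def)
  then show ?thesis by (simp add: deg_def of_bool_def sum.If_cases Int_def)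
qed

lemma real_common_deg:
  "real (common_deg n m D v w) = (\<Sum>u\<in>W - {v, w}. of_bool (adj D v u \<and> adj D w u))"
proof -
  have "{u \<in> W. adj D v u \<and> adj D w u} = {u \<in> W - {v, w}. adj D v u \<and> adj D w u}"
    by (auto simp: adjacent_def)
  then show ?thesis by (simp add: common_deg_def of_bool_def sum.If_cases Int_def)
qed

lemma card_W_minus: "v < m \<Longrightarrow> real (card (W - {v})) = real m - 1"
  "v < m \<Longrightarrow> w < m \<Longrightarrow> v \<noteq> w \<Longrightarrow> real (card (W - {v, w})) = real m - 2"
  using m_ge by (auto simp: card_Diff_subset of_nat_diff)

lemma sum_edge_prob:
  "(\<Sum>(v, w)\<in>ordered_pairs m. EG (\<lambda>D. of_bool (adj D v w))) = real m * (real m - 1) * edge_prob"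
proof -
  have "(\<Sum>(v, w)\<in>ordered_pairs m. EG (\<lambda>D. of_bool (adj D v w))) = (\<Sum>v<m. \<Sum>w\<in>W - {v}. edge_prob)"
    unfolding sum_ordered_pairs(1) by (intro sum.cong refl EG_edge) auto
  also have "\<dots> = (\<Sum>v<m. (real m - 1) * edge_prob)"
    by (intro sum.cong refl) (use card_W_minus in auto)
  finally show ?thesis by simp
qed

lemma b_mean_eq:
  assumes "edge_prob > 0"
  shows "b_mean n m P = 1 + (real m - 2) * path_prob / edge_prob"
proof -
  have pos: "real m * (real m - 1) * edge_prob > 0" using assms m_ge by simp
  have one: "EG (\<lambda>D. of_bool (adj D v w) * real (deg n m D v)) = edge_prob + (real m - 2) * path_prob"
    if vw: "v < m" "w < m" "v \<noteq> w" for v w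
  proof -
    have W: "W - {v} = insert w (W - {v, w})" using vw by auto
    have "of_bool (adj D v w) * real (deg n m D v)
        = of_bool (adj D v w) + (\<Sum>u\<in>W - {v, w}. of_bool (adj D v w \<and> adj D v u))" for D
      unfolding real_deg by (subst W, subst sum.insert) (auto simp: of_bool_def)
    then have "EG (\<lambda>D. of_bool (adj D v w) * real (deg n m D v))
        = EG (\<lambda>D. of_bool (adj D v w)) + (\<Sum>u\<in>W - {v, w}. EG (\<lambda>D. of_bool (adj D v w \<and> adj D v u)))"
      by (simp only: EG_sum Bochner_Integration.integral_add[OF integrable_G integrable_G])
    also have "(\<Sum>u\<in>W - {v, w}. EG (\<lambda>D. of_bool (adj D v w \<and> adj D v u))) = (\<Sum>u\<in>W - {v, w}. path_prob)"
      by (intro sum.cong refl EG_path) (use vw in auto)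
    finally show ?thesis
      using vw by (simp add: EG_edge card_W_minus)
  qed
  have "(\<Sum>(v, w)\<in>ordered_pairs m. EG (\<lambda>D. of_bool (adj D v w) * real (deg n m D v)))
      = (\<Sum>v<m. \<Sum>w\<in>W - {v}. edge_prob + (real m - 2) * path_prob)"
    unfolding sum_ordered_pairs(1) by (intro sum.cong refl one) auto
  also have "\<dots> = (\<Sum>v<m. (real m - 1) * (edge_prob + (real m - 2) * path_prob))"
    by (intro sum.cong refl) (use card_W_minus in auto)
  also have "\<dots> = real m * (real m - 1) * (edge_prob + (real m - 2) * path_prob)" by simp
  finally have num: "(\<Sum>(v, w)\<in>ordered_pairs m. EG (\<lambda>D. of_bool (adj D v w) * real (deg n m D v)))
      = real m * (real m - 1) * (edge_prob + (real m - 2) * path_prob)" .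
  have "b_mean n m P = real m * (real m - 1) * (edge_prob + (real m - 2) * path_prob)
      / (real m * (real m - 1) * edge_prob)"
    unfolding b_mean_def using pos
    by (subst expectation_given_passive_model) (simp_all add: sum_edge_prob num)
  also have "\<dots> = (edge_prob + (real m - 2) * path_prob) / edge_prob"
    using m_ge by simp
  also have "\<dots> = 1 + (real m - 2) * path_prob / edge_prob"
    using assms by (simp add: add_divide_distrib)
  finally show ?thesis .
qed

lemma h_mean_eq:
  assumes "edge_prob > 0"
  shows "h_mean n m P = (real m - 2) * triangle_prob / edge_prob"
proof -
  have pos: "real m * (real m - 1) * edge_prob > 0" using assms m_ge by simp
  have one: "EG (\<lambda>D. of_bool (adj D v w) * real (common_deg n m D v w)) = (real m - 2) * triangle_prob"
    if vw: "v < m" "w < m" "v \<noteq> w" for v w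
  proof -
    have "of_bool (adj D v w) * real (common_deg n m D v w)
        = (\<Sum>u\<in>W - {v, w}. of_bool (adj D v w \<and> adj D v u \<and> adj D w u))" for D
      unfolding real_common_deg sum_distrib_left by (intro sum.cong) auto
    then have "EG (\<lambda>D. of_bool (adj D v w) * real (common_deg n m D v w))
        = (\<Sum>u\<in>W - {v, w}. EG (\<lambda>D. of_bool (adj D v w \<and> adj D v u \<and> adj D w u)))"
      by (simp only: EG_sum)
    also have "\<dots> = (\<Sum>u\<in>W - {v, w}. triangle_prob)"
      by (intro sum.cong refl EG_triangle) (use vw in auto)
    finally show ?thesis
      using vw by (simp add: card_W_minus)
  qed
  have "(\<Sum>(v, w)\<in>ordered_pairs m. EG (\<lambda>D. of_bool (adj D v w) * real (common_deg n m D v w)))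
      = (\<Sum>v<m. \<Sum>w\<in>W - {v}. (real m - 2) * triangle_prob)"
    unfolding sum_ordered_pairs(1) by (intro sum.cong refl one) auto
  also have "\<dots> = (\<Sum>v<m. (real m - 1) * ((real m - 2) * triangle_prob))"
    by (intro sum.cong refl) (use card_W_minus in auto)
  also have "\<dots> = real m * (real m - 1) * ((real m - 2) * triangle_prob)" by simp
  finally have num: "(\<Sum>(v, w)\<in>ordered_pairs m. EG (\<lambda>D. of_bool (adj D v w) * real (common_deg n m D v w)))
      = real m * (real m - 1) * ((real m - 2) * triangle_prob)" .
  have "h_mean n m P = real m * (real m - 1) * ((real m - 2) * triangle_prob)
      / (real m * (real m - 1) * edge_prob)"
    unfolding h_mean_def using pos
    by (subst expectation_given_passive_model) (simp_all add: sum_edge_prob num)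
  also have "\<dots> = (real m - 2) * triangle_prob / edge_prob"
    using m_ge by simp
  finally show ?thesis .
qed

section \<open>Counting around one vertex\<close>

text \<open>The number of vertices to which the set \<open>X\<close> joins \<open>w\<close>. The value \<open>0\<close> for the empty set makes it compatible with the default
value of the product law.\<close>

definition set_deg :: "nat \<Rightarrow> nat set \<Rightarrow> nat" where
  "set_deg w X = (if w \<in> X then card X - 1 else 0)"

text \<open>The degree of \<open>w\<close> with every neighbour counted once for each common set; likewise \<open>set_pairs\<close> below counts the pairs
of neighbours that share a set with \<open>w\<close> once for each such set.\<close>

definition multi_deg :: "(nat \<Rightarrow> nat set) \<Rightarrow> nat \<Rightarrow> nat" where
  "multi_deg D w = (\<Sum>i<n. set_deg w (D i))"

definition set_pairs :: "(nat \<Rightarrow> nat set) \<Rightarrow> nat \<Rightarrow> real" where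
  "set_pairs D w = (\<Sum>i<n. falling_factorial (real (set_deg w (D i))) 2)"

abbreviation sum_pairs :: "nat \<Rightarrow> (nat \<Rightarrow> nat \<Rightarrow> real) \<Rightarrow> real" where
  "sum_pairs w F \<equiv> (\<Sum>v\<in>W - {w}. \<Sum>u\<in>W - {v, w}. F v u)"

text \<open>Ordered pairs \<open>(v, u)\<close> around a fixed vertex \<open>w\<close>, counted once: pairs forming a triangle with \<open>w\<close>, pairs lying with \<open>w\<close> in
one common set, and pairs for which \<open>w, v, u\<close> is a path without the closing edge.\<close>

definition triangles :: "(nat \<Rightarrow> nat set) \<Rightarrow> nat \<Rightarrow> real" where
  "triangles D w = sum_pairs w (\<lambda>v u. of_bool (adj D v w \<and> adj D v u \<and> adj D w u))"

definition covered_pairs :: "(nat \<Rightarrow> nat set) \<Rightarrow> nat \<Rightarrow> real" where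
  "covered_pairs D w = sum_pairs w (\<lambda>v u. of_bool (\<exists>i<n. v \<in> D i \<and> w \<in> D i \<and> u \<in> D i))"

definition open_paths :: "(nat \<Rightarrow> nat set) \<Rightarrow> nat \<Rightarrow> real" where
  "open_paths D w = sum_pairs w (\<lambda>v u. of_bool (adj D v w \<and> adj D v u \<and> \<not> adj D w u))"

text \<open>Counts the steps from a neighbour \<open>v\<close> of \<open>w\<close> to \<open>u\<close> through each set that avoids \<open>w\<close>. It overcounts the open paths if
\<open>v\<close> and \<open>u\<close> share several sets or \<open>u\<close> is itself a neighbour of \<open>w\<close>.\<close>

definition outer_pairs :: "(nat \<Rightarrow> nat set) \<Rightarrow> nat \<Rightarrow> real" where
  "outer_pairs D w = (\<Sum>i<n. sum_pairs w (\<lambda>v u. of_bool (adj D v w) * of_bool (v \<in> D i \<and> u \<in> D i \<and> w \<notin> D i)))"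

lemma EQ_cong:
  assumes "\<And>X. X \<subseteq> W \<Longrightarrow> F X = F' X"
  shows "EQ F = EQ F'"
  by (intro integral_cong_AE AE_pmfI) (use assms set_Q in auto)

lemma EQ_sum: "EQ (\<lambda>D. \<Sum>u\<in>A. F u D) = (\<Sum>u\<in>A. EQ (F u))"
  by (rule Bochner_Integration.integral_sum) simp

lemma sum_pairs_const: "w < m \<Longrightarrow> sum_pairs w (\<lambda>_ _. c) = (real m - 1) * (real m - 2) * c"
proof -
  assume w: "w < m"
  have "sum_pairs w (\<lambda>_ _. c) = (\<Sum>v\<in>W - {w}. (real m - 2) * c)"
    by (intro sum.cong refl) (use w card_W_minus in auto)
  also have "\<dots> = (real m - 1) * ((real m - 2) * c)"
    unfolding sum_constant card_W_minus(1)[OF w] ..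
  finally show ?thesis by simp
qed

lemma EG_diff_le:
  assumes "\<And>D. (\<And>i. D i \<subseteq> W) \<Longrightarrow> \<bar>f D - g D\<bar> \<le> h D"
  shows "\<bar>EG f - EG g\<bar> \<le> EG h"
proof -
  have "\<bar>EG f - EG g\<bar> = \<bar>EG (\<lambda>D. f D - g D)\<bar>" by simp
  also have "\<dots> \<le> EG (\<lambda>D. \<bar>f D - g D\<bar>)" by (rule integral_abs_bound)
  also have "\<dots> \<le> EG h" by (rule EG_mono) (rule assms)
  finally show ?thesis .
qed

lemma sum_of_bool_card: "finite A \<Longrightarrow> (\<Sum>x\<in>A. of_bool (R x) :: real) = real (card {x \<in> A. R x})"
  by (simp add: Int_def)

lemma real_set_deg:
  assumes "X \<subseteq> W"
  shows "real (set_deg w X) = (\<Sum>u\<in>W - {w}. of_bool (w \<in> X \<and> u \<in> X))"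
proof (cases "w \<in> X")
  case True
  have fin: "finite X" using assms finite_subset by blast
  have "{u \<in> W - {w}. w \<in> X \<and> u \<in> X} = X - {w}" using True assms by auto
  then show ?thesis
    unfolding sum_of_bool_card[OF finite_Diff[OF finite_lessThan]] using True fin by (simp add: set_deg_def)
qed (simp add: set_deg_def)

lemma set_deg_pairs:
  assumes X: "X \<subseteq> W"
  shows "falling_factorial (real (set_deg w X)) 2
    = sum_pairs w (\<lambda>v u. of_bool (v \<in> X \<and> w \<in> X \<and> u \<in> X))"
proof (cases "w \<in> X")
  case True
  have fin: "finite X" using X finite_subset by blast
  have inner: "(\<Sum>u\<in>W - {v, w}. of_bool (v \<in> X \<and> w \<in> X \<and> u \<in> X)) = of_bool (w \<in> X \<and> v \<in> X) * real (card X - 2)"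
    if v: "v \<noteq> w" for v
  proof (cases "v \<in> X")
    case True
    have "{u \<in> W - {v, w}. v \<in> X \<and> w \<in> X \<and> u \<in> X} = X - {v, w}" using True \<open>w \<in> X\<close> X by auto
    moreover have "card (X - {v, w}) = card X - 2"
      using True \<open>w \<in> X\<close> v fin by (simp add: card_Diff_subset)
    ultimately show ?thesis
      unfolding sum_of_bool_card[OF finite_Diff[OF finite_lessThan]] using True \<open>w \<in> X\<close> by simp
  qed simp
  have "sum_pairs w (\<lambda>v u. of_bool (v \<in> X \<and> w \<in> X \<and> u \<in> X))
      = (\<Sum>v\<in>W - {w}. of_bool (w \<in> X \<and> v \<in> X) * real (card X - 2))"
    by (intro sum.cong refl inner) auto
  also have "\<dots> = real (set_deg w X) * real (card X - 2)"
    by (simp only: real_set_deg[OF X] sum_distrib_right)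
  also have "\<dots> = falling_factorial (real (set_deg w X)) 2"
    unfolding falling_factorial_2 using True by (simp add: set_deg_def numeral_2_eq_2)
  finally show ?thesis ..
qed (simp add: set_deg_def falling_factorial_def numeral_2_eq_2)

lemma of_bool_ex_le_sum: "(of_bool (\<exists>i<n. R i) :: real) \<le> (\<Sum>i<n. of_bool (R i))"
proof (cases "\<exists>i<n. R i")
  case True
  then obtain i where i: "i < n" "R i" by auto
  have "(1 :: real) = of_bool (R i)" using i by simp
  also have "\<dots> \<le> (\<Sum>i<n. of_bool (R i))"
    using i by (intro member_le_sum) auto
  finally show ?thesis using True by simp
qed (simp add: sum_nonneg)

lemma deg_le_multi_deg:
  assumes "\<And>i. D i \<subseteq> W"
  shows "deg n m D w \<le> multi_deg D w"
proof -
  have "real (deg n m D w) \<le> (\<Sum>u\<in>W - {w}. \<Sum>i<n. of_bool (w \<in> D i \<and> u \<in> D i))"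
    unfolding real_deg adjacent_def
    by (intro sum_mono order_trans[OF _ of_bool_ex_le_sum]) auto
  also have "\<dots> = real (multi_deg D w)"
    by (subst sum.swap) (simp only: multi_deg_def real_set_deg[OF assms] of_nat_sum)
  finally show ?thesis by simp
qed

lemma covered_le_triangles: "covered_pairs D w \<le> triangles D w"
  unfolding covered_pairs_def triangles_def
  by (intro sum_mono) (auto simp: adjacent_def)

lemma covered_le_set_pairs:
  assumes "\<And>i. D i \<subseteq> W"
  shows "covered_pairs D w \<le> set_pairs D w"
proof -
  have "covered_pairs D w \<le> sum_pairs w (\<lambda>v u. \<Sum>i<n. of_bool (v \<in> D i \<and> w \<in> D i \<and> u \<in> D i))"
    unfolding covered_pairs_def by (intro sum_mono of_bool_ex_le_sum)
  also have "\<dots> = (\<Sum>i<n. sum_pairs w (\<lambda>v u. of_bool (v \<in> D i \<and> w \<in> D i \<and> u \<in> D i)))"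
    by (simp only: sum.swap[of _ "{..<n}"])
  also have "\<dots> = set_pairs D w"
    by (simp only: set_pairs_def set_deg_pairs[OF assms])
  finally show ?thesis .
qed

text \<open>A crude bound, used only on the event that the degree is \<open>k\<close>, where it replaces uniform integrability.\<close>

lemma triangles_le: "triangles D w \<le> (real (deg n m D w))\<^sup>2"
proof -
  have "triangles D w \<le> (\<Sum>v\<in>W - {w}. of_bool (adj D w v) * real (deg n m D w))"
    unfolding triangles_def
  proof (rule sum_mono)
    fix v assume v: "v \<in> W - {w}"
    have "(\<Sum>u\<in>W - {v, w}. of_bool (adj D v w \<and> adj D v u \<and> adj D w u))
        \<le> (\<Sum>u\<in>W - {v, w}. of_bool (adj D w v) * of_bool (adj D w u) :: real)"
      using adj_commute by (intro sum_mono) auto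
    also have "\<dots> \<le> (\<Sum>u\<in>W - {w}. of_bool (adj D w v) * of_bool (adj D w u))"
      by (intro sum_mono2) auto
    finally show "(\<Sum>u\<in>W - {v, w}. of_bool (adj D v w \<and> adj D v u \<and> adj D w u))
        \<le> of_bool (adj D w v) * real (deg n m D w)"
      unfolding real_deg sum_distrib_left .
  qed
  also have "\<dots> = (real (deg n m D w))\<^sup>2"
    unfolding power2_eq_square by (simp only: real_deg sum_distrib_right)
  finally show ?thesis .
qed

lemma set_pairs_le: "set_pairs D w \<le> (real (multi_deg D w))\<^sup>2"
proof -
  have "set_pairs D w \<le> (\<Sum>i<n. real (set_deg w (D i)) * real (multi_deg D w))"
    unfolding set_pairs_def
  proof (rule sum_mono)
    fix i assume i: "i \<in> {..<n}"
    have "set_deg w (D i) \<le> multi_deg D w"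
      unfolding multi_deg_def using i by (intro member_le_sum) auto
    then show "falling_factorial (real (set_deg w (D i))) 2 \<le> real (set_deg w (D i)) * real (multi_deg D w)"
      unfolding falling_factorial_2 by (intro mult_left_mono) auto
  qed
  also have "\<dots> = (real (multi_deg D w))\<^sup>2"
    unfolding power2_eq_square by (simp add: multi_deg_def sum_distrib_right)
  finally show ?thesis .
qed

lemma triangles_nonneg: "0 \<le> triangles D w"
  unfolding triangles_def by (intro sum_nonneg) auto

lemma set_pairs_nonneg: "0 \<le> set_pairs D w"
  unfolding set_pairs_def by (intro sum_nonneg falling_factorial_nonneg)

context
  fixes w assumes w: "w < m"
begin

lemma EG_deg: "EG (\<lambda>D. real (deg n m D w)) = (real m - 1) * edge_prob"
proof -
  have "EG (\<lambda>D. real (deg n m D w)) = (\<Sum>u\<in>W - {w}. edge_prob)"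
    unfolding real_deg EG_sum by (intro sum.cong refl EG_edge) (use w in auto)
  then show ?thesis unfolding sum_constant card_W_minus(1)[OF w] .
qed

lemma EG_multi_deg: "EG (\<lambda>D. real (multi_deg D w)) = (real m - 1) * (real n * hit 2)"
proof -
  have "EQ (\<lambda>X. real (set_deg w X)) = EQ (\<lambda>X. \<Sum>u\<in>W - {w}. of_bool (w \<in> X \<and> u \<in> X))"
    by (intro EQ_cong real_set_deg)
  also have "\<dots> = (\<Sum>u\<in>W - {w}. hit 2)"
    unfolding EQ_sum by (intro sum.cong refl EQ_hit2) (use w in auto)
  finally have 1: "EQ (\<lambda>X. real (set_deg w X)) = (real m - 1) * hit 2"
    unfolding sum_constant card_W_minus(1)[OF w] .
  have "EG (\<lambda>D. real (multi_deg D w)) = (\<Sum>i<n. EG (\<lambda>D. real (set_deg w (D i))))"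
    by (simp only: multi_deg_def of_nat_sum EG_sum)
  also have "\<dots> = (\<Sum>i<n. (real m - 1) * hit 2)"
    unfolding 1[symmetric] by (intro sum.cong refl EG_component) auto
  finally show ?thesis by simp
qed

lemma EG_sum_pairs:
  assumes "\<And>v u. v < m \<Longrightarrow> u < m \<Longrightarrow> v \<noteq> w \<Longrightarrow> u \<noteq> w \<Longrightarrow> v \<noteq> u \<Longrightarrow> EG (F v u) = c"
  shows "EG (\<lambda>D. sum_pairs w (\<lambda>v u. F v u D)) = (real m - 1) * (real m - 2) * c"
proof -
  have "EG (\<lambda>D. sum_pairs w (\<lambda>v u. F v u D)) = sum_pairs w (\<lambda>v u. c)"
    unfolding EG_sum by (intro sum.cong refl assms) auto
  then show ?thesis unfolding sum_pairs_const[OF w] .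
qed

lemma EG_triangles: "EG (\<lambda>D. triangles D w) = (real m - 1) * (real m - 2) * triangle_prob"
  unfolding triangles_def
proof (rule EG_sum_pairs)
  fix v u assume vu: "v < m" "u < m" "v \<noteq> w" "u \<noteq> w" "v \<noteq> u"
  then show "EG (\<lambda>D. of_bool (adj D v w \<and> adj D v u \<and> adj D w u)) = triangle_prob"
    using w by (intro EG_triangle) auto
qed

lemma EG_covered_pairs: "EG (\<lambda>D. covered_pairs D w) = (real m - 1) * (real m - 2) * common_set_prob"
  unfolding covered_pairs_def
proof (rule EG_sum_pairs)
  fix v u assume vu: "v < m" "u < m" "v \<noteq> w" "u \<noteq> w" "v \<noteq> u"
  then show "EG (\<lambda>D. of_bool (\<exists>i<n. v \<in> D i \<and> w \<in> D i \<and> u \<in> D i)) = common_set_prob"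
    using w by (intro EG_common_set) auto
qed

lemma EG_set_pairs: "EG (\<lambda>D. set_pairs D w) = (real m - 1) * (real m - 2) * (real n * hit 3)"
proof -
  have "EQ (\<lambda>X. falling_factorial (real (set_deg w X)) 2)
      = EQ (\<lambda>X. sum_pairs w (\<lambda>v u. of_bool (v \<in> X \<and> w \<in> X \<and> u \<in> X)))"
    by (intro EQ_cong set_deg_pairs)
  also have "\<dots> = sum_pairs w (\<lambda>v u. hit 3)"
    unfolding EQ_sum by (intro sum.cong refl EQ_hit3) (use w in auto)
  finally have 1: "EQ (\<lambda>X. falling_factorial (real (set_deg w X)) 2) = (real m - 1) * (real m - 2) * hit 3"
    unfolding sum_pairs_const[OF w] .
  have "EG (\<lambda>D. set_pairs D w) = (\<Sum>i<n. EG (\<lambda>D. falling_factorial (real (set_deg w (D i))) 2))"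
    by (simp only: set_pairs_def EG_sum)
  also have "\<dots> = (\<Sum>i<n. (real m - 1) * (real m - 2) * hit 3)"
    unfolding 1[symmetric] by (intro sum.cong refl EG_component) auto
  finally show ?thesis by simp
qed

lemma EG_open_paths: "EG (\<lambda>D. open_paths D w) = (real m - 1) * (real m - 2) * (path_prob - triangle_prob)"
  unfolding open_paths_def
proof (rule EG_sum_pairs)
  fix v u assume vu: "v < m" "u < m" "v \<noteq> w" "u \<noteq> w" "v \<noteq> u"
  have "EG (\<lambda>D. of_bool (adj D v w \<and> adj D v u \<and> \<not> adj D w u))
      = EG (\<lambda>D. of_bool (adj D v w \<and> adj D v u) - of_bool (adj D v w \<and> adj D v u \<and> adj D w u))"
    by (intro Bochner_Integration.integral_cong) auto
  also have "\<dots> = EG (\<lambda>D. of_bool (adj D v w \<and> adj D v u)) - EG (\<lambda>D. of_bool (adj D v w \<and> adj D v u \<and> adj D w u))"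
    by (rule Bochner_Integration.integral_diff) simp_all
  finally show "EG (\<lambda>D. of_bool (adj D v w \<and> adj D v u \<and> \<not> adj D w u)) = path_prob - triangle_prob"
    using vu w EG_path[of v w u] EG_triangle[of v w u] by simp
qed

end

text \<open>Bounds for the expected overcounts: of neighbours, of triangles (those not explained by a single set, plus
repetitions in \<open>set_pairs\<close>), and of open paths. Under the hypotheses of the theorem each is \<open>O(1/n)\<close>.\<close>

definition deg_err :: real where
  "deg_err = (real m - 1) * (real n * hit 2 - edge_prob)"
definition triangle_err :: real where
  "triangle_err = (real m - 1) * (real m - 2)
     * ((triangle_prob - common_set_prob) + (real n * hit 3 - common_set_prob))"
definition open_path_err :: real where
  "open_path_err = (real m - 1) * (real m - 2)
     * (real n * (hit 2 - hit 3) * edge_prob - (path_prob - triangle_prob))"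

lemma EG_deg_gap: "w < m \<Longrightarrow> EG (\<lambda>D. real (multi_deg D w) - real (deg n m D w)) = deg_err"
  by (simp add: EG_multi_deg EG_deg deg_err_def algebra_simps)

text \<open>The multiplicity degree is never smaller, and both are integers, so they differ with probability at most their
expected difference.\<close>

lemma prob_deg_close:
  assumes w: "w < m"
  shows "\<bar>EG (\<lambda>D. of_bool (deg n m D w = k)) - EG (\<lambda>D. of_bool (multi_deg D w = k))\<bar> \<le> deg_err"
  unfolding EG_deg_gap[OF w, symmetric]
proof (rule EG_diff_le)
  fix D :: "nat \<Rightarrow> nat set" assume "\<And>i. D i \<subseteq> W"
  then have "deg n m D w \<le> multi_deg D w" by (rule deg_le_multi_deg)
  then show "\<bar>of_bool (deg n m D w = k) - of_bool (multi_deg D w = k)\<bar>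
      \<le> real (multi_deg D w) - real (deg n m D w)" by auto
qed

text \<open>Both counts dominate the pairs covered by one set, so their difference is controlled by two nonnegative
quantities with known means. Where the two degrees differ, both counts are replaced by the bound \<open>k\<^sup>2\<close>.\<close>

lemma triangles_close:
  assumes w: "w < m"
  shows "\<bar>EG (\<lambda>D. of_bool (deg n m D w = k) * triangles D w)
      - EG (\<lambda>D. of_bool (multi_deg D w = k) * set_pairs D w)\<bar> \<le> triangle_err + (real k)\<^sup>2 * deg_err"
proof -
  have "EG (\<lambda>D. (triangles D w - covered_pairs D w) + (set_pairs D w - covered_pairs D w)
      + (real k)\<^sup>2 * (real (multi_deg D w) - real (deg n m D w))) = triangle_err + (real k)\<^sup>2 * deg_err"
    using EG_deg_gap[OF w]
    by (simp add: EG_triangles[OF w] EG_covered_pairs[OF w] EG_set_pairs[OF w] triangle_err_def algebra_simps)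
  moreover have "\<bar>EG (\<lambda>D. of_bool (deg n m D w = k) * triangles D w)
      - EG (\<lambda>D. of_bool (multi_deg D w = k) * set_pairs D w)\<bar>
    \<le> EG (\<lambda>D. (triangles D w - covered_pairs D w) + (set_pairs D w - covered_pairs D w)
      + (real k)\<^sup>2 * (real (multi_deg D w) - real (deg n m D w)))"
  proof (rule EG_diff_le)
    fix D :: "nat \<Rightarrow> nat set" assume D: "\<And>i. D i \<subseteq> W"
    note le = deg_le_multi_deg[where D = D and w = w, OF D] covered_le_set_pairs[where D = D and w = w, OF D] covered_le_triangles[of D w]
      triangles_le[of D w] set_pairs_le[of D w] triangles_nonneg[of D w] set_pairs_nonneg[of D w]
    show "\<bar>of_bool (deg n m D w = k) * triangles D w - of_bool (multi_deg D w = k) * set_pairs D w\<bar>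
        \<le> (triangles D w - covered_pairs D w) + (set_pairs D w - covered_pairs D w)
          + (real k)\<^sup>2 * (real (multi_deg D w) - real (deg n m D w))"
    proof (cases "deg n m D w = multi_deg D w")
      case True
      then show ?thesis using le by (cases "multi_deg D w = k") auto
    next
      case False
      have "\<bar>of_bool (deg n m D w = k) * triangles D w - of_bool (multi_deg D w = k) * set_pairs D w\<bar>
          \<le> (real k)\<^sup>2 * 1"
        using False le by auto
      also have "\<dots> \<le> (real k)\<^sup>2 * (real (multi_deg D w) - real (deg n m D w))"
        using False le by (intro mult_left_mono) auto
      finally show ?thesis using le by linarith
    qed
  qed
  ultimately show ?thesis by simp
qed

lemma open_le_outer: "open_paths D w \<le> outer_pairs D w"
proof -
  have "open_paths D w \<le> sum_pairs w (\<lambda>v u. of_bool (adj D v w) * (\<Sum>i<n. of_bool (v \<in> D i \<and> u \<in> D i \<and> w \<notin> D i)))"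
    unfolding open_paths_def
  proof (intro sum_mono)
    fix v u assume vu: "v \<in> W - {w}" "u \<in> W - {v, w}"
    have "of_bool (adj D v w \<and> adj D v u \<and> \<not> adj D w u)
        \<le> of_bool (adj D v w) * (of_bool (\<exists>i<n. v \<in> D i \<and> u \<in> D i \<and> w \<notin> D i) :: real)"
      using vu by (auto simp: adjacent_def)
    also have "\<dots> \<le> of_bool (adj D v w) * (\<Sum>i<n. of_bool (v \<in> D i \<and> u \<in> D i \<and> w \<notin> D i))"
      by (intro mult_left_mono of_bool_ex_le_sum) auto
    finally show "of_bool (adj D v w \<and> adj D v u \<and> \<not> adj D w u)
        \<le> of_bool (adj D v w) * (\<Sum>i<n. of_bool (v \<in> D i \<and> u \<in> D i \<and> w \<notin> D i) :: real)" .
  qed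
  also have "\<dots> = outer_pairs D w"
    by (simp only: outer_pairs_def sum_distrib_left sum.swap[of _ "{..<n}"])
  finally show ?thesis .
qed

context
  fixes w assumes w: "w < m"
begin

lemma EQ_outer:
  assumes "v < m" "u < m" "v \<noteq> w" "u \<noteq> w" "v \<noteq> u"
  shows "EQ (\<lambda>X. of_bool (v \<in> X \<and> u \<in> X \<and> w \<notin> X)) = hit 2 - hit 3"
proof -
  have "EQ (\<lambda>X. of_bool (v \<in> X \<and> u \<in> X \<and> w \<notin> X))
      = EQ (\<lambda>X. of_bool (v \<in> X \<and> u \<in> X) - of_bool (v \<in> X \<and> u \<in> X \<and> w \<in> X))"
    by (intro Bochner_Integration.integral_cong) auto
  also have "\<dots> = EQ (\<lambda>X. of_bool (v \<in> X \<and> u \<in> X)) - EQ (\<lambda>X. of_bool (v \<in> X \<and> u \<in> X \<and> w \<in> X))"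
    by (rule Bochner_Integration.integral_diff) simp_all
  finally show ?thesis using assms w EQ_hit2[of v u] EQ_hit3[of v u w] by simp
qed

lemma adj_remove_set:
  assumes "w \<notin> D i"
  shows "adj (D(i := {})) v w = adj D v w" "adj (D(i := {})) w v = adj D w v"
  using assms by (auto simp: adjacent_def)

text \<open>If the \<open>i\<close>-th set avoids \<open>w\<close>, then emptying it changes neither the degree of \<open>w\<close> nor its neighbours.
Independence then separates the event that the set contains \<open>v\<close> and \<open>u\<close> from the neighbourhood of \<open>w\<close>, and summing over the
neighbours \<open>v\<close> produces the factor \<open>k\<close>.\<close>

lemma EG_weighted_outer:
  "EG (\<lambda>D. of_bool (deg n m D w = k) * outer_pairs D w)
    = (\<Sum>i<n. (hit 2 - hit 3) * (real m - 2) * (k * EG (\<lambda>D. of_bool (deg n m (D(i := {})) w = k))))"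
proof -
  have single: "EG (\<lambda>D. of_bool (deg n m D w = k) * (of_bool (adj D v w) * of_bool (v \<in> D i \<and> u \<in> D i \<and> w \<notin> D i)))
      = (hit 2 - hit 3) * EG (\<lambda>D. of_bool (adj (D(i := {})) w v) * of_bool (deg n m (D(i := {})) w = k))"
    if "i < n" "v < m" "u < m" "v \<noteq> w" "u \<noteq> w" "v \<noteq> u" for i v u
  proof -
    have "of_bool (deg n m D w = k) * (of_bool (adj D v w) * of_bool (v \<in> D i \<and> u \<in> D i \<and> w \<notin> D i))
      = of_bool (v \<in> D i \<and> u \<in> D i \<and> w \<notin> D i)
        * (of_bool (adj (D(i := {})) w v) * of_bool (deg n m (D(i := {})) w = k) :: real)" for D
    proof (cases "w \<in> D i")
      case False
      then show ?thesis
        by (simp add: adj_remove_set deg_def adj_commute[of D v w])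
    qed simp
    then have "EG (\<lambda>D. of_bool (deg n m D w = k) * (of_bool (adj D v w) * of_bool (v \<in> D i \<and> u \<in> D i \<and> w \<notin> D i)))
      = EG (\<lambda>D. of_bool (v \<in> D i \<and> u \<in> D i \<and> w \<notin> D i)
        * (of_bool (adj (D(i := {})) w v) * of_bool (deg n m (D(i := {})) w = k)))"
      by (simp only:)
    also have "\<dots> = EQ (\<lambda>X. of_bool (v \<in> X \<and> u \<in> X \<and> w \<notin> X))
        * EG (\<lambda>D. of_bool (adj (D(i := {})) w v) * of_bool (deg n m (D(i := {})) w = k))"
      by (rule EG_split[OF that(1), of "\<lambda>X. of_bool (v \<in> X \<and> u \<in> X \<and> w \<notin> X)"
            "\<lambda>D. of_bool (adj D w v) * of_bool (deg n m D w = k)"])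
    finally show ?thesis
      unfolding EQ_outer[OF that(2-)] .
  qed
  have "EG (\<lambda>D. of_bool (deg n m D w = k) * outer_pairs D w)
    = (\<Sum>i<n. sum_pairs w (\<lambda>v u. EG (\<lambda>D. of_bool (deg n m D w = k)
        * (of_bool (adj D v w) * of_bool (v \<in> D i \<and> u \<in> D i \<and> w \<notin> D i)))))"
    by (simp only: outer_pairs_def sum_distrib_left EG_sum)
  also have "\<dots> = (\<Sum>i<n. \<Sum>v\<in>W - {w}. \<Sum>u\<in>W - {v, w}.
      (hit 2 - hit 3) * EG (\<lambda>D. of_bool (adj (D(i := {})) w v) * of_bool (deg n m (D(i := {})) w = k)))"
    by (intro sum.cong refl single) auto
  also have "\<dots> = (\<Sum>i<n. \<Sum>v\<in>W - {w}. (real m - 2) *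
      ((hit 2 - hit 3) * EG (\<lambda>D. of_bool (adj (D(i := {})) w v) * of_bool (deg n m (D(i := {})) w = k))))"
    by (intro sum.cong refl) (use w card_W_minus(2) in auto)
  also have "\<dots> = (\<Sum>i<n. (hit 2 - hit 3) * (real m - 2) *
      EG (\<lambda>D. real (deg n m (D(i := {})) w) * of_bool (deg n m (D(i := {})) w = k)))"
    by (simp only: real_deg sum_distrib_right EG_sum) (simp add: sum_distrib_left mult_ac)
  also have "\<dots> = (\<Sum>i<n. (hit 2 - hit 3) * (real m - 2) * (k * EG (\<lambda>D. of_bool (deg n m (D(i := {})) w = k))))"
  proof (intro sum.cong refl arg_cong2[where f = "(*)"])
    fix i
    have "EG (\<lambda>D. real (deg n m (D(i := {})) w) * of_bool (deg n m (D(i := {})) w = k))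
        = EG (\<lambda>D. real k * of_bool (deg n m (D(i := {})) w = k))"
      by (intro Bochner_Integration.integral_cong) auto
    then show "EG (\<lambda>D. real (deg n m (D(i := {})) w) * of_bool (deg n m (D(i := {})) w = k))
        = real k * EG (\<lambda>D. of_bool (deg n m (D(i := {})) w = k))" by simp
  qed
  finally show ?thesis .
qed

lemma prob_deg_remove_set:
  assumes "i < n"
  shows "\<bar>EG (\<lambda>D. of_bool (deg n m (D(i := {})) w = k)) - EG (\<lambda>D. of_bool (deg n m D w = k))\<bar> \<le> hit 1"
proof -
  have "\<bar>EG (\<lambda>D. of_bool (deg n m (D(i := {})) w = k)) - EG (\<lambda>D. of_bool (deg n m D w = k))\<bar>
      \<le> EG (\<lambda>D. of_bool (w \<in> D i))"
  proof (rule EG_diff_le)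
    fix D :: "nat \<Rightarrow> nat set"
    show "\<bar>of_bool (deg n m (D(i := {})) w = k) - of_bool (deg n m D w = k)\<bar> \<le> (of_bool (w \<in> D i) :: real)"
    proof (cases "w \<in> D i")
      case False
      then show ?thesis by (simp add: adj_remove_set deg_def)
    qed auto
  qed
  also have "\<dots> = hit 1"
    using EG_component[OF assms, of "\<lambda>X. of_bool (w \<in> X)"] EQ_hit1[OF w] by simp
  finally show ?thesis .
qed

lemma EG_outer_le: "EG (\<lambda>D. outer_pairs D w) \<le> (real m - 1) * (real m - 2) * (real n * (hit 2 - hit 3) * edge_prob)"
proof -
  have single: "EG (\<lambda>D. of_bool (adj D v w) * of_bool (v \<in> D i \<and> u \<in> D i \<and> w \<notin> D i))
      \<le> (hit 2 - hit 3) * edge_prob"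
    if "i < n" "v < m" "u < m" "v \<noteq> w" "u \<noteq> w" "v \<noteq> u" for i v u
  proof -
    have "EG (\<lambda>D. of_bool (adj D v w) * of_bool (v \<in> D i \<and> u \<in> D i \<and> w \<notin> D i))
      = EG (\<lambda>D. of_bool (v \<in> D i \<and> u \<in> D i \<and> w \<notin> D i) * of_bool (adj (D(i := {})) v w))"
    proof (rule EG_cong)
      fix D :: "nat \<Rightarrow> nat set"
      show "of_bool (adj D v w) * of_bool (v \<in> D i \<and> u \<in> D i \<and> w \<notin> D i)
          = (of_bool (v \<in> D i \<and> u \<in> D i \<and> w \<notin> D i) * of_bool (adj (D(i := {})) v w) :: real)"
        by (cases "w \<in> D i") (simp_all add: adj_remove_set)
    qed
    also have "\<dots> = EQ (\<lambda>X. of_bool (v \<in> X \<and> u \<in> X \<and> w \<notin> X)) * EG (\<lambda>D. of_bool (adj (D(i := {})) v w))"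
      by (rule EG_split[OF that(1), of "\<lambda>X. of_bool (v \<in> X \<and> u \<in> X \<and> w \<notin> X)" "\<lambda>D. of_bool (adj D v w)"])
    also have "\<dots> \<le> (hit 2 - hit 3) * EG (\<lambda>D. of_bool (adj D v w))"
      unfolding EQ_outer[OF that(2-)]
      by (intro mult_left_mono EG_mono) (use hit3_le_hit2 in \<open>auto simp: adjacent_def split: if_splits\<close>)
    also have "EG (\<lambda>D. of_bool (adj D v w)) = edge_prob"
      using that w by (intro EG_edge) auto
    finally show ?thesis .
  qed
  have "EG (\<lambda>D. outer_pairs D w)
    = (\<Sum>i<n. sum_pairs w (\<lambda>v u. EG (\<lambda>D. of_bool (adj D v w) * of_bool (v \<in> D i \<and> u \<in> D i \<and> w \<notin> D i))))"
    by (simp only: outer_pairs_def EG_sum)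
  also have "\<dots> \<le> (\<Sum>i<n. sum_pairs w (\<lambda>v u. (hit 2 - hit 3) * edge_prob))"
    by (intro sum_mono single) auto
  finally show ?thesis
    unfolding sum_pairs_const[OF w] by (simp add: mult_ac)
qed

text \<open>The first error comes from restoring the emptied set, which matters only if it contains \<open>w\<close>; the second one from the
overcount in \<open>outer_pairs\<close>.\<close>

lemma open_paths_close:
  "\<bar>EG (\<lambda>D. of_bool (deg n m D w = k) * open_paths D w)
    - real n * (hit 2 - hit 3) * (real m - 2) * k * EG (\<lambda>D. of_bool (deg n m D w = k))\<bar>
   \<le> real n * (hit 2 - hit 3) * (real m - 2) * k * hit 1 + open_path_err"
proof -
  let ?c = "(hit 2 - hit 3) * (real m - 2) * k"
  let ?p = "EG (\<lambda>D. of_bool (deg n m D w = k))"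
  let ?M = "EG (\<lambda>D. of_bool (deg n m D w = k) * outer_pairs D w)"
  have c: "0 \<le> ?c" using hit3_le_hit2 m_ge by simp
  have 1: "\<bar>?M - real n * ?c * ?p\<bar> \<le> real n * ?c * hit 1"
  proof -
    have eq: "?M - real n * ?c * ?p = (\<Sum>i<n. ?c * (EG (\<lambda>D. of_bool (deg n m (D(i := {})) w = k)) - ?p))"
      unfolding EG_weighted_outer by (simp add: sum_subtractf right_diff_distrib mult.assoc)
    have "\<bar>?M - real n * ?c * ?p\<bar> \<le> (\<Sum>i<n. ?c * hit 1)"
      unfolding eq
    proof (intro order_trans[OF sum_abs] sum_mono)
      fix i assume "i \<in> {..<n}"
      then have "\<bar>EG (\<lambda>D. of_bool (deg n m (D(i := {})) w = k)) - ?p\<bar> \<le> hit 1"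
        by (intro prob_deg_remove_set) auto
      then show "\<bar>?c * (EG (\<lambda>D. of_bool (deg n m (D(i := {})) w = k)) - ?p)\<bar> \<le> ?c * hit 1"
        unfolding abs_mult[of ?c] abs_of_nonneg[OF c] by (rule mult_left_mono[OF _ c])
    qed
    then show ?thesis by (simp add: mult.assoc)
  qed
  have "\<bar>EG (\<lambda>D. of_bool (deg n m D w = k) * open_paths D w) - ?M\<bar> \<le> EG (\<lambda>D. outer_pairs D w - open_paths D w)"
    using open_le_outer[of _ w] by (intro EG_diff_le) (auto simp: abs_if algebra_simps)
  also have "\<dots> = EG (\<lambda>D. outer_pairs D w) - EG (\<lambda>D. open_paths D w)" by simp
  also have "\<dots> \<le> open_path_err"
    using EG_outer_le unfolding EG_open_paths[OF w] open_path_err_def by (simp add: right_diff_distrib)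
  finally have 2: "\<bar>EG (\<lambda>D. of_bool (deg n m D w = k) * open_paths D w) - ?M\<bar> \<le> open_path_err" .
  show ?thesis using 1 2 by (simp add: mult.assoc)
qed

end

definition set_deg_law :: "nat pmf" where "set_deg_law = map_pmf (set_deg 0) Q"

lemma expectation_P:
  "measure_pmf.expectation P h = (\<Sum>s\<le>m. h s * pmf P s)"
  by (rule integral_measure_pmf_real) (use supp in auto)

text \<open>A set joins \<open>w\<close> to \<open>j \<ge> 1\<close> other vertices if it has size \<open>j + 1\<close> and contains \<open>w\<close>: the origin of the
size-biased law with a shift by one.\<close>

lemma pmf_set_deg:
  assumes w: "w < m" and j: "1 \<le> j"
  shows "pmf (map_pmf (set_deg w) Q) j = (real j + 1) * pmf P (j + 1) / real m"
proof -
  have "pmf (map_pmf (set_deg w) Q) j = EQ (\<lambda>X. of_bool (set_deg w X = j))"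
    unfolding expectation_of_bool by (simp add: pmf_map vimage_def)
  also have "\<dots> = EQ (\<lambda>X. of_bool ({w} \<subseteq> X) * of_bool (card X = j + 1))"
    using j by (intro Bochner_Integration.integral_cong) (auto simp: set_deg_def)
  also have "\<dots> = measure_pmf.expectation P (\<lambda>s. of_bool (s = j + 1) * real s) / real m"
    using w EQ_superset[of "{w}" "\<lambda>s. of_bool (s = j + 1)"] by (simp add: falling_factorial_def)
  also have "measure_pmf.expectation P (\<lambda>s. of_bool (s = j + 1) * real s) = (real j + 1) * pmf P (j + 1)"
    by (subst integral_measure_pmf_real[of "{j + 1}"]) auto
  finally show ?thesis .
qed

lemma pmf_set_deg_0:
  assumes w: "w < m"
  shows "1 - pmf (map_pmf (set_deg w) Q) 0 = (factorial_moment P 1 - pmf P 1) / real m"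
proof -
  have "1 - pmf (map_pmf (set_deg w) Q) 0 = 1 - EQ (\<lambda>X. of_bool (set_deg w X = 0))"
    unfolding expectation_of_bool by (simp add: pmf_map vimage_def)
  also have "\<dots> = EQ (\<lambda>X. 1 - of_bool (set_deg w X = 0))" by simp
  also have "\<dots> = EQ (\<lambda>X. of_bool ({w} \<subseteq> X) * of_bool (card X \<noteq> 1))"
  proof (rule EQ_cong)
    fix X assume "X \<subseteq> W"
    then have "finite X" using finite_subset by blast
    then have "card X \<noteq> 0" if "w \<in> X" using that by auto
    then have "set_deg w X = 0 \<longleftrightarrow> \<not> ({w} \<subseteq> X \<and> card X \<noteq> 1)"
      unfolding set_deg_def by (cases "card X") auto
    then show "1 - of_bool (set_deg w X = 0) = (of_bool ({w} \<subseteq> X) * of_bool (card X \<noteq> 1) :: real)"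
      by (simp only: of_bool_def) auto
  qed
  also have "\<dots> = measure_pmf.expectation P (\<lambda>s. of_bool (s \<noteq> 1) * real s) / real m"
    using w EQ_superset[of "{w}" "\<lambda>s. of_bool (s \<noteq> 1)"] by (simp add: falling_factorial_def)
  also have "measure_pmf.expectation P (\<lambda>s. of_bool (s \<noteq> 1) * real s) = factorial_moment P 1 - pmf P 1"
  proof -
    have "measure_pmf.expectation P (\<lambda>s. of_bool (s \<noteq> 1) * real s)
        = measure_pmf.expectation P (\<lambda>s. real s - of_bool (s = 1))"
      by (intro Bochner_Integration.integral_cong) auto
    also have "\<dots> = (\<Sum>s\<le>m. real s * pmf P s) - (\<Sum>s\<le>m. of_bool (s = 1) * pmf P s)"
      unfolding expectation_P by (simp only: left_diff_distrib sum_subtractf)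
    also have "(\<Sum>s\<le>m. of_bool (s = 1) * pmf P s) = (\<Sum>s\<le>m. if s = 1 then pmf P s else 0)"
      by (intro sum.cong) auto
    also have "\<dots> = pmf P 1" using m_ge by (subst sum.delta) auto
    also have "(\<Sum>s\<le>m. real s * pmf P s) = factorial_moment P 1"
      unfolding factorial_moment_def expectation_P by (simp add: falling_factorial_def)
    finally show ?thesis .
  qed
  finally show ?thesis .
qed

lemma map_set_deg_eq_law:
  assumes w: "w < m"
  shows "map_pmf (set_deg w) Q = set_deg_law"
proof (rule pmf_eqI)
  fix j
  have 0: "0 < m" using m_ge by simp
  show "pmf (map_pmf (set_deg w) Q) j = pmf set_deg_law j"
    unfolding set_deg_law_def
    using pmf_set_deg[OF w, of j] pmf_set_deg[OF 0, of j] pmf_set_deg_0[OF w] pmf_set_deg_0[OF 0]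
    by (cases "j = 0") auto
qed

lemma EG_multi_deg_law:
  assumes w: "w < m"
  shows "EG (\<lambda>D. of_bool (multi_deg D w = k)) = pmf (iid_sum set_deg_law n) k"
    and "EG (\<lambda>D. of_bool (multi_deg D w = k) * set_pairs D w)
      = measure_pmf.expectation (Pi_pmf {..<n} 0 (\<lambda>_. set_deg_law))
          (\<lambda>x. of_bool ((\<Sum>i<n. x i) = k) * (\<Sum>i<n. falling_factorial (real (x i)) 2))"
proof -
  have Pi: "Pi_pmf {..<n} 0 (\<lambda>_. set_deg_law) = map_pmf (\<lambda>D. set_deg w \<circ> D) G"
    unfolding map_set_deg_eq_law[OF w, symmetric] by (rule Pi_pmf_map) (simp_all add: set_deg_def)
  show "EG (\<lambda>D. of_bool (multi_deg D w = k)) = pmf (iid_sum set_deg_law n) k"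
    unfolding iid_sum_def Pi expectation_of_bool multi_deg_def
    by (simp add: pmf_map vimage_def pmf.map_comp o_def)
  show "EG (\<lambda>D. of_bool (multi_deg D w = k) * set_pairs D w)
      = measure_pmf.expectation (Pi_pmf {..<n} 0 (\<lambda>_. set_deg_law))
          (\<lambda>x. of_bool ((\<Sum>i<n. x i) = k) * (\<Sum>i<n. falling_factorial (real (x i)) 2))"
    unfolding Pi integral_map_pmf multi_deg_def set_pairs_def o_def ..
qed

text \<open>Averages over the vertices, as the uniform random pair produces them; the estimates hold for each summand.\<close>

definition avg_deg_prob :: "nat \<Rightarrow> real" where
  "avg_deg_prob k = (\<Sum>w<m. EG (\<lambda>D. of_bool (deg n m D w = k))) / m"
definition avg_triangles :: "nat \<Rightarrow> real" where
  "avg_triangles k = (\<Sum>w<m. EG (\<lambda>D. of_bool (deg n m D w = k) * triangles D w)) / m"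
definition avg_open_paths :: "nat \<Rightarrow> real" where
  "avg_open_paths k = (\<Sum>w<m. EG (\<lambda>D. of_bool (deg n m D w = k) * open_paths D w)) / m"

lemma average_close:
  assumes "\<And>w. w < m \<Longrightarrow> \<bar>f w - c * g w\<bar> \<le> (e :: real)"
  shows "\<bar>(\<Sum>w<m. f w) / m - c * ((\<Sum>w<m. g w) / m)\<bar> \<le> e"
proof -
  have m: "real m > 0" using m_ge by simp
  have eq: "(\<Sum>w<m. f w) / m - c * ((\<Sum>w<m. g w) / m) = (\<Sum>w<m. f w - c * g w) / m"
    by (simp add: sum_subtractf sum_distrib_left diff_divide_distrib)
  have "\<bar>(\<Sum>w<m. f w) / m - c * ((\<Sum>w<m. g w) / m)\<bar> \<le> (\<Sum>w<m. e) / m"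
    unfolding eq abs_divide abs_of_pos[OF m] using m
    by (intro divide_right_mono order_trans[OF sum_abs] sum_mono assms) auto
  also have "\<dots> = e" using m by simp
  finally show ?thesis .
qed

lemma avg_deg_prob_close: "\<bar>avg_deg_prob k - pmf (iid_sum set_deg_law n) k\<bar> \<le> deg_err"
  using average_close[of "\<lambda>w. EG (\<lambda>D. of_bool (deg n m D w = k))" "pmf (iid_sum set_deg_law n) k" "\<lambda>_. 1" deg_err]
    prob_deg_close[of _ k] m_ge EG_multi_deg_law(1)[of _ k]
  by (simp add: avg_deg_prob_def)

lemma avg_triangles_close:
  "\<bar>avg_triangles k - measure_pmf.expectation (Pi_pmf {..<n} 0 (\<lambda>_. set_deg_law))
      (\<lambda>x. of_bool ((\<Sum>i<n. x i) = k) * (\<Sum>i<n. falling_factorial (real (x i)) 2))\<bar>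
    \<le> triangle_err + (real k)\<^sup>2 * deg_err"
  using average_close[of "\<lambda>w. EG (\<lambda>D. of_bool (deg n m D w = k) * triangles D w)"
      "measure_pmf.expectation (Pi_pmf {..<n} 0 (\<lambda>_. set_deg_law))
      (\<lambda>x. of_bool ((\<Sum>i<n. x i) = k) * (\<Sum>i<n. falling_factorial (real (x i)) 2))" "\<lambda>_. 1"
      "triangle_err + (real k)\<^sup>2 * deg_err"]
    triangles_close[of _ k] m_ge EG_multi_deg_law(2)[of _ k]
  by (simp add: avg_triangles_def)

lemma avg_open_paths_close:
  "\<bar>avg_open_paths k - real n * (hit 2 - hit 3) * (real m - 2) * k * avg_deg_prob k\<bar>
    \<le> real n * (hit 2 - hit 3) * (real m - 2) * k * hit 1 + open_path_err"
  unfolding avg_open_paths_def avg_deg_prob_def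
  by (rule average_close) (rule open_paths_close)

lemma sum_edge_deg_prob:
  "(\<Sum>(v, w)\<in>ordered_pairs m. EG (\<lambda>D. of_bool (adj D v w \<and> deg n m D w = k)))
    = k * (\<Sum>w<m. EG (\<lambda>D. of_bool (deg n m D w = k)))"
proof -
  have one: "(\<Sum>v\<in>W - {w}. EG (\<lambda>D. of_bool (adj D v w \<and> deg n m D w = k)))
      = k * EG (\<lambda>D. of_bool (deg n m D w = k))" for w
  proof -
    have "(\<Sum>v\<in>W - {w}. EG (\<lambda>D. of_bool (adj D v w \<and> deg n m D w = k)))
        = EG (\<lambda>D. real (deg n m D w) * of_bool (deg n m D w = k))"
      unfolding real_deg sum_distrib_right EG_sum
      by (intro sum.cong refl Bochner_Integration.integral_cong) (auto simp: adj_commute)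
    also have "\<dots> = EG (\<lambda>D. real k * of_bool (deg n m D w = k))"
      by (intro Bochner_Integration.integral_cong) auto
    finally show ?thesis by simp
  qed
  show ?thesis
    unfolding sum_ordered_pairs(2) one sum_distrib_left ..
qed

lemma h_mean_deg_eq:
  assumes k: "k > 0" and pos: "avg_deg_prob k > 0"
  shows "h_mean_deg k n m P = avg_triangles k / (k * avg_deg_prob k)"
proof -
  have m: "real m > 0" using m_ge by simp
  let ?s = "\<Sum>w<m. EG (\<lambda>D. of_bool (deg n m D w = k))"
  have s: "?s > 0" using pos m by (simp add: avg_deg_prob_def zero_less_divide_iff)
  have num: "(\<Sum>(v, w)\<in>ordered_pairs m. EG (\<lambda>D. of_bool (adj D v w \<and> deg n m D w = k) * real (common_deg n m D v w)))
      = (\<Sum>w<m. EG (\<lambda>D. of_bool (deg n m D w = k) * triangles D w))"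
  proof -
    have "of_bool (adj D v w \<and> deg n m D w = k) * real (common_deg n m D v w)
        = of_bool (deg n m D w = k) * (\<Sum>u\<in>W - {v, w}. of_bool (adj D v w \<and> adj D v u \<and> adj D w u))" for D v w
      unfolding real_common_deg sum_distrib_left by (intro sum.cong) auto
    then show ?thesis
      unfolding sum_ordered_pairs(2) by (simp only: triangles_def sum_distrib_left EG_sum)
  qed
  have "h_mean_deg k n m P = (\<Sum>w<m. EG (\<lambda>D. of_bool (deg n m D w = k) * triangles D w)) / (k * ?s)"
    unfolding h_mean_deg_def using k s
    by (subst expectation_given_passive_model) (simp_all only: sum_edge_deg_prob num of_nat_0_less_iff mult_pos_pos)
  also have "\<dots> = avg_triangles k / (k * avg_deg_prob k)"
    using m by (simp add: avg_triangles_def avg_deg_prob_def)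
  finally show ?thesis .
qed

lemma b_mean_deg_eq:
  assumes k: "k > 0" and pos: "avg_deg_prob k > 0"
  shows "b_mean_deg k n m P = 1 + h_mean_deg k n m P + avg_open_paths k / (k * avg_deg_prob k)"
proof -
  have m: "real m > 0" using m_ge by simp
  let ?s = "\<Sum>w<m. EG (\<lambda>D. of_bool (deg n m D w = k))"
  let ?t = "\<Sum>w<m. EG (\<lambda>D. of_bool (deg n m D w = k) * triangles D w)"
  let ?o = "\<Sum>w<m. EG (\<lambda>D. of_bool (deg n m D w = k) * open_paths D w)"
  have s: "?s > 0" using pos m by (simp add: avg_deg_prob_def zero_less_divide_iff)
  have num: "(\<Sum>(v, w)\<in>ordered_pairs m. EG (\<lambda>D. of_bool (adj D v w \<and> deg n m D w = k) * real (deg n m D v)))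
      = k * ?s + ?t + ?o"
  proof -
    have one: "of_bool (adj D v w \<and> deg n m D w = k) * real (deg n m D v)
        = of_bool (adj D v w \<and> deg n m D w = k)
          + of_bool (deg n m D w = k) * (\<Sum>u\<in>W - {v, w}. of_bool (adj D v w \<and> adj D v u \<and> adj D w u))
          + of_bool (deg n m D w = k) * (\<Sum>u\<in>W - {v, w}. of_bool (adj D v w \<and> adj D v u \<and> \<not> adj D w u))"
      if "v < m" "w < m" "v \<noteq> w" for D v w
    proof -
      have W: "W - {v} = insert w (W - {v, w})" using that by auto
      have "of_bool (adj D v w \<and> deg n m D w = k) * real (deg n m D v)
        = of_bool (adj D v w \<and> deg n m D w = k) * (of_bool (adj D v w)
           + (\<Sum>u\<in>W - {v, w}. of_bool (adj D v u)))"
        unfolding real_deg[of D v] by (subst W, subst sum.insert) auto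
      also have "\<dots> = of_bool (adj D v w \<and> deg n m D w = k)
          + (\<Sum>u\<in>W - {v, w}. of_bool (deg n m D w = k) * of_bool (adj D v w \<and> adj D v u \<and> adj D w u)
            + of_bool (deg n m D w = k) * of_bool (adj D v w \<and> adj D v u \<and> \<not> adj D w u))"
        unfolding distrib_left sum_distrib_left
        by (intro arg_cong2[where f = "(+)"] sum.cong) auto
      finally show ?thesis by (simp only: sum.distrib sum_distrib_left add.assoc)
    qed
    have "(\<Sum>(v, w)\<in>ordered_pairs m. EG (\<lambda>D. of_bool (adj D v w \<and> deg n m D w = k) * real (deg n m D v)))
       = (\<Sum>w<m. \<Sum>v\<in>W - {w}. EG (\<lambda>D. of_bool (adj D v w \<and> deg n m D w = k))
          + EG (\<lambda>D. of_bool (deg n m D w = k) * (\<Sum>u\<in>W - {v, w}. of_bool (adj D v w \<and> adj D v u \<and> adj D w u)))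
          + EG (\<lambda>D. of_bool (deg n m D w = k) * (\<Sum>u\<in>W - {v, w}. of_bool (adj D v w \<and> adj D v u \<and> \<not> adj D w u))))"
      unfolding sum_ordered_pairs(2)
      by (intro sum.cong refl, subst one)
         (simp_all only: Bochner_Integration.integral_add[OF integrable_G integrable_G] lessThan_iff Diff_iff singleton_iff not_False_eq_True)
    also have "\<dots> = (\<Sum>w<m. \<Sum>v\<in>W - {w}. EG (\<lambda>D. of_bool (adj D v w \<and> deg n m D w = k))) + ?t + ?o"
      by (simp only: sum.distrib triangles_def open_paths_def sum_distrib_left EG_sum)
    also have "(\<Sum>w<m. \<Sum>v\<in>W - {w}. EG (\<lambda>D. of_bool (adj D v w \<and> deg n m D w = k))) = k * ?s"
      by (simp only: sum_edge_deg_prob flip: sum_ordered_pairs(2))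
    finally show ?thesis .
  qed
  have "b_mean_deg k n m P = (k * ?s + ?t + ?o) / (k * ?s)"
    unfolding b_mean_deg_def using k s
    by (subst expectation_given_passive_model) (simp_all only: sum_edge_deg_prob num of_nat_0_less_iff mult_pos_pos)
  also have "\<dots> = 1 + ?t / (k * ?s) + ?o / (k * ?s)"
    using k s by (simp add: add_divide_distrib)
  also have "\<dots> = 1 + h_mean_deg k n m P + avg_open_paths k / (k * avg_deg_prob k)"
    using m unfolding h_mean_deg_eq[OF assms] by (simp add: avg_triangles_def avg_deg_prob_def avg_open_paths_def)
  finally show ?thesis .
qed

section \<open>Expansion of the subgraph probabilities\<close>

lemma hit_bounds: "0 \<le> hit 2" "0 \<le> hit 3" "hit 3 \<le> hit 2" "hit 2 \<le> 1" "2 * hit 2 - hit 3 \<le> 1"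
  "3 * hit 2 - 2 * hit 3 \<le> 1"
proof -
  have lt: "0 < m" "1 < m" "2 < m" using m_ge by auto
  have nn: "0 \<le> EQ (\<lambda>D. of_bool (R D))" for R
    by (intro Bochner_Integration.integral_nonneg) auto
  show "0 \<le> hit 2" "0 \<le> hit 3" by (rule hit_nonneg)+
  show "hit 3 \<le> hit 2" by (rule hit3_le_hit2)
  have ne: "(0::nat) \<noteq> 1" "(0::nat) \<noteq> 2" "(1::nat) \<noteq> 2" by auto
  show "hit 2 \<le> 1"
    using nn[of "\<lambda>D. \<not> (0 \<in> D \<and> 1 \<in> D)"] unfolding EQ_no_edge[OF lt ne] by simp
  show "2 * hit 2 - hit 3 \<le> 1"
    using nn[of "\<lambda>D. \<not> (0 \<in> D \<and> 1 \<in> D) \<and> \<not> (0 \<in> D \<and> 2 \<in> D)"]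
    unfolding EQ_no_path[OF lt ne] by simp
  show "3 * hit 2 - 2 * hit 3 \<le> 1"
    using nn[of "\<lambda>D. \<not> (0 \<in> D \<and> 1 \<in> D) \<and> \<not> (0 \<in> D \<and> 2 \<in> D) \<and> \<not> (1 \<in> D \<and> 2 \<in> D)"]
    unfolding EQ_no_triangle[OF lt ne] by simp
qed

lemma edge_prob_approx: "\<bar>edge_prob - n * hit 2\<bar> \<le> (n * hit 2)\<^sup>2"
  using one_minus_power_first_order[OF hit_bounds(1,4), of n] unfolding edge_prob_def
  by (simp add: abs_le_iff)

lemma common_set_prob_approx: "\<bar>common_set_prob - n * hit 3\<bar> \<le> (n * hit 3)\<^sup>2"
  using one_minus_power_first_order[OF hit_bounds(2) order_trans[OF hit_bounds(3,4)], of n]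
  unfolding common_set_prob_def by (simp add: abs_le_iff)

text \<open>The pairs of distinct sets, one for each edge, give \<open>(n q)\<^sup>2\<close>; a single set containing the path gives \<open>n r\<close>.\<close>

lemma path_prob_approx:
  "\<bar>path_prob - (n * hit 3 + (n * hit 2)\<^sup>2)\<bar> \<le> 10 * (n * hit 2) ^ 3 + n * (hit 2)\<^sup>2 + 2 * (n * hit 2) * (n * hit 3)"
proof -
  define q r N where "q = hit 2" and "r = hit 3" and "N = real n"
  have b: "0 \<le> q" "0 \<le> r" "r \<le> q" "q \<le> 1" "2 * q - r \<le> 1" "0 \<le> N"
    using hit_bounds by (auto simp: q_def r_def N_def)
  have 1: "\<bar>(1 - q) ^ n - (1 - N * q + N * (N - 1) / 2 * q\<^sup>2)\<bar> \<le> (N * q) ^ 3"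
    using one_minus_power_approx[of q n] b by (simp add: N_def)
  have 2: "\<bar>(1 - (2 * q - r)) ^ n - (1 - N * (2 * q - r) + N * (N - 1) / 2 * (2 * q - r)\<^sup>2)\<bar> \<le> (N * (2 * q - r)) ^ 3"
    using one_minus_power_approx[of "2 * q - r" n] b by (simp add: N_def)
  have "(N * (2 * q - r)) ^ 3 \<le> (2 * (N * q)) ^ 3"
    using b by (intro power_mono) (auto simp: mult_left_mono algebra_simps)
  then have cube2: "(N * (2 * q - r)) ^ 3 \<le> 8 * (N * q) ^ 3"
    by (simp add: power_mult_distrib)
  have "(1 - 2 * (1 - N * q + N * (N - 1) / 2 * q\<^sup>2) + (1 - N * (2 * q - r) + N * (N - 1) / 2 * (2 * q - r)\<^sup>2))
      - (N * r + (N * q)\<^sup>2) = - (N * q\<^sup>2) - N * (N - 1) * (2 * q * r - r\<^sup>2 / 2)"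
    by (simp add: field_simps power2_eq_square)
  moreover have "\<bar>- (N * q\<^sup>2) - N * (N - 1) * (2 * q * r - r\<^sup>2 / 2)\<bar> \<le> N * q\<^sup>2 + 2 * (N * q) * (N * r)"
  proof -
    have N1: "0 \<le> N * (N - 1)" "N * (N - 1) \<le> N * N"
      using b by (cases "n = 0", auto simp: N_def algebra_simps)
    have "r * r \<le> 4 * (q * r)" using b mult_right_mono[of r "4 * q" r] by simp
    then have qr: "0 \<le> 2 * q * r - r\<^sup>2 / 2" "2 * q * r - r\<^sup>2 / 2 \<le> 2 * q * r"
      by (auto simp: power2_eq_square)
    have "N * (N - 1) * (2 * q * r - r\<^sup>2 / 2) \<le> N * N * (2 * q * r)"
      by (rule mult_mono[OF N1(2) qr(2) _ qr(1)]) simp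
    moreover have "0 \<le> N * (N - 1) * (2 * q * r - r\<^sup>2 / 2)" "0 \<le> N * q\<^sup>2"
      using N1(1) qr(1) b by (auto intro: mult_nonneg_nonneg)
    ultimately show ?thesis by (simp add: abs_le_iff mult_ac)
  qed
  ultimately have 3: "\<bar>(1 - 2 * (1 - N * q + N * (N - 1) / 2 * q\<^sup>2) + (1 - N * (2 * q - r) + N * (N - 1) / 2 * (2 * q - r)\<^sup>2))
      - (N * r + (N * q)\<^sup>2)\<bar> \<le> N * q\<^sup>2 + 2 * (N * q) * (N * r)" by simp
  have "\<bar>(1 - 2 * (1 - q) ^ n + (1 - (2 * q - r)) ^ n) - (N * r + (N * q)\<^sup>2)\<bar>
      \<le> 10 * (N * q) ^ 3 + N * q\<^sup>2 + 2 * (N * q) * (N * r)"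
  proof -
    have "\<bar>(1 - 2 * A + B) - t\<bar> \<le> 10 * c + e"
      if "\<bar>A - a\<bar> \<le> c" "\<bar>B - b\<bar> \<le> d" "d \<le> 8 * c" "\<bar>(1 - 2 * a + b) - t\<bar> \<le> e" for A B a b c d e t :: real
      using that by linarith
    from this[OF 1 2 cube2 3] show ?thesis by simp
  qed
  then show ?thesis by (simp add: path_prob_def q_def r_def N_def)
qed

text \<open>A set with at most two of the three vertices yields at most one edge, so two sets produce a triangle only if one of
them contains all three vertices. Up to second order the triangle probability is therefore that of a common set, and the
remaining configurations need three sets.\<close>

lemma triangle_prob_approx: "\<bar>triangle_prob - n * hit 3\<bar> \<le> 54 * (n * hit 2) ^ 3 + (n * hit 3)\<^sup>2"
proof -
  define q r N where "q = hit 2" and "r = hit 3" and "N = real n"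
  have b: "0 \<le> q" "0 \<le> r" "r \<le> q" "q \<le> 1" "2 * q - r \<le> 1" "3 * q - 2 * r \<le> 1" "0 \<le> N"
    using hit_bounds by (auto simp: q_def r_def N_def)
  have 1: "\<bar>(1 - q) ^ n - (1 - N * q + N * (N - 1) / 2 * q\<^sup>2)\<bar> \<le> (N * q) ^ 3"
    using one_minus_power_approx[of q n] b by (simp add: N_def)
  have 2: "\<bar>(1 - (2 * q - r)) ^ n - (1 - N * (2 * q - r) + N * (N - 1) / 2 * (2 * q - r)\<^sup>2)\<bar> \<le> (N * (2 * q - r)) ^ 3"
    using one_minus_power_approx[of "2 * q - r" n] b by (simp add: N_def)
  have 3: "\<bar>(1 - (3 * q - 2 * r)) ^ n - (1 - N * (3 * q - 2 * r) + N * (N - 1) / 2 * (3 * q - 2 * r)\<^sup>2)\<bar>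
      \<le> (N * (3 * q - 2 * r)) ^ 3"
    using one_minus_power_approx[of "3 * q - 2 * r" n] b by (simp add: N_def)
  have "(N * (2 * q - r)) ^ 3 \<le> (2 * (N * q)) ^ 3"
    using b by (intro power_mono) (auto simp: mult_left_mono algebra_simps)
  then have cube2: "(N * (2 * q - r)) ^ 3 \<le> 8 * (N * q) ^ 3"
    by (simp add: power_mult_distrib)
  have "(N * (3 * q - 2 * r)) ^ 3 \<le> (3 * (N * q)) ^ 3"
    using b by (intro power_mono) (auto simp: mult_left_mono algebra_simps)
  then have cube3: "(N * (3 * q - 2 * r)) ^ 3 \<le> 27 * (N * q) ^ 3"
    by (simp add: power_mult_distrib)
  \<comment> \<open>Here \<open>-3 q\<^sup>2 + 3 (2 q - r)\<^sup>2 - (3 q - 2 r)\<^sup>2 = - r\<^sup>2\<close>.\<close>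
  have eq: "(1 - 3 * (1 - N * q + N * (N - 1) / 2 * q\<^sup>2) + 3 * (1 - N * (2 * q - r) + N * (N - 1) / 2 * (2 * q - r)\<^sup>2)
      - (1 - N * (3 * q - 2 * r) + N * (N - 1) / 2 * (3 * q - 2 * r)\<^sup>2)) - N * r
      = - (N * (N - 1) / 2 * r\<^sup>2)"
    by (simp add: field_simps power2_eq_square)
  have N1: "0 \<le> N * (N - 1) / 2" "N * (N - 1) / 2 \<le> N * N"
    using b by (cases "n = 0", auto simp: N_def field_simps)
  have "0 \<le> N * (N - 1) / 2 * r\<^sup>2" using N1(1) by (rule mult_nonneg_nonneg) simp
  moreover have "N * (N - 1) / 2 * r\<^sup>2 \<le> (N * r)\<^sup>2"
    using mult_right_mono[OF N1(2), of "r\<^sup>2"] by (simp add: power2_eq_square mult_ac)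
  ultimately have "\<bar>(1 - 3 * (1 - q) ^ n + 3 * (1 - (2 * q - r)) ^ n - (1 - (3 * q - 2 * r)) ^ n) - N * r\<bar>
      \<le> 54 * (N * q) ^ 3 + (N * r)\<^sup>2"
  proof -
    assume s: "0 \<le> N * (N - 1) / 2 * r\<^sup>2" "N * (N - 1) / 2 * r\<^sup>2 \<le> (N * r)\<^sup>2"
    have "\<bar>(1 - 3 * A + 3 * B - C) - t\<bar> \<le> 54 * x + e"
      if "\<bar>A - a\<bar> \<le> x" "\<bar>B - b\<bar> \<le> d" "d \<le> 8 * x" "\<bar>C - c\<bar> \<le> g" "g \<le> 27 * x"
        "(1 - 3 * a + 3 * b - c) - t = - f" "0 \<le> f" "f \<le> e" for A B C a b c d e f g t x :: real
      using that by linarith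
    from this[OF 1 2 cube2 3 cube3 eq s] show ?thesis .
  qed
  then show ?thesis by (simp add: triangle_prob_def q_def r_def N_def)
qed

end

section \<open>Orders of magnitude\<close>

text \<open>Integer exponents make the orders of products additive; inverses of quantities with a nonzero rescaled limit have the opposite order.\<close>

abbreviation of_order :: "int \<Rightarrow> (nat \<Rightarrow> real) \<Rightarrow> bool" where
  "of_order k f \<equiv> f \<in> O(\<lambda>n. real n powi k)"

lemma of_order_mult:
  assumes "of_order k f" "of_order l g"
  shows "of_order (k + l) (\<lambda>n. f n * g n)"
proof -
  have "(\<lambda>n. f n * g n) \<in> O(\<lambda>n. real n powi k * real n powi l)"
    using assms by (rule landau_o.big.mult)
  moreover have "\<forall>\<^sub>F n in sequentially. real n powi k * real n powi l = real n powi (k + l)"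
    using eventually_gt_at_top[of 0] by eventually_elim (simp add: power_int_add)
  ultimately show ?thesis by (simp cong: landau_o.big.cong)
qed

lemma of_order_mono:
  assumes "of_order k f" "k \<le> l"
  shows "of_order l f"
proof -
  have "(\<lambda>n. real n powi k) \<in> O(\<lambda>n. real n powi l)"
  proof (rule landau_o.big_mono)
    show "\<forall>\<^sub>F n in sequentially. norm (real n powi k) \<le> norm (real n powi l)"
      using eventually_ge_at_top[of 1]
    proof eventually_elim
      case (elim n)
      then show ?case using power_int_increasing[OF assms(2), of "real n"] by simp
    qed
  qed
  with assms(1) show ?thesis by (rule landau_o.big_trans)
qed

lemma of_order_add: "of_order k f \<Longrightarrow> of_order k g \<Longrightarrow> of_order k (\<lambda>n. f n + g n)"
  by (rule sum_in_bigo)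

lemma of_order_diff: "of_order k f \<Longrightarrow> of_order k g \<Longrightarrow> of_order k (\<lambda>n. f n - g n)"
  by (rule sum_in_bigo)

lemma of_order_n: "of_order 1 (\<lambda>n. real n)"
  by simp

lemma of_order_bound:
  assumes "of_order k g" "\<forall>\<^sub>F n in sequentially. \<bar>f n\<bar> \<le> g n"
  shows "of_order k f"
proof -
  have "f \<in> O(g)"
    using assms(2) by (intro landau_o.big_mono) (auto elim!: eventually_mono)
  then show ?thesis using assms(1) by (rule landau_o.big_trans)
qed

lemma of_order_tendsto:
  assumes "(\<lambda>n. f n * real n powi (- k)) \<longlonglongrightarrow> c"
  shows "of_order k f"
proof (rule bigoI_tendsto)
  show "((\<lambda>n. f n / real n powi k) \<longlongrightarrow> c) sequentially"
    using assms by (simp add: power_int_minus divide_inverse)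
  show "\<forall>\<^sub>F n in sequentially. real n powi k \<noteq> 0"
    using eventually_gt_at_top[of 0] by eventually_elim simp
qed

lemma of_order_inverse:
  assumes "(\<lambda>n. f n * real n powi (- k)) \<longlonglongrightarrow> c" "c \<noteq> 0"
  shows "of_order (- k) (\<lambda>n. inverse (f n))"
proof (rule of_order_tendsto)
  show "(\<lambda>n. inverse (f n) * real n powi (- (- k))) \<longlonglongrightarrow> inverse c"
    using tendsto_inverse[OF assms] by (simp add: power_int_minus)
qed

lemma of_order_neg_tendsto_0:
  assumes "of_order k f" "k < 0"
  shows "f \<longlonglongrightarrow> 0"
proof -
  have "of_order (-1) f" using assms by (intro of_order_mono[OF assms(1)]) auto
  moreover have "(\<lambda>n. real n powi (-1)) \<in> o(\<lambda>_. 1)"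
    using lim_inverse_n by (intro smalloI_tendsto) (auto simp: power_int_minus)
  ultimately have "f \<in> o(\<lambda>_. 1)" by (rule landau_o.big_small_trans)
  then show ?thesis using smalloD_tendsto by fastforce
qed

section \<open>Asymptotics along the sequence of graphs\<close>

locale passive_graph_sequence =
  fixes m :: "nat \<Rightarrow> nat" and P :: "nat \<Rightarrow> nat pmf" and Z :: "nat pmf" and \<beta> :: real
  assumes supp: "\<And>n. n \<ge> 1 \<Longrightarrow> set_pmf (P n) \<subseteq> {..m n}"
    and m_lim: "filterlim m at_top sequentially"
    and beta_pos: "\<beta> > 0"
    and beta_lim: "(\<lambda>n. real (m n) / real n) \<longlonglongrightarrow> \<beta>"
    and X_lim: "weak_conv_m (\<lambda>n. distr (measure_pmf (P n)) borel real) (distr (measure_pmf Z) borel real)"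
    and Z_ge2: "measure_pmf.prob Z {z. z \<ge> 2} > 0"
    and Z_mom4: "integrable (measure_pmf Z) (\<lambda>z. real z ^ 4)"
    and X_mom4: "(\<lambda>n. measure_pmf.expectation (P n) (\<lambda>x. real x ^ 4))
                   \<longlonglongrightarrow> measure_pmf.expectation Z (\<lambda>z. real z ^ 4)"
begin

abbreviation y :: "nat \<Rightarrow> nat \<Rightarrow> real" where "y i n \<equiv> factorial_moment (P n) i"
abbreviation z :: "nat \<Rightarrow> real" where "z i \<equiv> factorial_moment Z i"
abbreviation hit :: "nat \<Rightarrow> nat \<Rightarrow> real" where "hit a n \<equiv> passive_graph.hit (m n) (P n) a"
abbreviation edge :: "nat \<Rightarrow> real" where "edge n \<equiv> passive_graph.edge_prob n (m n) (P n)"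
abbreviation path :: "nat \<Rightarrow> real" where "path n \<equiv> passive_graph.path_prob n (m n) (P n)"
abbreviation tri :: "nat \<Rightarrow> real" where "tri n \<equiv> passive_graph.triangle_prob n (m n) (P n)"
abbreviation css :: "nat \<Rightarrow> real" where "css n \<equiv> passive_graph.common_set_prob n (m n) (P n)"

lemma eventually_graph: "\<forall>\<^sub>F n in sequentially. n \<ge> 1 \<and> passive_graph (m n) (P n) \<and> real (m n) \<ge> 3"
proof -
  have "\<forall>\<^sub>F n in sequentially. 3 \<le> m n"
    using m_lim by (simp add: filterlim_at_top)
  then show ?thesis
    using eventually_ge_at_top[of 1]
  proof eventually_elim
    case (elim n)
    then show ?case using supp[of n] by (simp add: passive_graph_def)
  qed
qed

lemma pmf_lim: "(\<lambda>n. pmf (P n) j) \<longlonglongrightarrow> pmf Z j"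
  using X_lim by (rule pmf_tendsto_of_weak_conv)

lemma moment_lim:
  assumes "1 \<le> i" "i \<le> 4"
  shows "(\<lambda>n. y i n) \<longlonglongrightarrow> z i"
  unfolding factorial_moment_def
proof (rule expectation_tendsto_of_dominating[OF pmf_lim])
  show "\<forall>\<^sub>F n in sequentially. integrable (measure_pmf (P n)) (\<lambda>x. real x ^ 4)"
    using eventually_ge_at_top[of 1]
  proof eventually_elim
    case (elim n)
    then have "finite (set_pmf (P n))" using supp finite_subset by blast
    then show ?case by (rule integrable_measure_pmf_finite)
  qed
qed (use Z_mom4 X_mom4 falling_factorial_le_power4[OF assms] in auto)

lemma z_integrable: "1 \<le> i \<Longrightarrow> i \<le> 4 \<Longrightarrow> integrable (measure_pmf Z) (\<lambda>x. falling_factorial (real x) i)"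
  using Z_mom4 by (rule Bochner_Integration.integrable_bound) (use falling_factorial_le_power4 in auto)

lemma z_1: "z 1 = measure_pmf.expectation Z real" "integrable (measure_pmf Z) real"
  using z_integrable[of 1] by (simp_all add: factorial_moment_def falling_factorial_real)

lemma z_pos: "0 < z 1" "0 < z 2"
proof -
  have le: "measure_pmf.prob Z {x. x \<ge> 2} \<le> z i" if "i \<in> {1, 2}" for i
  proof -
    have "measure_pmf.prob Z {x. x \<ge> 2} = measure_pmf.expectation Z (indicator {x. x \<ge> 2})" by simp
    also have "\<dots> \<le> z i"
      unfolding factorial_moment_def
    proof (rule integral_mono)
      fix x :: nat
      have "1 \<le> falling_factorial (real x) i" if x: "x \<ge> 2"
      proof -
        have "1 * 1 \<le> real x * (real x - 1)" using x by (intro mult_mono) auto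
        then show ?thesis using x \<open>i \<in> {1, 2}\<close> by (auto simp: falling_factorial_real)
      qed
      then show "indicator {x. x \<ge> 2} x \<le> falling_factorial (real x) i"
        using falling_factorial_nonneg[of x i] by (auto simp: indicator_def)
    next
      show "integrable (measure_pmf Z) (indicator {x. x \<ge> 2} :: nat \<Rightarrow> real)"
        by (rule measure_pmf.integrable_const_bound[where B = 1]) (auto simp: indicator_def)
    qed (use that z_integrable in auto)
    finally show ?thesis .
  qed
  show "0 < z 1" "0 < z 2" using le[of 1] le[of 2] Z_ge2 by auto
qed

sublocale limit: compound_poisson_limit \<beta> Z
  using beta_pos z_1 z_pos by unfold_locales simp_all

lemma m_ratio_lim: "(\<lambda>n. (real (m n) - c) / real n) \<longlonglongrightarrow> \<beta>" "(\<lambda>n. real n / (real (m n) - c)) \<longlonglongrightarrow> 1 / \<beta>"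
proof -
  have "(\<lambda>n. real (m n) / real n - c * (1 / real n)) \<longlonglongrightarrow> \<beta> - c * 0"
    by (intro tendsto_intros beta_lim lim_1_over_n)
  then show 1: "(\<lambda>n. (real (m n) - c) / real n) \<longlonglongrightarrow> \<beta>" by (simp add: diff_divide_distrib)
  show "(\<lambda>n. real n / (real (m n) - c)) \<longlonglongrightarrow> 1 / \<beta>"
    using tendsto_inverse[OF 1] beta_pos by (simp add: divide_inverse mult.commute)
qed

text \<open>The shift \<open>c\<close> covers the factors \<open>m\<close>, \<open>m - 1\<close> and \<open>m - 2\<close>.\<close>

lemma order_m: "of_order 1 (\<lambda>n. real (m n) - c)"
  by (rule of_order_tendsto) (use m_ratio_lim(1)[of c] in \<open>simp add: power_int_minus divide_inverse\<close>)

lemma hit_eq: "\<forall>\<^sub>F n in sequentially. hit 1 n = y 1 n / real (m n)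
    \<and> hit 2 n = y 2 n / (real (m n) * (real (m n) - 1))
    \<and> hit 3 n = y 3 n / (real (m n) * (real (m n) - 1) * (real (m n) - 2))"
  using eventually_graph
  by eventually_elim (simp add: passive_graph.hit_def falling_factorial_real)

lemma hit2_lim: "(\<lambda>n. hit 2 n * real n powi (- (- 2))) \<longlonglongrightarrow> z 2 / \<beta>\<^sup>2"
proof -
  have "(\<lambda>n. y 2 n * (real n / (real (m n) - 0)) * (real n / (real (m n) - 1))) \<longlonglongrightarrow> z 2 * (1 / \<beta>) * (1 / \<beta>)"
    by (intro tendsto_mult moment_lim m_ratio_lim) auto
  moreover have "\<forall>\<^sub>F n in sequentially. y 2 n * (real n / (real (m n) - 0)) * (real n / (real (m n) - 1))
      = hit 2 n * real n powi (- (- 2))"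
    using hit_eq by eventually_elim (simp add: power2_eq_square)
  ultimately show ?thesis by (simp add: Lim_transform_eventually power2_eq_square)
qed

lemma hit3_lim: "(\<lambda>n. hit 3 n * real n powi (- (- 3))) \<longlonglongrightarrow> z 3 / \<beta> ^ 3"
proof -
  have "(\<lambda>n. y 3 n * (real n / (real (m n) - 0)) * (real n / (real (m n) - 1)) * (real n / (real (m n) - 2)))
      \<longlonglongrightarrow> z 3 * (1 / \<beta>) * (1 / \<beta>) * (1 / \<beta>)"
    by (intro tendsto_mult moment_lim m_ratio_lim) auto
  moreover have "\<forall>\<^sub>F n in sequentially.
      y 3 n * (real n / (real (m n) - 0)) * (real n / (real (m n) - 1)) * (real n / (real (m n) - 2))
      = hit 3 n * real n powi (- (- 3))"
    using hit_eq by eventually_elim (simp add: power3_eq_cube)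
  ultimately show ?thesis by (simp add: Lim_transform_eventually power3_eq_cube)
qed

lemma hit1_lim: "(\<lambda>n. hit 1 n * real n powi (- (- 1))) \<longlonglongrightarrow> z 1 / \<beta>"
proof -
  have "(\<lambda>n. y 1 n * (real n / (real (m n) - 0))) \<longlonglongrightarrow> z 1 * (1 / \<beta>)"
    by (intro tendsto_mult moment_lim m_ratio_lim) auto
  moreover have "\<forall>\<^sub>F n in sequentially. y 1 n * (real n / (real (m n) - 0)) = hit 1 n * real n powi (- (- 1))"
    using hit_eq by eventually_elim simp
  ultimately show ?thesis by (simp add: Lim_transform_eventually)
qed

lemma order_hit: "of_order (-1) (hit 1)" "of_order (-2) (hit 2)" "of_order (-3) (hit 3)"
  using of_order_tendsto[OF hit1_lim] of_order_tendsto[OF hit2_lim] of_order_tendsto[OF hit3_lim] by simp_all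

lemma order_n_hit: "of_order (-1) (\<lambda>n. real n * hit 2 n)" "of_order (-2) (\<lambda>n. real n * hit 3 n)"
  using of_order_mult[OF of_order_n order_hit(2)] of_order_mult[OF of_order_n order_hit(3)] by simp_all

lemma order_power:
  assumes "of_order k f"
  shows "of_order (2 * k) (\<lambda>n. (f n)\<^sup>2)" "of_order (3 * k) (\<lambda>n. f n ^ 3)"
proof -
  have "of_order (k + k) (\<lambda>n. f n * f n)" "of_order (k + k + k) (\<lambda>n. f n * f n * f n)"
    by (intro of_order_mult assms)+
  then show "of_order (2 * k) (\<lambda>n. (f n)\<^sup>2)" "of_order (3 * k) (\<lambda>n. f n ^ 3)"
    by (simp_all add: power2_eq_square power3_eq_cube)
qed

lemma order_edge: "of_order (-2) (\<lambda>n. edge n - real n * hit 2 n)"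
proof (rule of_order_bound)
  show "of_order (-2) (\<lambda>n. (real n * hit 2 n)\<^sup>2)" using order_power(1)[OF order_n_hit(1)] by simp
  show "\<forall>\<^sub>F n in sequentially. \<bar>edge n - real n * hit 2 n\<bar> \<le> (real n * hit 2 n)\<^sup>2"
    using eventually_graph by eventually_elim (simp add: passive_graph.edge_prob_approx)
qed

lemma order_css: "of_order (-3) (\<lambda>n. css n - real n * hit 3 n)"
proof (rule of_order_bound)
  show "of_order (-3) (\<lambda>n. (real n * hit 3 n)\<^sup>2)"
    using of_order_mono[OF order_power(1)[OF order_n_hit(2)]] by simp
  show "\<forall>\<^sub>F n in sequentially. \<bar>css n - real n * hit 3 n\<bar> \<le> (real n * hit 3 n)\<^sup>2"
    using eventually_graph by eventually_elim (simp add: passive_graph.common_set_prob_approx)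
qed

lemma order_tri: "of_order (-3) (\<lambda>n. tri n - real n * hit 3 n)"
proof (rule of_order_bound)
  show "of_order (-3) (\<lambda>n. 54 * (real n * hit 2 n) ^ 3 + (real n * hit 3 n)\<^sup>2)"
  proof (rule of_order_add)
    show "of_order (-3) (\<lambda>n. 54 * (real n * hit 2 n) ^ 3)"
      using order_power(2)[OF order_n_hit(1)] by simp
    show "of_order (-3) (\<lambda>n. (real n * hit 3 n)\<^sup>2)"
      using of_order_mono[OF order_power(1)[OF order_n_hit(2)]] by simp
  qed
  show "\<forall>\<^sub>F n in sequentially. \<bar>tri n - real n * hit 3 n\<bar> \<le> 54 * (real n * hit 2 n) ^ 3 + (real n * hit 3 n)\<^sup>2"
    using eventually_graph by eventually_elim (simp add: passive_graph.triangle_prob_approx)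
qed

lemma order_path: "of_order (-3) (\<lambda>n. path n - (real n * hit 3 n + (real n * hit 2 n)\<^sup>2))"
proof (rule of_order_bound)
  show "of_order (-3) (\<lambda>n. 10 * (real n * hit 2 n) ^ 3 + real n * (hit 2 n)\<^sup>2 + 2 * (real n * hit 2 n) * (real n * hit 3 n))"
  proof (intro of_order_add)
    show "of_order (-3) (\<lambda>n. 10 * (real n * hit 2 n) ^ 3)"
      using order_power(2)[OF order_n_hit(1)] by simp
    show "of_order (-3) (\<lambda>n. real n * (hit 2 n)\<^sup>2)"
      using of_order_mult[OF of_order_n order_power(1)[OF order_hit(2)]] by simp
    show "of_order (-3) (\<lambda>n. 2 * (real n * hit 2 n) * (real n * hit 3 n))"
      using of_order_mult[OF order_n_hit] by (simp add: mult.assoc)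
  qed
  show "\<forall>\<^sub>F n in sequentially. \<bar>path n - (real n * hit 3 n + (real n * hit 2 n)\<^sup>2)\<bar>
      \<le> 10 * (real n * hit 2 n) ^ 3 + real n * (hit 2 n)\<^sup>2 + 2 * (real n * hit 2 n) * (real n * hit 3 n)"
    using eventually_graph by eventually_elim (simp only: passive_graph.path_prob_approx)
qed

lemma edge_lim: "(\<lambda>n. edge n * real n powi (- (- 1))) \<longlonglongrightarrow> z 2 / \<beta>\<^sup>2"
proof -
  have "of_order (-1) (\<lambda>n. real n * (edge n - real n * hit 2 n))"
    using of_order_mult[OF of_order_n order_edge] by simp
  then have "(\<lambda>n. real n * (edge n - real n * hit 2 n)) \<longlonglongrightarrow> 0"
    by (rule of_order_neg_tendsto_0) simp
  then have "(\<lambda>n. real n * (edge n - real n * hit 2 n) + hit 2 n * real n powi (- (- 2))) \<longlonglongrightarrow> 0 + z 2 / \<beta>\<^sup>2"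
    by (rule tendsto_add[OF _ hit2_lim])
  then show ?thesis by (simp add: algebra_simps power2_eq_square)
qed

lemma order_inverse: "of_order 1 (\<lambda>n. inverse (edge n))" "of_order 2 (\<lambda>n. inverse (hit 2 n))"
  using of_order_inverse[OF edge_lim] of_order_inverse[OF hit2_lim] z_pos beta_pos by simp_all

lemma eventually_pos: "\<forall>\<^sub>F n in sequentially. 0 < edge n \<and> 0 < hit 2 n \<and> 0 < y 2 n"
proof -
  have pos: "0 < z 2 / \<beta>\<^sup>2" using z_pos beta_pos by simp
  have "\<forall>\<^sub>F n in sequentially. 0 < edge n * real n powi (- (- 1))"
    "\<forall>\<^sub>F n in sequentially. 0 < hit 2 n * real n powi (- (- 2))"
    "\<forall>\<^sub>F n in sequentially. 0 < y 2 n"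
    using order_tendstoD(1)[OF edge_lim pos] order_tendstoD(1)[OF hit2_lim pos]
      order_tendstoD(1)[OF moment_lim[of 2] z_pos(2)] by simp_all
  then show ?thesis
    by eventually_elim (auto simp: zero_less_mult_iff)
qed

lemma order_triangle_err: "of_order (-1) (\<lambda>n. (real (m n) - 1) * (real (m n) - 2)
    * ((tri n - css n) + (real n * hit 3 n - css n)))"
proof -
  have "of_order (-3) (\<lambda>n. (tri n - real n * hit 3 n) - (css n - real n * hit 3 n) - (css n - real n * hit 3 n))"
    by (intro of_order_diff order_tri order_css)
  from of_order_mult[OF of_order_mult[OF order_m[of 1] order_m[of 2]] this]
  show ?thesis by (simp add: algebra_simps)
qed

text \<open>The leading terms \<open>(n q)\<^sup>2\<close> of \<open>n q edge\<close> and \<open>path\<close> cancel, and so do the terms \<open>n r\<close> of \<open>path\<close> and \<open>triangle\<close>.\<close>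

lemma order_open_path_err: "of_order (-1) (\<lambda>n. (real (m n) - 1) * (real (m n) - 2)
    * (real n * (hit 2 n - hit 3 n) * edge n - (path n - tri n)))"
proof -
  let ?e = "\<lambda>n. edge n - real n * hit 2 n" and ?t = "\<lambda>n. tri n - real n * hit 3 n"
    and ?p = "\<lambda>n. path n - (real n * hit 3 n + (real n * hit 2 n)\<^sup>2)"
  have oe: "of_order (-1) edge" using of_order_tendsto[OF edge_lim] by simp
  have "of_order (-3) (\<lambda>n. real n * hit 2 n * ?e n - real n * hit 3 n * edge n - (?p n - ?t n))"
    using of_order_mult[OF order_n_hit(1) order_edge] of_order_mult[OF order_n_hit(2) oe]
    by (intro of_order_diff order_tri order_path) simp_all
  from of_order_mult[OF of_order_mult[OF order_m[of 1] order_m[of 2]] this]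
  have "of_order (-1) (\<lambda>n. (real (m n) - 1) * (real (m n) - 2) *
      (real n * hit 2 n * ?e n - real n * hit 3 n * edge n - (?p n - ?t n)))" by simp
  moreover have "real n * hit 2 n * ?e n - real n * hit 3 n * edge n - (?p n - ?t n)
      = real n * (hit 2 n - hit 3 n) * edge n - (path n - tri n)" for n
    by (simp add: algebra_simps power2_eq_square)
  ultimately show ?thesis by (simp only:)
qed

lemma order_deg_err: "of_order (-1) (\<lambda>n. (real (m n) - 1) * (real n * hit 2 n - edge n))"
proof -
  have "of_order (-2) (\<lambda>n. real n * hit 2 n - edge n)"
    using order_edge by (subst landau_o.big.uminus_in_iff[symmetric]) simp
  from of_order_mult[OF order_m[of 1] this] show ?thesis by simp
qed

text \<open>Since \<open>y\<^sub>3 / y\<^sub>2 = (m - 2) r / q\<close> exactly, the error is \<open>m - 2\<close> times the difference of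
\<open>triangle / edge\<close> and \<open>n r / (n q)\<close>, hence of order \<open>1 - 5 + 1 + 2 = -1\<close> after clearing denominators.\<close>

lemma h_mean_approx: "of_order (-1) (\<lambda>n. h_mean n (m n) (P n) - y 3 n / y 2 n)"
proof -
  let ?e = "\<lambda>n. edge n - real n * hit 2 n" and ?t = "\<lambda>n. tri n - real n * hit 3 n"
  have "of_order (-5) (\<lambda>n. ?t n * hit 2 n - hit 3 n * ?e n)"
    using of_order_mult[OF order_tri order_hit(2)] of_order_mult[OF order_hit(3) order_edge]
    by (intro of_order_diff) simp_all
  from of_order_mult[OF of_order_mult[OF order_m[of 2] this] of_order_mult[OF order_inverse]]
  have "of_order (-1) (\<lambda>n. (real (m n) - 2) * (?t n * hit 2 n - hit 3 n * ?e n) * (inverse (edge n) * inverse (hit 2 n)))"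
    by simp
  moreover have "\<forall>\<^sub>F n in sequentially. h_mean n (m n) (P n) - y 3 n / y 2 n
      = (real (m n) - 2) * (?t n * hit 2 n - hit 3 n * ?e n) * (inverse (edge n) * inverse (hit 2 n))"
    using eventually_graph eventually_pos hit_eq
  proof eventually_elim
    case (elim n)
    have "h_mean n (m n) (P n) = (real (m n) - 2) * tri n / edge n"
      using elim by (intro passive_graph.h_mean_eq) auto
    moreover have "y 3 n / y 2 n = (real (m n) - 2) * hit 3 n / hit 2 n"
      using elim by simp
    moreover have "(real (m n) - 2) * tri n / edge n - (real (m n) - 2) * hit 3 n / hit 2 n
        = (real (m n) - 2) * (?t n * hit 2 n - hit 3 n * ?e n) * (inverse (edge n) * inverse (hit 2 n))"
      using elim(2) by (simp add: field_simps)
    ultimately show ?case by simp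
  qed
  ultimately show ?thesis by (simp cong: landau_o.big.in_cong)
qed

text \<open>As for \<open>h_mean_approx\<close>, with the extra term \<open>(n q)\<^sup>2\<close> of the path probability, which produces \<open>n (m - 2) q\<close>; replacing
this by \<open>n (m - 1) q = y\<^sub>2 / \<beta>\<^sub>n\<close> costs \<open>n q = O(1/n)\<close>.\<close>

lemma b_mean_approx:
  "of_order (-1) (\<lambda>n. b_mean n (m n) (P n) - (1 + y 2 n / (real (m n) / real n) + y 3 n / y 2 n))"
proof -
  let ?e = "\<lambda>n. edge n - real n * hit 2 n"
    and ?p = "\<lambda>n. path n - (real n * hit 3 n + (real n * hit 2 n)\<^sup>2)"
  have "of_order (-5) (\<lambda>n. ?p n * hit 2 n - hit 3 n * ?e n - real n * hit 2 n * (hit 2 n * ?e n))"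
    using of_order_mult[OF order_path order_hit(2)] of_order_mult[OF order_hit(3) order_edge]
      of_order_mult[OF order_n_hit(1) of_order_mult[OF order_hit(2) order_edge]]
    by (intro of_order_diff) simp_all
  from of_order_mult[OF of_order_mult[OF order_m[of 2] this] of_order_mult[OF order_inverse]]
  have "of_order (-1) (\<lambda>n. (real (m n) - 2) * (?p n * hit 2 n - hit 3 n * ?e n - real n * hit 2 n * (hit 2 n * ?e n))
      * (inverse (edge n) * inverse (hit 2 n)))"
    by simp
  from of_order_diff[OF this order_n_hit(1)]
  have "of_order (-1) (\<lambda>n. (real (m n) - 2) * (?p n * hit 2 n - hit 3 n * ?e n - real n * hit 2 n * (hit 2 n * ?e n))
      * (inverse (edge n) * inverse (hit 2 n)) - real n * hit 2 n)" .
  moreover have "\<forall>\<^sub>F n in sequentially.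
      b_mean n (m n) (P n) - (1 + y 2 n / (real (m n) / real n) + y 3 n / y 2 n)
      = (real (m n) - 2) * (?p n * hit 2 n - hit 3 n * ?e n - real n * hit 2 n * (hit 2 n * ?e n))
      * (inverse (edge n) * inverse (hit 2 n)) - real n * hit 2 n"
    using eventually_graph eventually_pos hit_eq
  proof eventually_elim
    case (elim n)
    have "b_mean n (m n) (P n) = 1 + (real (m n) - 2) * path n / edge n"
      using elim by (intro passive_graph.b_mean_eq) auto
    moreover have "y 3 n / y 2 n = (real (m n) - 2) * hit 3 n / hit 2 n"
      using elim by simp
    moreover have "y 2 n / (real (m n) / real n) = real n * (real (m n) - 1) * hit 2 n"
      using elim by simp
    moreover have "(1 + (real (m n) - 2) * path n / edge n)
          - (1 + real n * (real (m n) - 1) * hit 2 n + (real (m n) - 2) * hit 3 n / hit 2 n)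
        = (real (m n) - 2) * (?p n * hit 2 n - hit 3 n * ?e n - real n * hit 2 n * (hit 2 n * ?e n))
      * (inverse (edge n) * inverse (hit 2 n)) - real n * hit 2 n"
      using elim(2) by (simp add: field_simps power2_eq_square)
    ultimately show ?case by simp
  qed
  ultimately show ?thesis by (simp cong: landau_o.big.in_cong)
qed

abbreviation law :: "nat \<Rightarrow> nat pmf" where "law n \<equiv> passive_graph.set_deg_law (m n) (P n)"
abbreviation deg_prob :: "nat \<Rightarrow> nat \<Rightarrow> real" where
  "deg_prob k n \<equiv> passive_graph.avg_deg_prob n (m n) (P n) k"
abbreviation tri_avg :: "nat \<Rightarrow> nat \<Rightarrow> real" where
  "tri_avg k n \<equiv> passive_graph.avg_triangles n (m n) (P n) k"
abbreviation open_avg :: "nat \<Rightarrow> nat \<Rightarrow> real" where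
  "open_avg k n \<equiv> passive_graph.avg_open_paths n (m n) (P n) k"

text \<open>With \<open>law_lim_0\<close>, the two hypotheses of the Poisson limit theorem \<open>iid_sum_tendsto_d_law\<close>.\<close>

lemma law_lim:
  assumes "j \<ge> 1"
  shows "(\<lambda>n. real n * pmf (law n) j) \<longlonglongrightarrow> limit.intensity j"
proof -
  have "(\<lambda>n. (real j + 1) * pmf (P n) (j + 1) * (real n / (real (m n) - 0))) \<longlonglongrightarrow> (real j + 1) * pmf Z (j + 1) * (1 / \<beta>)"
    by (intro tendsto_intros pmf_lim m_ratio_lim)
  moreover have "\<forall>\<^sub>F n in sequentially. (real j + 1) * pmf (P n) (j + 1) * (real n / (real (m n) - 0)) = real n * pmf (law n) j"
    using eventually_graph
  proof eventually_elim
    case (elim n)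
    then interpret g: passive_graph n "m n" "P n" by simp
    show ?case using g.pmf_set_deg[of 0 j] elim assms by (simp add: g.set_deg_law_def)
  qed
  ultimately show ?thesis by (simp add: Lim_transform_eventually limit.intensity_def)
qed

lemma law_lim_0: "(\<lambda>n. real n * (1 - pmf (law n) 0)) \<longlonglongrightarrow> limit.rate - limit.intensity 0"
proof -
  have "(\<lambda>n. (y 1 n - pmf (P n) 1) * (real n / (real (m n) - 0))) \<longlonglongrightarrow> (z 1 - pmf Z 1) * (1 / \<beta>)"
    by (intro tendsto_intros pmf_lim m_ratio_lim moment_lim) auto
  moreover have "\<forall>\<^sub>F n in sequentially. (y 1 n - pmf (P n) 1) * (real n / (real (m n) - 0)) = real n * (1 - pmf (law n) 0)"
    using eventually_graph
  proof eventually_elim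
    case (elim n)
    then interpret g: passive_graph n "m n" "P n" by simp
    show ?case using g.pmf_set_deg_0[of 0] elim by (simp add: g.set_deg_law_def)
  qed
  ultimately have "(\<lambda>n. real n * (1 - pmf (law n) 0)) \<longlonglongrightarrow> (z 1 - pmf Z 1) * (1 / \<beta>)"
    by (rule Lim_transform_eventually)
  moreover have "(z 1 - pmf Z 1) * (1 / \<beta>) = limit.rate - limit.intensity 0"
    unfolding z_1 limit.rate_def limit.intensity_def by (simp add: diff_divide_distrib)
  ultimately show ?thesis by simp
qed

lemma tendsto_of_close:
  fixes f g e :: "nat \<Rightarrow> real"
  assumes "of_order (-1) e" "\<forall>\<^sub>F n in sequentially. \<bar>f n - g n\<bar> \<le> e n" "g \<longlonglongrightarrow> l"
  shows "f \<longlonglongrightarrow> l"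
proof -
  have "e \<longlonglongrightarrow> 0" by (rule of_order_neg_tendsto_0[OF assms(1)]) simp
  then have "(\<lambda>n. f n - g n) \<longlonglongrightarrow> 0"
    by (rule Lim_null_comparison[rotated]) (use assms(2) in simp)
  from tendsto_add[OF this assms(3)] show ?thesis by simp
qed

lemma deg_prob_lim: "deg_prob k \<longlonglongrightarrow> pmf limit.d_law k"
proof (rule tendsto_of_close[OF order_deg_err])
  show "\<forall>\<^sub>F n in sequentially. \<bar>deg_prob k n - pmf (iid_sum (law n) n) k\<bar>
      \<le> (real (m n) - 1) * (real n * hit 2 n - edge n)"
    using eventually_graph
  proof eventually_elim
    case (elim n)
    then interpret g: passive_graph n "m n" "P n" by simp
    show ?case using g.avg_deg_prob_close by (simp add: g.deg_err_def)
  qed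
  show "(\<lambda>n. pmf (iid_sum (law n) n) k) \<longlonglongrightarrow> pmf limit.d_law k"
    by (rule limit.iid_sum_tendsto_d_law(1)[OF law_lim law_lim_0])
qed

lemma tri_avg_lim:
  "tri_avg k \<longlonglongrightarrow> measure_pmf.expectation (limit_model \<beta> Z) (\<lambda>\<omega>. of_bool (d_ss \<omega> = k) * d_2s \<omega>)"
proof (rule tendsto_of_close)
  show "of_order (-1) (\<lambda>n. (real (m n) - 1) * (real (m n) - 2) * ((tri n - css n) + (real n * hit 3 n - css n))
      + (real k)\<^sup>2 * ((real (m n) - 1) * (real n * hit 2 n - edge n)))"
    using order_deg_err by (intro of_order_add order_triangle_err) simp
  show "\<forall>\<^sub>F n in sequentially. \<bar>tri_avg k n - measure_pmf.expectation (Pi_pmf {..<n} 0 (\<lambda>_. law n))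
      (\<lambda>x. of_bool ((\<Sum>i<n. x i) = k) * (\<Sum>i<n. falling_factorial (real (x i)) 2))\<bar>
      \<le> (real (m n) - 1) * (real (m n) - 2) * ((tri n - css n) + (real n * hit 3 n - css n))
      + (real k)\<^sup>2 * ((real (m n) - 1) * (real n * hit 2 n - edge n))"
    using eventually_graph
  proof eventually_elim
    case (elim n)
    then interpret g: passive_graph n "m n" "P n" by simp
    show ?case using g.avg_triangles_close[of k] by (simp add: g.deg_err_def g.triangle_err_def)
  qed
  have d2: "d_2s = (\<lambda>\<omega>. \<Sum>j<fst \<omega>. falling_factorial (real (snd \<omega> j)) 2)"
    by (simp add: d_2s_def case_prod_unfold)
  show "(\<lambda>n. measure_pmf.expectation (Pi_pmf {..<n} 0 (\<lambda>_. law n))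
      (\<lambda>x. of_bool ((\<Sum>i<n. x i) = k) * (\<Sum>i<n. falling_factorial (real (x i)) 2)))
    \<longlonglongrightarrow> measure_pmf.expectation (limit_model \<beta> Z) (\<lambda>\<omega>. of_bool (d_ss \<omega> = k) * d_2s \<omega>)"
    unfolding d2
    by (rule limit.expectation_iid_sum_tendsto[OF law_lim law_lim_0])
       (simp_all add: falling_factorial_nonneg, simp add: falling_factorial_real)
qed

lemma open_avg_lim: "open_avg k \<longlonglongrightarrow> z 2 / \<beta> * k * pmf limit.d_law k"
proof (rule tendsto_of_close)
  let ?c = "\<lambda>n. real n * (hit 2 n - hit 3 n) * (real (m n) - 2) * k"
  have c_lim: "?c \<longlonglongrightarrow> z 2 / \<beta> * k"
  proof -
    have "of_order (-1) (\<lambda>n. real n * hit 3 n * (real (m n) - 2))"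
      using of_order_mult[OF order_n_hit(2) order_m[of 2]] by simp
    then have r: "(\<lambda>n. real n * hit 3 n * (real (m n) - 2)) \<longlonglongrightarrow> 0"
      by (rule of_order_neg_tendsto_0) simp
    have "(\<lambda>n. (hit 2 n * real n powi (- (- 2)) * ((real (m n) - 2) / real n)
        - real n * hit 3 n * (real (m n) - 2)) * k) \<longlonglongrightarrow> (z 2 / \<beta>\<^sup>2 * \<beta> - 0) * k"
      by (intro tendsto_intros hit2_lim m_ratio_lim r)
    moreover have "\<forall>\<^sub>F n in sequentially. (hit 2 n * real n powi (- (- 2)) * ((real (m n) - 2) / real n)
        - real n * hit 3 n * (real (m n) - 2)) * k = ?c n"
      using eventually_gt_at_top[of 0] by eventually_elim (simp add: field_simps power2_eq_square)
    ultimately show ?thesis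
      using beta_pos by (simp add: Lim_transform_eventually power2_eq_square)
  qed
  show "(\<lambda>n. ?c n * deg_prob k n) \<longlonglongrightarrow> z 2 / \<beta> * k * pmf limit.d_law k"
    by (intro tendsto_mult c_lim deg_prob_lim)
  show "of_order (-1) (\<lambda>n. ?c n * hit 1 n + (real (m n) - 1) * (real (m n) - 2)
      * (real n * (hit 2 n - hit 3 n) * edge n - (path n - tri n)))"
  proof (intro of_order_add order_open_path_err)
    have "of_order 0 ?c" by (rule of_order_tendsto) (use c_lim in simp)
    from of_order_mult[OF this order_hit(1)] show "of_order (-1) (\<lambda>n. ?c n * hit 1 n)" by simp
  qed
  show "\<forall>\<^sub>F n in sequentially. \<bar>open_avg k n - ?c n * deg_prob k n\<bar>
      \<le> ?c n * hit 1 n + (real (m n) - 1) * (real (m n) - 2)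
        * (real n * (hit 2 n - hit 3 n) * edge n - (path n - tri n))"
    using eventually_graph
  proof eventually_elim
    case (elim n)
    then interpret g: passive_graph n "m n" "P n" by simp
    show ?case using g.avg_open_paths_close[of k] by (simp only: g.open_path_err_def)
  qed
qed

text \<open>The limits of numerators and denominators of the exact formulas; the positive limit of the denominator makes
the conditioning event possible for large \<open>n\<close>.\<close>

lemma conditional_lim:
  assumes k: "k > 0" and pos: "pmf limit.d_law k > 0"
  shows "(\<lambda>n. h_mean_deg k n (m n) (P n)) \<longlonglongrightarrow> expectation_given (limit_model \<beta> Z) {\<omega>. d_ss \<omega> = k} d_2s / real k"
    and "(\<lambda>n. b_mean_deg k n (m n) (P n) - (1 + h_mean_deg k n (m n) (P n))) \<longlonglongrightarrow> z 2 / \<beta>"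
proof -
  have den: "(\<lambda>n. real k * deg_prob k n) \<longlonglongrightarrow> real k * pmf limit.d_law k"
    by (intro tendsto_intros deg_prob_lim)
  have ne: "real k * pmf limit.d_law k \<noteq> 0" using k pos by simp
  have ev: "\<forall>\<^sub>F n in sequentially. deg_prob k n > 0"
    using deg_prob_lim pos by (rule order_tendstoD)
  have "expectation_given (limit_model \<beta> Z) {\<omega>. d_ss \<omega> = k} d_2s / real k
      = measure_pmf.expectation (limit_model \<beta> Z) (\<lambda>\<omega>. of_bool (d_ss \<omega> = k) * d_2s \<omega>) / (real k * pmf limit.d_law k)"
  proof -
    have "measure_pmf.expectation (limit_model \<beta> Z) (\<lambda>\<omega>. indicator {\<omega>. d_ss \<omega> = k} \<omega> * d_2s \<omega>)
        = measure_pmf.expectation (limit_model \<beta> Z) (\<lambda>\<omega>. of_bool (d_ss \<omega> = k) * d_2s \<omega>)"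
      by (intro Bochner_Integration.integral_cong) (auto simp: indicator_def)
    then show ?thesis
      using pos by (subst expectation_given_eq) (simp_all add: limit.pmf_d_law mult.commute)
  qed
  moreover have "(\<lambda>n. tri_avg k n / (real k * deg_prob k n)) \<longlonglongrightarrow>
      measure_pmf.expectation (limit_model \<beta> Z) (\<lambda>\<omega>. of_bool (d_ss \<omega> = k) * d_2s \<omega>) / (real k * pmf limit.d_law k)"
    by (rule tendsto_divide[OF tri_avg_lim den ne])
  moreover have "\<forall>\<^sub>F n in sequentially. tri_avg k n / (real k * deg_prob k n) = h_mean_deg k n (m n) (P n)"
    using eventually_graph ev
    by eventually_elim (use k in \<open>simp add: passive_graph.h_mean_deg_eq\<close>)
  ultimately show "(\<lambda>n. h_mean_deg k n (m n) (P n)) \<longlonglongrightarrow> expectation_given (limit_model \<beta> Z) {\<omega>. d_ss \<omega> = k} d_2s / real k"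
    by (simp add: Lim_transform_eventually)
  have "(\<lambda>n. open_avg k n / (real k * deg_prob k n)) \<longlonglongrightarrow> z 2 / \<beta> * k * pmf limit.d_law k / (real k * pmf limit.d_law k)"
    by (rule tendsto_divide[OF open_avg_lim den ne])
  then have "(\<lambda>n. open_avg k n / (real k * deg_prob k n)) \<longlonglongrightarrow> z 2 / \<beta>"
    using k pos by simp
  moreover have "\<forall>\<^sub>F n in sequentially. open_avg k n / (real k * deg_prob k n)
      = b_mean_deg k n (m n) (P n) - (1 + h_mean_deg k n (m n) (P n))"
    using eventually_graph ev
    by eventually_elim (use k in \<open>simp add: passive_graph.b_mean_deg_eq\<close>)
  ultimately show "(\<lambda>n. b_mean_deg k n (m n) (P n) - (1 + h_mean_deg k n (m n) (P n))) \<longlonglongrightarrow> z 2 / \<beta>"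
    by (rule Lim_transform_eventually)
qed

lemma unconditional_lim:
  "(\<lambda>n. b_mean n (m n) (P n)) \<longlonglongrightarrow> 1 + z 2 / \<beta> + z 3 / z 2"
  "(\<lambda>n. h_mean n (m n) (P n)) \<longlonglongrightarrow> z 3 / z 2"
proof -
  have r: "(\<lambda>n. y 3 n / y 2 n) \<longlonglongrightarrow> z 3 / z 2"
    using z_pos by (intro tendsto_divide moment_lim) auto
  have "(\<lambda>n. b_mean n (m n) (P n) - (1 + y 2 n / (real (m n) / real n) + y 3 n / y 2 n)) \<longlonglongrightarrow> 0"
    by (rule of_order_neg_tendsto_0[OF b_mean_approx]) simp
  moreover have "(\<lambda>n. 1 + y 2 n / (real (m n) / real n) + y 3 n / y 2 n) \<longlonglongrightarrow> 1 + z 2 / \<beta> + z 3 / z 2"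
    using beta_pos by (intro tendsto_intros moment_lim beta_lim r) auto
  ultimately show "(\<lambda>n. b_mean n (m n) (P n)) \<longlonglongrightarrow> 1 + z 2 / \<beta> + z 3 / z 2"
    using tendsto_add by fastforce
  have "(\<lambda>n. h_mean n (m n) (P n) - y 3 n / y 2 n) \<longlonglongrightarrow> 0"
    by (rule of_order_neg_tendsto_0[OF h_mean_approx]) simp
  from tendsto_add[OF this r] show "(\<lambda>n. h_mean n (m n) (P n)) \<longlonglongrightarrow> z 3 / z 2"
    by simp
qed

lemma delta_ratio:
  "delta_s \<beta> Z 1 = z 2 / \<beta>"
  "delta_s \<beta> Z 2 / delta_s \<beta> Z 1 = 1 + z 2 / \<beta> + z 3 / z 2"
proof -
  show 1: "delta_s \<beta> Z 1 = z 2 / \<beta>" by (rule limit.delta_s_1[OF Z_mom4])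
  show "delta_s \<beta> Z 2 / delta_s \<beta> Z 1 = 1 + z 2 / \<beta> + z 3 / z 2"
    unfolding limit.delta_s_2[OF Z_mom4] 1 using beta_pos z_pos
    by (simp add: field_simps power2_eq_square)
qed

end

lemma smallo_1_of_tendsto:
  fixes f :: "nat \<Rightarrow> real"
  assumes "f \<longlonglongrightarrow> c"
  shows "(\<lambda>n. f n - c) \<in> o(\<lambda>_. 1)"
proof (rule smalloI_tendsto)
  show "((\<lambda>n. (f n - c) / 1) \<longlongrightarrow> 0) sequentially"
    using tendsto_diff[OF assms tendsto_const[of c]] by simp
qed simp

section \<open>The conditional means of degrees and common neighbours\<close>

theorem theorem4:
  fixes m :: "nat \<Rightarrow> nat" and P :: "nat \<Rightarrow> nat pmf" and Z :: "nat pmf" and \<beta> :: real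
  assumes supp: "\<And>n. n \<ge> 1 \<Longrightarrow> set_pmf (P n) \<subseteq> {..m n}"
    and m_lim: "filterlim m at_top sequentially"
    and beta_pos: "\<beta> > 0"
    and beta_lim: "(\<lambda>n. real (m n) / real n) \<longlonglongrightarrow> \<beta>"
    and X_lim: "weak_conv_m (\<lambda>n. distr (measure_pmf (P n)) borel real) (distr (measure_pmf Z) borel real)"
    and Z_ge2: "measure_pmf.prob Z {z. z \<ge> 2} > 0"
    and Z_mom4: "integrable (measure_pmf Z) (\<lambda>z. real z ^ 4)"
    and X_mom4: "(\<lambda>n. measure_pmf.expectation (P n) (\<lambda>x. real x ^ 4))
                   \<longlonglongrightarrow> measure_pmf.expectation Z (\<lambda>z. real z ^ 4)"
  shows "(\<lambda>n. b_mean n (m n) (P n)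
          - (1 + factorial_moment (P n) 2 / (real (m n) / real n)
               + factorial_moment (P n) 3 / factorial_moment (P n) 2)) \<in> O(\<lambda>n. 1 / real n)
    \<and> (\<lambda>n. b_mean n (m n) (P n) - delta_s \<beta> Z 2 / delta_s \<beta> Z 1) \<in> o(\<lambda>_. 1)
    \<and> (\<lambda>n. h_mean n (m n) (P n) - factorial_moment (P n) 3 / factorial_moment (P n) 2) \<in> O(\<lambda>n. 1 / real n)
    \<and> (\<lambda>n. h_mean n (m n) (P n) - (delta_s \<beta> Z 2 / delta_s \<beta> Z 1 - 1 - delta_s \<beta> Z 1)) \<in> o(\<lambda>_. 1)
    \<and> (\<forall>k::nat. k > 0 \<longrightarrow> measure_pmf.prob (limit_model \<beta> Z) {\<omega>. d_ss \<omega> = k} > 0 \<longrightarrow>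
         (\<lambda>n. h_mean_deg k n (m n) (P n)
              - expectation_given (limit_model \<beta> Z) {\<omega>. d_ss \<omega> = k} d_2s / real k) \<in> o(\<lambda>_. 1)
       \<and> (\<lambda>n. b_mean_deg k n (m n) (P n)
              - (1 + factorial_moment (P n) 2 / \<beta> + h_mean_deg k n (m n) (P n))) \<in> o(\<lambda>_. 1)
       \<and> (\<lambda>n. b_mean_deg k n (m n) (P n)
              - (1 + delta_s \<beta> Z 1 + h_mean_deg k n (m n) (P n))) \<in> o(\<lambda>_. 1))"
proof -
  interpret passive_graph_sequence m P Z \<beta>
    by unfold_locales (fact supp m_lim beta_pos beta_lim X_lim Z_ge2 Z_mom4 X_mom4)+
  have inv: "(\<lambda>n. real n powi (-1)) = (\<lambda>n. 1 / real n)"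
    by (simp add: power_int_minus divide_inverse)
  have cond: "(\<lambda>n. h_mean_deg k n (m n) (P n)
              - expectation_given (limit_model \<beta> Z) {\<omega>. d_ss \<omega> = k} d_2s / real k) \<in> o(\<lambda>_. 1)"
    "(\<lambda>n. b_mean_deg k n (m n) (P n)
              - (1 + factorial_moment (P n) 2 / \<beta> + h_mean_deg k n (m n) (P n))) \<in> o(\<lambda>_. 1)"
    "(\<lambda>n. b_mean_deg k n (m n) (P n)
              - (1 + delta_s \<beta> Z 1 + h_mean_deg k n (m n) (P n))) \<in> o(\<lambda>_. 1)"
    if k: "k > 0" and pos: "measure_pmf.prob (limit_model \<beta> Z) {\<omega>. d_ss \<omega> = k} > 0" for k
  proof -
    note lim = conditional_lim[OF k pos[folded limit.pmf_d_law]]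
    show "(\<lambda>n. h_mean_deg k n (m n) (P n)
              - expectation_given (limit_model \<beta> Z) {\<omega>. d_ss \<omega> = k} d_2s / real k) \<in> o(\<lambda>_. 1)"
      by (rule smallo_1_of_tendsto[OF lim(1)])
    have "(\<lambda>n. b_mean_deg k n (m n) (P n) - (1 + h_mean_deg k n (m n) (P n)) - y 2 n / \<beta>)
        \<longlonglongrightarrow> z 2 / \<beta> - z 2 / \<beta>"
      using beta_pos by (intro tendsto_diff[OF lim(2)] tendsto_divide moment_lim tendsto_const) auto
    from smallo_1_of_tendsto[OF this]
    show "(\<lambda>n. b_mean_deg k n (m n) (P n)
              - (1 + factorial_moment (P n) 2 / \<beta> + h_mean_deg k n (m n) (P n))) \<in> o(\<lambda>_. 1)"
      by (simp add: algebra_simps)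
    from smallo_1_of_tendsto[OF lim(2)]
    show "(\<lambda>n. b_mean_deg k n (m n) (P n)
              - (1 + delta_s \<beta> Z 1 + h_mean_deg k n (m n) (P n))) \<in> o(\<lambda>_. 1)"
      unfolding delta_ratio(1) by (simp add: algebra_simps)
  qed
  have hd: "delta_s \<beta> Z 2 / delta_s \<beta> Z 1 - 1 - delta_s \<beta> Z 1 = z 3 / z 2"
    unfolding delta_ratio(2) unfolding delta_ratio(1) by simp
  show ?thesis
    using b_mean_approx[unfolded inv] h_mean_approx[unfolded inv]
      smallo_1_of_tendsto[OF unconditional_lim(1)[folded delta_ratio(2)]]
      smallo_1_of_tendsto[OF unconditional_lim(2)[folded hd]] cond
    by blast
qed

end
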